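(* Let $V$ be a superspace over $\mathbb{C}$ with $\dim V=(n,n)$ and let $k,p\ge0$. The collection of inner products $$(v^*_t,v_s),\quad [v^*_t,v_s]\qquad (1\le t\le k,\ 1\le s\le p)$$ is a basic set for the $\mathfrak{q}(V)$-invariants in $\mathfrak{A}^{p}_{k}$.
   Context: All superspaces are over $\mathbb{C}$; $\dim V=(n,n)$ means $\dim V_{\bar 0}=\dim V_{\bar 1}=n$. Let $U=\mathbb{C}^k$, $W=\mathbb{C}^p$ (purely even) and $$\mathfrak{A}^{p}_{k}=S^{\bullet}(V^{k}\oplus V^{*p})=S^{\bullet}(U\otimes V\oplus V^*\otimes W)$$ (symmetric algebra in the super sense), on which $\mathfrak{gl}(V)$, $\mathfrak{gl}(U)$, $\mathfrak{gl}(W)$ act by superderivations. (Since $V\cong\Pi(V)$ as $\mathfrak q(V)$-modules, the algebra $S^{\bullet}(V^{k}\oplus\Pi(V)^{l}\oplus V^{*p}\oplus\Pi(V)^{*q})$ is isomorphic to $\mathfrak{A}^{p+q}_{k+l}$, so only this case need be considered.) For a Lie subsuperalgebra $\mathfrak g\subset\mathfrak{gl}(V)$, an element is $\mathfrak g$-invariant if annihilated by $\mathfrak g$. Polarization operators are the operators given by elements of $U(\mathfrak{gl}(U)\oplus\mathfrak{gl}(W))$. A set $\mathfrak M$ of $\mathfrak g$-invariants is basic if the algebra of $\mathfrak g$-invariants coincides with the least subalgebra containing $\mathfrak M$ and stable under all polarization operators. Let $I=\{1,\dots,n,\bar1,\dots,\bar n\}$ (barred indices odd, unbarred even), $\{e_i\}_{i\in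 I}$ a homogeneous basis of $V$ with parities of the indices, $\{e^*_i\}$ the dual basis of $V^*$, $e_i^*(e_j)=\delta_{ij}$; $\{u_t\}$, $\{w_s\}$ bases of $U$, $W$; $x_{ti}=u_t\otimes e_i$, $x^*_{is}=e^*_i\otimes w_s$. $\mathfrak q(V)\subset\mathfrak{gl}(V)$ is the Lie superalgebra preserving the tensor $\sum_{i=1}^n(e_i\otimes e^*_{\bar i}+e_{\bar i}\otimes e^*_i)$. Finally $$(v^*_t,v_s)=\sum_{i\in I}x_{ti}x^*_{is},\qquad [v^*_t,v_s]=\sum_{i=1}^n\bigl(x_{ti}x^*_{\bar i s}+x_{t\bar i}x^*_{is}\bigr).$$ *)

theory Defs
  imports Complex_Main "HOL-Library.Poly_Mapping"
begin

section \<open>The tensor superalgebra\<close>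

text \<open>
  Words form a free monoid under concatenation, so finitely supported functions on words,
  with the convolution product of \<open>Poly_Mapping\<close>, are the free associative algebra.
\<close>

instantiation list :: (type) monoid_add
begin
definition zero_list :: "'a list" where "zero_list = []"
definition plus_list :: "'a list \<Rightarrow> 'a list \<Rightarrow> 'a list" where "plus_list = (@)"
instance by standard (simp_all add: zero_list_def plus_list_def)
end

text \<open>
  \<open>Ev i\<close> is the even index \<open>i\<close>, \<open>Od i\<close> is the odd index \<open>i\<close> with a bar. Parities are of type
  \<^typ>\<open>bool\<close>, with \<open>True\<close> for odd.
\<close>

datatype idx = Ev nat | Od nat

primrec ipar :: "idx \<Rightarrow> bool" where
  "ipar (Ev i) = False"
| "ipar (Od i) = True"

definition Idx :: "nat \<Rightarrow> idx set" where
  "Idx n = Ev ` {1..n} \<union> Od ` {1..n}"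

text \<open>
  \<open>X t i\<close> is the basis vector \<open>u\<^sub>t \<otimes> e\<^sub>i\<close> of \<open>U \<otimes> V\<close>, and \<open>Xs i s\<close> is the basis vector
  \<open>e\<^sub>i\<^sup>* \<otimes> w\<^sub>s\<close> of \<open>V\<^sup>* \<otimes> W\<close>. The type has infinitely many of them; the sizes \<open>n\<close>, \<open>k\<close>, \<open>p\<close>
  select the finite set \<open>gens n k p\<close>.
\<close>

datatype gen = X nat idx | Xs idx nat

primrec gpar :: "gen \<Rightarrow> bool" where
  "gpar (X t i) = ipar i"
| "gpar (Xs i s) = ipar i"

definition gens :: "nat \<Rightarrow> nat \<Rightarrow> nat \<Rightarrow> gen set" where
  "gens n k p = {X t i | t i. t \<in> {1..k} \<and> i \<in> Idx n} \<union> {Xs i s | i s. i \<in> Idx n \<and> s \<in> {1..p}}"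

type_synonym tens = "gen list \<Rightarrow>\<^sub>0 complex"

definition tscal :: "complex \<Rightarrow> tens" where
  "tscal c = Poly_Mapping.single [] c"

definition tword :: "gen list \<Rightarrow> tens" where
  "tword w = Poly_Mapping.single w 1"

definition ksign :: "bool \<Rightarrow> bool \<Rightarrow> complex" where
  "ksign a b = (if a \<and> b then - 1 else 1)"

text \<open>
  \<open>tder \<epsilon> \<phi>\<close> is the superderivation of parity \<open>\<epsilon>\<close> of the tensor algebra that extends the map \<open>\<phi>\<close>
  on generators.
\<close>

primrec wder :: "bool \<Rightarrow> (gen \<Rightarrow> tens) \<Rightarrow> gen list \<Rightarrow> tens" where
  "wder \<epsilon> \<phi> [] = 0"
| "wder \<epsilon> \<phi> (g # w) =
     \<phi> g * tword w + tscal (ksign \<epsilon> (gpar g)) * tword [g] * wder \<epsilon> \<phi> w"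

definition tder :: "bool \<Rightarrow> (gen \<Rightarrow> tens) \<Rightarrow> tens \<Rightarrow> tens" where
  "tder \<epsilon> \<phi> f = (\<Sum>w\<in>Poly_Mapping.keys f. tscal (Poly_Mapping.lookup f w) * wder \<epsilon> \<phi> w)"

lemma tscal_mult: "tscal a * tscal b = tscal (a * b)"
  by (simp add: tscal_def mult_single plus_list_def)

lemma tscal_add: "tscal (a + b) = tscal a + tscal b"
  by (simp add: tscal_def single_add)

lemma tscal_0 [simp]: "tscal 0 = 0"
  by (simp add: tscal_def)

lemma tscal_1 [simp]: "tscal 1 = 1"
  by (simp add: tscal_def flip: single_one zero_list_def)

lemma tword_mult: "tword v * tword w = tword (v @ w)"
  by (simp add: tword_def mult_single plus_list_def)

lemma tword_Nil: "tword [] = 1"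
  by (simp add: tword_def flip: single_one zero_list_def)

lemma tens_expand: "f = (\<Sum>w\<in>Poly_Mapping.keys f. tscal (Poly_Mapping.lookup f w) * tword w)"
  (is "_ = ?r")
proof (rule poly_mapping_eqI)
  fix v
  have "Poly_Mapping.lookup ?r v =
    (\<Sum>w\<in>Poly_Mapping.keys f. Poly_Mapping.lookup f w when w = v)"
    by (simp add: lookup_sum tscal_def tword_def mult_single plus_list_def lookup_single)
  also have "\<dots> = Poly_Mapping.lookup f v"
    by (auto simp: when_def sum.delta in_keys_iff)
  finally show "Poly_Mapping.lookup f v = Poly_Mapping.lookup ?r v" by simp
qed

lemma tscal_comm: "tscal c * f = f * tscal c"
proof -
  have "tscal c * (\<Sum>w\<in>A. tscal (b w) * tword w) = (\<Sum>w\<in>A. tscal (b w) * tword w) * tscal c"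
    for A b
    by (simp add: sum_distrib_left sum_distrib_right tscal_def tword_def mult_single
        plus_list_def mult.commute)
  from this[where A = "Poly_Mapping.keys f" and b = "Poly_Mapping.lookup f"] show ?thesis
    by (simp flip: tens_expand)
qed

lemma tword_tscal: "tword w * (tscal c * f) = tscal c * (tword w * f)"
  by (simp only: mult.assoc[symmetric] tscal_comm[of c "tword w"])

lemma tword_mult_left: "tword v * (tword w * f) = tword (v @ w) * f"
  by (simp only: mult.assoc[symmetric] tword_mult)

lemma tscal_mult_left: "tscal a * (tscal b * f) = tscal (a * b) * f"
  by (simp only: mult.assoc[symmetric] tscal_mult)

lemmas tens_norm = mult.assoc tword_tscal tword_mult tword_mult_left tscal_mult tscal_mult_left

lemma tens_induct [case_names add word]:
  assumes "\<And>f g. P f \<Longrightarrow> P g \<Longrightarrow> P (f + g)" and "\<And>c w. P (tscal c * tword w)"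
  shows "P f"
proof -
  have z: "P 0" using assms(2)[of 0 "[]"] by simp
  have "P (\<Sum>w\<in>A. tscal (b w) * tword w)" if "finite A" for A b
    using that by induction (use z assms in auto)
  from this[where A = "Poly_Mapping.keys f" and b = "Poly_Mapping.lookup f"] show ?thesis
    by (simp flip: tens_expand)
qed

lemma tder_superset:
  assumes "finite A" "Poly_Mapping.keys f \<subseteq> A"
  shows "tder \<epsilon> \<phi> f = (\<Sum>w\<in>A. tscal (Poly_Mapping.lookup f w) * wder \<epsilon> \<phi> w)"
  unfolding tder_def by (rule sum.mono_neutral_left) (use assms in \<open>auto simp: in_keys_iff\<close>)

lemma tder_add: "tder \<epsilon> \<phi> (f + g) = tder \<epsilon> \<phi> f + tder \<epsilon> \<phi> g"
proof -
  let ?A = "Poly_Mapping.keys f \<union> Poly_Mapping.keys g"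
  have "Poly_Mapping.keys (f + g) \<subseteq> ?A" by (rule keys_add)
  then show ?thesis
    by (simp add: tder_superset[of ?A] lookup_add tscal_add distrib_right sum.distrib)
qed

lemma tder_word: "tder \<epsilon> \<phi> (tscal c * tword w) = tscal c * wder \<epsilon> \<phi> w"
  by (cases "c = 0") (simp_all add: tder_def tscal_def tword_def mult_single plus_list_def)

lemma tder_0 [simp]: "tder \<epsilon> \<phi> 0 = 0"
  by (simp add: tder_def)

lemma tder_tword: "tder \<epsilon> \<phi> (tword w) = wder \<epsilon> \<phi> w"
  using tder_word[of \<epsilon> \<phi> 1 w] by simp

lemma tder_scal: "tder \<epsilon> \<phi> (tscal c * f) = tscal c * tder \<epsilon> \<phi> f"
proof (induction f rule: tens_induct)
  case (add f g)
  then show ?case by (simp add: distrib_left tder_add)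
next
  case (word b w)
  then show ?case by (simp add: tscal_mult_left tder_word)
qed

lemma tder_minus: "tder \<epsilon> \<phi> (- f) = - tder \<epsilon> \<phi> f"
  using tder_add[of \<epsilon> \<phi> f "- f"] by (simp add: eq_neg_iff_add_eq_0 add.commute)

lemma tder_diff: "tder \<epsilon> \<phi> (f - g) = tder \<epsilon> \<phi> f - tder \<epsilon> \<phi> g"
  using tder_add[of \<epsilon> \<phi> f "- g"] by (simp add: tder_minus)

lemma tder_Cons:
  "tder \<epsilon> \<phi> (tword [g] * f) = \<phi> g * f + tscal (ksign \<epsilon> (gpar g)) * tword [g] * tder \<epsilon> \<phi> f"
proof (induction f rule: tens_induct)
  case (add f h)
  then show ?case by (simp add: distrib_left tder_add)
next
  case (word c w)
  have "\<phi> g * (tscal c * tword w) = tscal c * (\<phi> g * tword w)"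
    by (simp only: mult.assoc[symmetric] tscal_comm[of c "\<phi> g"])
  then show ?case
    by (simp add: tens_norm tder_word distrib_left mult.commute)
qed

section \<open>The symmetric superalgebra\<close>

text \<open>The two-sided ideal generated by the supercommutators of generators.\<close>

inductive_set sideal :: "tens set" where
  rel: "a * (tword [g, h] - tscal (ksign (gpar g) (gpar h)) * tword [h, g]) * b \<in> sideal"
| zero: "0 \<in> sideal"
| add: "f \<in> sideal \<Longrightarrow> f' \<in> sideal \<Longrightarrow> f + f' \<in> sideal"

lemma sideal_mult: "f \<in> sideal \<Longrightarrow> c * f * d \<in> sideal"
proof (induction rule: sideal.induct)
  case (rel a g h b)
  have "c * (a * (tword [g, h] - tscal (ksign (gpar g) (gpar h)) * tword [h, g]) * b) * d =
    (c * a) * (tword [g, h] - tscal (ksign (gpar g) (gpar h)) * tword [h, g]) * (b * d)"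
    by (simp add: mult.assoc)
  then show ?case by (metis sideal.rel)
qed (auto intro: sideal.intros simp: distrib_left distrib_right)

lemma sideal_mult_left: "f \<in> sideal \<Longrightarrow> c * f \<in> sideal"
  using sideal_mult[of f c 1] by simp

lemma sideal_mult_right: "f \<in> sideal \<Longrightarrow> f * d \<in> sideal"
  using sideal_mult[of f 1 d] by simp

lemma sideal_minus: "f \<in> sideal \<Longrightarrow> - f \<in> sideal"
  using sideal_mult_left[of f "- 1"] by simp

lemma sideal_diff: "f \<in> sideal \<Longrightarrow> g \<in> sideal \<Longrightarrow> f - g \<in> sideal"
  using sideal.add[of f "- g"] by (simp add: sideal_minus)

lemma sideal_sum: "(\<And>x. x \<in> A \<Longrightarrow> f x \<in> sideal) \<Longrightarrow> sum f A \<in> sideal"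
  by (induction A rule: infinite_finite_induct) (auto intro: sideal.intros)

definition srel :: "tens \<Rightarrow> tens \<Rightarrow> bool" where
  "srel f g \<longleftrightarrow> f - g \<in> sideal"

lemma equivp_srel: "equivp srel"
proof (rule equivpI)
  show "reflp srel" by (auto simp: reflp_def srel_def intro: sideal.zero)
  show "symp srel" by (auto simp: symp_def srel_def dest: sideal_minus)
  show "transp srel"
    unfolding transp_def srel_def
  proof (intro allI impI)
    fix f g h assume "f - g \<in> sideal" "g - h \<in> sideal"
    then have "(f - g) + (g - h) \<in> sideal" by (rule sideal.add)
    then show "f - h \<in> sideal" by simp
  qed
qed

text \<open>
  \<open>salg\<close> is the symmetric superalgebra on the superspace with basis all of \<^typ>\<open>gen\<close>.
\<close>

quotient_type salg = tens / srel
  by (rule equivp_srel)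

instantiation salg :: ring_1
begin

lift_definition zero_salg :: salg is 0 .
lift_definition one_salg :: salg is 1 .
lift_definition plus_salg :: "salg \<Rightarrow> salg \<Rightarrow> salg" is "(+)"
  unfolding srel_def add_diff_add by (rule sideal.add)
lift_definition uminus_salg :: "salg \<Rightarrow> salg" is uminus
  unfolding srel_def minus_diff_minus by (rule sideal_minus)
lift_definition minus_salg :: "salg \<Rightarrow> salg \<Rightarrow> salg" is "(-)"
proof -
  fix f f' g g' assume "srel f f'" "srel g g'"
  moreover have "(f - g) - (f' - g') = (f - f') - (g - g')" by simp
  ultimately show "srel (f - g) (f' - g')"
    unfolding srel_def by (simp only: sideal_diff)
qed
lift_definition times_salg :: "salg \<Rightarrow> salg \<Rightarrow> salg" is "(*)"
proof -
  fix f f' g g' assume "srel f f'" "srel g g'"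
  moreover have "f * g - f' * g' = (f - f') * g + f' * (g - g')"
    by (simp add: algebra_simps)
  ultimately show "srel (f * g) (f' * g')"
    unfolding srel_def by (metis sideal.add sideal_mult_left sideal_mult_right)
qed

lemma lookup_Nil_mult:
  "Poly_Mapping.lookup (f * g) [] = Poly_Mapping.lookup f [] * Poly_Mapping.lookup g []"
  for f g :: tens
proof (induction f rule: tens_induct)
  case (add f h)
  then show ?case by (simp add: distrib_right lookup_add)
next
  case (word c v)
  show ?case
  proof (induction g rule: tens_induct)
    case (add f h)
    then show ?case by (simp add: distrib_left lookup_add)
  next
    case (word d w)
    show ?case
      by (simp add: tscal_def tword_def mult_single plus_list_def lookup_single when_def)
  qed
qed

lemma sideal_lookup_Nil: "f \<in> sideal \<Longrightarrow> Poly_Mapping.lookup f [] = 0"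
  by (induction rule: sideal.induct)
     (simp_all add: lookup_Nil_mult lookup_add lookup_minus tword_def lookup_single)

instance
proof
  show "(0 :: salg) \<noteq> 1"
  proof (transfer, unfold srel_def, rule notI)
    assume "(0 - 1 :: tens) \<in> sideal"
    then have "Poly_Mapping.lookup (0 - 1 :: tens) [] = 0" by (rule sideal_lookup_Nil)
    then show False by (simp add: lookup_minus lookup_one zero_list_def)
  qed
qed (transfer; simp add: srel_def algebra_simps sideal.zero)+

end

lift_definition scal :: "complex \<Rightarrow> salg" is tscal .

lift_definition var :: "gen \<Rightarrow> salg" is "\<lambda>g. tword [g]" .

definition subalgebra :: "salg set \<Rightarrow> bool" where
  "subalgebra B \<longleftrightarrow>
     (\<forall>c. scal c \<in> B) \<and> (\<forall>f\<in>B. \<forall>g\<in>B. f + g \<in> B) \<and> (\<forall>f\<in>B. \<forall>g\<in>B. f * g \<in> B)"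

text \<open>
  The symmetric superalgebra of \<open>U \<otimes> V \<oplus> V\<^sup>* \<otimes> W\<close>, realised inside \<^typ>\<open>salg\<close>
  as the unital subalgebra generated by the basis vectors belonging to the given sizes.
\<close>

definition \<AA> :: "nat \<Rightarrow> nat \<Rightarrow> nat \<Rightarrow> salg set" where
  "\<AA> n k p = \<Inter>{B. subalgebra B \<and> var ` gens n k p \<subseteq> B}"

lemma var_supercomm: "var g * var h = scal (ksign (gpar g) (gpar h)) * var h * var g"
proof (transfer, unfold srel_def)
  fix g h
  show "tword [g] * tword [h] - tscal (ksign (gpar g) (gpar h)) * tword [h] * tword [g] \<in> sideal"
    using sideal.rel[of 1 g h 1] by (simp add: tword_mult mult.assoc)
qed

section \<open>The actions of the general linear Lie superalgebras\<close>

text \<open>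
  A matrix \<open>A\<close> stands for the endomorphism \<open>e\<^sub>j \<mapsto> (\<Sum>i. A i j e\<^sub>i)\<close>.
\<close>

definition gl :: "'i set \<Rightarrow> ('i \<Rightarrow> 'i \<Rightarrow> complex) set" where
  "gl J = {A. \<forall>i j. A i j \<noteq> 0 \<longrightarrow> i \<in> J \<and> j \<in> J}"

definition hpart :: "bool \<Rightarrow> (idx \<Rightarrow> idx \<Rightarrow> complex) \<Rightarrow> idx \<Rightarrow> idx \<Rightarrow> complex" where
  "hpart \<epsilon> A i j = (if (ipar i \<noteq> ipar j) = \<epsilon> then A i j else 0)"

text \<open>
  The action of an endomorphism \<open>A\<close> of \<open>V\<close> that is homogeneous of parity \<open>\<epsilon>\<close>. On \<open>V\<^sup>*\<close> it is
  \<open>(A f)(v) = - (- 1)\<^bsup>|A||f|\<^esup> f (A v)\<close>.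
\<close>

primrec glV_gen :: "nat \<Rightarrow> bool \<Rightarrow> (idx \<Rightarrow> idx \<Rightarrow> complex) \<Rightarrow> gen \<Rightarrow> tens" where
  "glV_gen n \<epsilon> A (X t j) = (\<Sum>i\<in>Idx n. tscal (A i j) * tword [X t i])"
| "glV_gen n \<epsilon> A (Xs i s) = (\<Sum>j\<in>Idx n. tscal (- ksign \<epsilon> (ipar i) * A i j) * tword [Xs j s])"

definition glV_tens :: "nat \<Rightarrow> (idx \<Rightarrow> idx \<Rightarrow> complex) \<Rightarrow> tens \<Rightarrow> tens" where
  "glV_tens n A f =
     tder False (glV_gen n False (hpart False A)) f + tder True (glV_gen n True (hpart True A)) f"

primrec glU_gen :: "nat \<Rightarrow> (nat \<Rightarrow> nat \<Rightarrow> complex) \<Rightarrow> gen \<Rightarrow> tens" where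
  "glU_gen k A (X t i) = (\<Sum>r=1..k. tscal (A r t) * tword [X r i])"
| "glU_gen k A (Xs i s) = 0"

primrec glW_gen :: "nat \<Rightarrow> (nat \<Rightarrow> nat \<Rightarrow> complex) \<Rightarrow> gen \<Rightarrow> tens" where
  "glW_gen p A (X t i) = 0"
| "glW_gen p A (Xs i s) = (\<Sum>r=1..p. tscal (A r s) * tword [Xs i r])"

text \<open>
  \<open>homog \<epsilon> \<phi>\<close> says that, modulo the ideal, \<open>\<phi> g\<close> supercommutes with the generators like an
  element of the parity of \<open>g\<close> shifted by \<open>\<epsilon>\<close>; this makes \<open>tder \<epsilon> \<phi>\<close> descend to \<open>salg\<close>.
\<close>

definition homog :: "bool \<Rightarrow> (gen \<Rightarrow> tens) \<Rightarrow> bool" where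
  "homog \<epsilon> \<phi> \<longleftrightarrow> (\<forall>g h. \<phi> g * tword [h] -
     tscal (ksign (gpar g \<noteq> \<epsilon>) (gpar h)) * (tword [h] * \<phi> g) \<in> sideal)"

lemma homog_aux:
  assumes "\<And>z. z \<in> Z \<Longrightarrow> c z \<noteq> 0 \<Longrightarrow> gpar (y z) = e"
  shows "(\<Sum>z\<in>Z. tscal (c z) * tword [y z]) * tword [h] -
     tscal (ksign e (gpar h)) * (tword [h] * (\<Sum>z\<in>Z. tscal (c z) * tword [y z])) \<in> sideal"
proof -
  have *: "tscal (c z) * tword [y z] * tword [h] -
      tscal (ksign e (gpar h)) * (tword [h] * (tscal (c z) * tword [y z])) \<in> sideal"
    if "z \<in> Z" for z
  proof (cases "c z = 0")
    case True
    then show ?thesis by (simp add: sideal.zero)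
  next
    case False
    then have e: "e = gpar (y z)" using assms that by simp
    have "tscal (ksign e (gpar h)) * (tword [h] * (tscal (c z) * tword [y z])) =
      tscal (c z) * (tscal (ksign e (gpar h)) * tword [h, y z])"
      by (simp add: tens_norm mult.commute)
    moreover have "tscal (c z) * tword [y z] * tword [h] = tscal (c z) * tword [y z, h]"
      by (simp add: mult.assoc tword_mult)
    ultimately show ?thesis
      using sideal.rel[of "tscal (c z)" "y z" h 1] by (simp add: e right_diff_distrib)
  qed
  have sums: "(\<Sum>z\<in>Z. tscal (c z) * tword [y z]) * tword [h] -
     tscal (ksign e (gpar h)) * (tword [h] * (\<Sum>z\<in>Z. tscal (c z) * tword [y z])) =
     (\<Sum>z\<in>Z. tscal (c z) * tword [y z] * tword [h] -
      tscal (ksign e (gpar h)) * (tword [h] * (tscal (c z) * tword [y z])))"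
    by (simp only: sum_subtractf sum_distrib_left sum_distrib_right)
  show ?thesis unfolding sums by (rule sideal_sum) (rule *)
qed

lemma homog_glV: "homog \<epsilon> (glV_gen n \<epsilon> (hpart \<epsilon> A))"
  unfolding homog_def
proof (intro allI)
  fix g h
  show "glV_gen n \<epsilon> (hpart \<epsilon> A) g * tword [h] -
     tscal (ksign (gpar g \<noteq> \<epsilon>) (gpar h)) * (tword [h] * glV_gen n \<epsilon> (hpart \<epsilon> A) g) \<in> sideal"
  proof (cases g)
    case (X t i)
    show ?thesis unfolding X glV_gen.simps
      by (rule homog_aux) (auto simp: hpart_def split: if_splits)
  next
    case (Xs i s)
    show ?thesis unfolding Xs glV_gen.simps
      by (rule homog_aux) (auto simp: hpart_def split: if_splits)
  qed
qed

lemma homog_glU: "homog False (glU_gen k A)"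
  unfolding homog_def
proof (intro allI)
  fix g h
  show "glU_gen k A g * tword [h] -
     tscal (ksign (gpar g \<noteq> False) (gpar h)) * (tword [h] * glU_gen k A g) \<in> sideal"
  proof (cases g)
    case (X t i)
    show ?thesis unfolding X glU_gen.simps by (rule homog_aux) auto
  qed (simp add: sideal.zero)
qed

lemma homog_glW: "homog False (glW_gen k A)"
  unfolding homog_def
proof (intro allI)
  fix g h
  show "glW_gen k A g * tword [h] -
     tscal (ksign (gpar g \<noteq> False) (gpar h)) * (tword [h] * glW_gen k A g) \<in> sideal"
  proof (cases g)
    case (Xs i s)
    show ?thesis unfolding Xs glW_gen.simps by (rule homog_aux) auto
  qed (simp add: sideal.zero)
qed

lemma tder_Cons2:
  "tder \<epsilon> \<phi> (tword [g, h] * f) = (\<phi> g * tword [h] + tscal (ksign \<epsilon> (gpar g)) * (tword [g] * \<phi> h)) * f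
     + tscal (ksign \<epsilon> (gpar g) * ksign \<epsilon> (gpar h)) * tword [g, h] * tder \<epsilon> \<phi> f"
proof -
  have "tword [g, h] * f = tword [g] * (tword [h] * f)"
    by (simp add: tword_mult flip: mult.assoc)
  moreover have "tscal (ksign \<epsilon> (gpar g)) * tword [g] * (tscal (ksign \<epsilon> (gpar h)) * tword [h] * F) =
    tscal (ksign \<epsilon> (gpar g) * ksign \<epsilon> (gpar h)) * tword [g, h] * F" for F
    by (simp add: tens_norm)
  ultimately show ?thesis
    by (simp add: tder_Cons distrib_left distrib_right mult.assoc)
qed

lemma tder_rel:
  assumes "homog \<epsilon> \<phi>"
  shows "tder \<epsilon> \<phi> ((tword [g, h] - tscal (ksign (gpar g) (gpar h)) * tword [h, g]) * b) \<in> sideal"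
proof -
  let ?s = "\<lambda>a b. tscal (ksign a b)"
  let ?G = "gpar g" and ?H = "gpar h"
  let ?r = "tword [g, h] - ?s ?G ?H * tword [h, g]"
  define P where "P = \<phi> g * tword [h] - ?s (?G \<noteq> \<epsilon>) ?H * (tword [h] * \<phi> g)"
  define Q where "Q = \<phi> h * tword [g] - ?s (?H \<noteq> \<epsilon>) ?G * (tword [g] * \<phi> h)"
  have PQ: "P \<in> sideal" "Q \<in> sideal"
    using assms by (auto simp: homog_def P_def Q_def)
  have t1: "tscal (- 1) = - 1"
    using tscal_add[of 1 "- 1"] by (simp add: eq_neg_iff_add_eq_0 add.commute)
  have "tder \<epsilon> \<phi> (?r * b) = P * b - ?s ?G ?H * Q * b
      + tscal (ksign \<epsilon> ?G * ksign \<epsilon> ?H) * ?r * tder \<epsilon> \<phi> b"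
    by (cases ?G; cases ?H; cases \<epsilon>)
       (simp_all add: P_def Q_def left_diff_distrib mult.assoc tder_add tder_diff tder_scal tder_Cons2
          ksign_def t1 algebra_simps)
  moreover have "?r \<in> sideal" using sideal.rel[of 1 g h 1] by simp
  ultimately show ?thesis
    using PQ by (simp only: sideal.add sideal_diff sideal_mult_right sideal_mult_left)
qed

lemma tder_left:
  assumes "f \<in> sideal" "tder \<epsilon> \<phi> f \<in> sideal"
  shows "tder \<epsilon> \<phi> (a * f) \<in> sideal"
proof (induction a rule: tens_induct)
  case (add f g)
  then show ?case by (simp add: distrib_right tder_add sideal.add)
next
  case (word c w)
  have "tder \<epsilon> \<phi> (tword w * f) \<in> sideal"
  proof (induction w)
    case Nil
    then show ?case using assms by (simp add: tword_Nil)
  next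
    case (Cons g w)
    have "tword (g # w) * f = tword [g] * (tword w * f)"
      by (simp add: tword_mult flip: mult.assoc)
    then show ?case using Cons assms
      by (simp add: tder_Cons sideal.add sideal_mult_left)
  qed
  then show ?case by (simp add: mult.assoc tder_scal sideal_mult_left)
qed

lemma tder_sideal:
  assumes "homog \<epsilon> \<phi>" "f \<in> sideal"
  shows "tder \<epsilon> \<phi> f \<in> sideal"
  using assms(2)
proof induction
  case (rel a g h b)
  have "(tword [g, h] - tscal (ksign (gpar g) (gpar h)) * tword [h, g]) * b \<in> sideal"
    using sideal.rel[of 1 g h b] by simp
  then show ?case
    unfolding mult.assoc[of a] using assms(1) by (intro tder_left tder_rel)
qed (auto simp: sideal.zero tder_add sideal.add)

lift_definition glV :: "nat \<Rightarrow> (idx \<Rightarrow> idx \<Rightarrow> complex) \<Rightarrow> salg \<Rightarrow> salg" is glV_tens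
  unfolding srel_def glV_tens_def add_diff_add tder_diff[symmetric]
  by (intro sideal.add tder_sideal homog_glV)

lift_definition glU :: "nat \<Rightarrow> (nat \<Rightarrow> nat \<Rightarrow> complex) \<Rightarrow> salg \<Rightarrow> salg"
  is "\<lambda>k A. tder False (glU_gen k A)"
  unfolding srel_def tder_diff[symmetric] by (intro tder_sideal homog_glU)

lift_definition glW :: "nat \<Rightarrow> (nat \<Rightarrow> nat \<Rightarrow> complex) \<Rightarrow> salg \<Rightarrow> salg"
  is "\<lambda>p A. tder False (glW_gen p A)"
  unfolding srel_def tder_diff[symmetric] by (intro tder_sideal homog_glW)

lemma abs_salg_sum: "finite A \<Longrightarrow> abs_salg (sum f A) = (\<Sum>x\<in>A. abs_salg (f x))"
  by (induction A rule: finite_induct)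
     (simp_all add: zero_salg.abs_eq[symmetric] plus_salg.abs_eq[symmetric])

lemma abs_salg_term: "abs_salg (tscal c * tword [g]) = scal c * var g"
  by (simp add: scal.abs_eq var.abs_eq times_salg.abs_eq)

lemma finite_Idx: "finite (Idx n)"
  by (simp add: Idx_def)

lemma glV_tens_homogeneous:
  assumes "hpart \<epsilon> A = A"
  shows "glV_tens n A f = tder \<epsilon> (glV_gen n \<epsilon> A) f"
proof -
  have z: "hpart (\<not> \<epsilon>) A = (\<lambda>_ _. 0)"
    by (subst assms[symmetric]) (auto simp: hpart_def fun_eq_iff)
  have "glV_gen n (\<not> \<epsilon>) (\<lambda>_ _. 0) = (\<lambda>_. 0)"
  proof
    fix g show "glV_gen n (\<not> \<epsilon>) (\<lambda>_ _. 0) g = 0" by (cases g) simp_all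
  qed
  moreover have "wder e (\<lambda>_. 0) w = 0" for e w by (induction w) simp_all
  ultimately have "tder (\<not> \<epsilon>) (glV_gen n (\<not> \<epsilon>) (hpart (\<not> \<epsilon>) A)) f = 0"
    by (simp add: z tder_def)
  then show ?thesis
    using assms by (cases \<epsilon>) (simp_all add: glV_tens_def)
qed

lemma glV_X:
  assumes "hpart \<epsilon> A = A"
  shows "glV n A (var (X t j)) = (\<Sum>i\<in>Idx n. scal (A i j) * var (X t i))"
proof -
  have "glV n A (var (X t j)) = abs_salg (glV_gen n \<epsilon> A (X t j))"
    by (simp only: var.abs_eq glV.abs_eq glV_tens_homogeneous[OF assms] tder_tword
        wder.simps tword_Nil mult_1_right mult_zero_right add_0_right)
  then show ?thesis by (simp only: glV_gen.simps abs_salg_sum finite_Idx abs_salg_term)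
qed

lemma glV_Xs:
  assumes "hpart \<epsilon> A = A"
  shows "glV n A (var (Xs i s)) =
    (\<Sum>j\<in>Idx n. scal (- ksign \<epsilon> (ipar i) * A i j) * var (Xs j s))"
proof -
  have "glV n A (var (Xs i s)) = abs_salg (glV_gen n \<epsilon> A (Xs i s))"
    by (simp only: var.abs_eq glV.abs_eq glV_tens_homogeneous[OF assms] tder_tword
        wder.simps tword_Nil mult_1_right mult_zero_right add_0_right)
  then show ?thesis by (simp only: glV_gen.simps abs_salg_sum finite_Idx abs_salg_term)
qed

lemma glV_Leibniz:
  assumes "hpart \<epsilon> A = A"
  shows "glV n A (var g * f) =
    glV n A (var g) * f + scal (ksign \<epsilon> (gpar g)) * var g * glV n A f"
proof -
  obtain F where F: "f = abs_salg F" by (metis Quotient3_abs_rep[OF Quotient3_salg])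
  show ?thesis
    by (simp add: F var.abs_eq scal.abs_eq glV.abs_eq times_salg.abs_eq plus_salg.abs_eq
        glV_tens_homogeneous[OF assms] tder_Cons tder_tword tword_Nil)
qed

text \<open>
  \<open>q n\<close> is the stabiliser in \<open>gl(V)\<close> of the odd tensor in \<open>V \<otimes> V\<^sup>*\<close>. The space \<open>V \<otimes> V\<^sup>*\<close> is
  identified with the span of the words \<open>[X 0 i, Xs j 0]\<close>: the auxiliary labels \<open>0\<close>
  give one copy of \<open>V\<close> and one copy of \<open>V\<^sup>*\<close>.
\<close>

definition q_tensor :: "nat \<Rightarrow> tens" where
  "q_tensor n = (\<Sum>i=1..n. tword [X 0 (Ev i), Xs (Od i) 0] + tword [X 0 (Od i), Xs (Ev i) 0])"

definition \<qq> :: "nat \<Rightarrow> (idx \<Rightarrow> idx \<Rightarrow> complex) set" where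
  "\<qq> n = {A \<in> gl (Idx n). glV_tens n A (q_tensor n) = 0}"

primrec bar :: "idx \<Rightarrow> idx" where
  "bar (Ev i) = Od i"
| "bar (Od i) = Ev i"

lemma bar_bar [simp]: "bar (bar i) = i"
  by (cases i) auto

lemma ipar_bar [simp]: "ipar (bar i) \<longleftrightarrow> \<not> ipar i"
  by (cases i) auto

lemma bar_Idx [simp]: "bar i \<in> Idx n \<longleftrightarrow> i \<in> Idx n"
  by (cases i) (auto simp: Idx_def)

lemma q_tensor_alt: "q_tensor n = (\<Sum>i\<in>Idx n. tword [X 0 i, Xs (bar i) 0])"
proof -
  have "(\<Sum>i\<in>Idx n. tword [X 0 i, Xs (bar i) 0]) =
    (\<Sum>i\<in>Ev ` {1..n}. tword [X 0 i, Xs (bar i) 0]) +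
    (\<Sum>i\<in>Od ` {1..n}. tword [X 0 i, Xs (bar i) 0])"
    unfolding Idx_def by (rule sum.union_disjoint) auto
  also have "\<dots> = q_tensor n"
    by (simp add: q_tensor_def sum.reindex inj_on_def sum.distrib)
  finally show ?thesis ..
qed

lemma lookup_glV_q_tensor:
  "Poly_Mapping.lookup (glV_tens n A (q_tensor n)) v =
    (\<Sum>a\<in>Idx n. \<Sum>b\<in>Idx n.
      (A a (bar b) - (if ipar a = ipar b then - 1 else 1) * A (bar a) b)
        when v = [X 0 a, Xs b 0])"
proof -
  let ?w = "\<lambda>a b. tword [X 0 a, Xs b 0]"
  have tsum: "tder e f (\<Sum>i\<in>I. g i) = (\<Sum>i\<in>I. tder e f (g i))" for e f g and I :: "idx set"
    by (induction I rule: infinite_finite_induct) (simp_all add: tder_add)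
  define B where "B e = hpart e A" for e
  have d: "tder e (glV_gen n e (B e)) (q_tensor n) =
     (\<Sum>a\<in>Idx n. \<Sum>b\<in>Idx n. tscal (B e a (bar b)) * ?w a b) +
     (\<Sum>a\<in>Idx n. \<Sum>b\<in>Idx n. tscal ((if e then 1 else - 1) * B e (bar a) b) * ?w a b)" for e
  proof -
    have "tder e (glV_gen n e (B e)) (q_tensor n) =
      (\<Sum>i\<in>Idx n. \<Sum>a\<in>Idx n. tscal (B e a i) * ?w a (bar i)) +
      (\<Sum>a\<in>Idx n. \<Sum>b\<in>Idx n. tscal ((if e then 1 else - 1) * B e (bar a) b) * ?w a b)"
      by (simp add: q_tensor_alt tsum tder_tword tword_Nil sum_distrib_left sum_distrib_right
          tens_norm sum.distrib)
         (auto intro!: sum.cong simp: ksign_def)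
    also have "(\<Sum>i\<in>Idx n. \<Sum>a\<in>Idx n. tscal (B e a i) * ?w a (bar i)) =
      (\<Sum>b\<in>Idx n. \<Sum>a\<in>Idx n. tscal (B e a (bar b)) * ?w a b)"
      by (rule sum.reindex_bij_witness[of _ bar bar]) auto
    also have "\<dots> = (\<Sum>a\<in>Idx n. \<Sum>b\<in>Idx n. tscal (B e a (bar b)) * ?w a b)"
      by (rule sum.swap)
    finally show ?thesis .
  qed
  have lk: "Poly_Mapping.lookup (tscal c * tword u) v = (c when v = u)" for c u
    by (auto simp: tscal_def tword_def mult_single plus_list_def lookup_single when_def)
  have "Poly_Mapping.lookup (glV_tens n A (q_tensor n)) v =
    (\<Sum>a\<in>Idx n. \<Sum>b\<in>Idx n.
      (B False a (bar b) - B False (bar a) b + B True a (bar b) + B True (bar a) b)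
        when v = [X 0 a, Xs b 0])"
    unfolding glV_tens_def B_def[symmetric] d lookup_add lookup_sum lk sum.distrib[symmetric]
    by (intro sum.cong refl) (simp add: when_def)
  also have "\<dots> = (\<Sum>a\<in>Idx n. \<Sum>b\<in>Idx n.
      (A a (bar b) - (if ipar a = ipar b then - 1 else 1) * A (bar a) b)
        when v = [X 0 a, Xs b 0])"
    by (intro sum.cong refl) (auto simp: B_def hpart_def)
  finally show ?thesis .
qed

text \<open>In block form \<open>q n\<close> consists of the matrices with rows \<open>(P, Q)\<close> and \<open>(- Q, P)\<close>.\<close>

lemma qq_iff:
  "A \<in> \<qq> n \<longleftrightarrow> A \<in> gl (Idx n) \<and>
     (\<forall>i\<in>{1..n}. \<forall>j\<in>{1..n}. A (Od i) (Od j) = A (Ev i) (Ev j) \<and> A (Od i) (Ev j) = - A (Ev i) (Od j))"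
proof -
  let ?c = "\<lambda>a b. A a (bar b) - (if ipar a = ipar b then - 1 else 1) * A (bar a) b"
  have *: "Poly_Mapping.lookup (glV_tens n A (q_tensor n)) [X 0 a, Xs b 0] = ?c a b"
    if "a \<in> Idx n" "b \<in> Idx n" for a b
  proof -
    have "Poly_Mapping.lookup (glV_tens n A (q_tensor n)) [X 0 a, Xs b 0] =
      (\<Sum>a'\<in>Idx n. \<Sum>b'\<in>Idx n. if b' = b then (if a' = a then ?c a b else 0) else 0)"
      unfolding lookup_glV_q_tensor by (intro sum.cong refl) (auto simp: when_def)
    then show ?thesis using that by (simp add: sum.delta finite_Idx)
  qed
  have "glV_tens n A (q_tensor n) = 0 \<longleftrightarrow> (\<forall>a\<in>Idx n. \<forall>b\<in>Idx n. ?c a b = 0)"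
  proof
    assume "glV_tens n A (q_tensor n) = 0"
    then show "\<forall>a\<in>Idx n. \<forall>b\<in>Idx n. ?c a b = 0" using * by simp
  next
    assume "\<forall>a\<in>Idx n. \<forall>b\<in>Idx n. ?c a b = 0"
    then show "glV_tens n A (q_tensor n) = 0"
      by (intro poly_mapping_eqI) (simp add: lookup_glV_q_tensor)
  qed
  also have "\<dots> \<longleftrightarrow> (\<forall>i\<in>{1..n}. \<forall>j\<in>{1..n}.
      A (Od i) (Od j) = A (Ev i) (Ev j) \<and> A (Od i) (Ev j) = - A (Ev i) (Od j))"
    unfolding Idx_def ball_Un by (auto simp: eq_neg_iff_add_eq_0 add.commute)
  finally show ?thesis by (simp add: \<qq>_def)
qed

section \<open>Invariants and basic sets\<close>

definition invariants :: "nat \<Rightarrow> nat \<Rightarrow> nat \<Rightarrow> (idx \<Rightarrow> idx \<Rightarrow> complex) set \<Rightarrow> salg set" where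
  "invariants n k p \<gg> = {f \<in> \<AA> n k p. \<forall>A\<in>\<gg>. glV n A f = 0}"

text \<open>
  The operators on \<open>\<AA> n k p\<close> given by elements of the enveloping algebra of
  \<open>gl(U) \<oplus> gl(W)\<close>: its image is the unital algebra of operators generated by the two actions.
\<close>

inductive_set polarizations :: "nat \<Rightarrow> nat \<Rightarrow> (salg \<Rightarrow> salg) set" for k p where
  ident: "(\<lambda>f. f) \<in> polarizations k p"
| glU: "A \<in> gl {1..k} \<Longrightarrow> glU k A \<in> polarizations k p"
| glW: "A \<in> gl {1..p} \<Longrightarrow> glW p A \<in> polarizations k p"
| scale: "D \<in> polarizations k p \<Longrightarrow> (\<lambda>f. scal c * D f) \<in> polarizations k p"
| add: "D \<in> polarizations k p \<Longrightarrow> E \<in> polarizations k p \<Longrightarrow> (\<lambda>f. D f + E f) \<in> polarizations k p"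
| comp: "D \<in> polarizations k p \<Longrightarrow> E \<in> polarizations k p \<Longrightarrow> (\<lambda>f. D (E f)) \<in> polarizations k p"

definition polarization_closure :: "nat \<Rightarrow> nat \<Rightarrow> salg set \<Rightarrow> salg set" where
  "polarization_closure k p M =
     \<Inter>{B. subalgebra B \<and> M \<subseteq> B \<and> (\<forall>D\<in>polarizations k p. D ` B \<subseteq> B)}"

definition basic_set ::
  "nat \<Rightarrow> nat \<Rightarrow> nat \<Rightarrow> (idx \<Rightarrow> idx \<Rightarrow> complex) set \<Rightarrow> salg set \<Rightarrow> bool" where
  "basic_set n k p \<gg> M \<longleftrightarrow>
     M \<subseteq> invariants n k p \<gg> \<and> invariants n k p \<gg> = polarization_closure k p M"

definition inner_even :: "nat \<Rightarrow> nat \<Rightarrow> nat \<Rightarrow> salg" where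
  "inner_even n t s = (\<Sum>i\<in>Idx n. var (X t i) * var (Xs i s))"

definition inner_odd :: "nat \<Rightarrow> nat \<Rightarrow> nat \<Rightarrow> salg" where
  "inner_odd n t s =
     (\<Sum>i=1..n. var (X t (Ev i)) * var (Xs (Od i) s) + var (X t (Od i)) * var (Xs (Ev i) s))"

end

theory Submission
  imports Defs
begin

text \<open>
  By Taylor expansion, \<open>f\<close> is a combination of contractions of its coefficient
  tensors, and after a sign change each coefficient tensor of an invariant is a matrix \<open>T\<close> on
  words of length \<open>m\<close> that commutes with the action of \<open>q n\<close>; the identity matrix in \<open>q n\<close> forces
  equally many letters from \<open>V\<close> and from the dual.

  To describe such \<open>T\<close>, enlarge \<open>V\<close> by \<open>m\<close> further pairs of basis vectors. Lowering operators
  in the larger queer superalgebra carry the new basis vectors back to the old ones, and \<open>T\<close> is a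
  combination of the matrices whose column at \<open>u\<close> is obtained from a fixed word by lowering the new
  indices to the letters of \<open>u\<close>. This is a Fredholm alternative for the standard Hermitian form:
  raising is adjoint to lowering, and a lowering product after a raising product acts on the small
  space through \<open>q n\<close>, hence commutes with the adjoint of \<open>T\<close>.

  Contracting one of these matrices amounts to applying \<open>m\<close> even derivations to a word, each of
  which replaces a letter with a new index by an inner product.
\<close>

section \<open>Superderivations of the symmetric superalgebra\<close>

text \<open>The obstacle is that words may be longer than n, so over the old indices there is no
  generic word from which an operator commuting with \<open>q n\<close> could be read off. With
  fresh pairs, \<open>map Ev qs\<close> is such a word: its letters are distinct and even, so
  raising addresses each position separately and without signs. A matrix of the overview can be
  nonzero only if its fixed word has exactly one letter of each fresh pair; the order of the pairs
  is a permutation, the odd partners record Clifford generators. This is Sergeev's description of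
  the commutant, as a spanning statement for every n. Positivity of the Hermitian form takes the
  place of semisimplicity and double commutants; it can be used because queer matrices are closed
  under conjugate transposition and associative products. No basis of the quotient algebra is
  constructed: coefficients are constant terms of iterated partial derivatives, so only
  superderivations and the constant term have to descend. The even partner of a pair yields the even
  inner product, the odd partner the odd one.\<close>

lemma ksign_simps [simp]:
  "ksign False b = 1" "ksign a False = 1" "ksign True True = - 1"
  by (simp_all add: ksign_def)

lemma ksign_sq [simp]: "ksign a b * ksign a b = 1" "ksign a b * (ksign a b * c) = c"
  by (simp_all add: ksign_def)

lemma ksign_commute: "ksign a b = ksign b a"
  by (simp add: ksign_def conj_commute)

lemma ksign_neq: "ksign (a \<noteq> b) c = ksign a c * ksign b c" "ksign c (a \<noteq> b) = ksign c a * ksign c b"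
  "ksign (a = (\<not> b)) c = ksign a c * ksign b c" "ksign c (a = (\<not> b)) = ksign c a * ksign c b"
  by (auto simp: ksign_def)

lemma abs_salg_eq_0_iff: "abs_salg F = 0 \<longleftrightarrow> F \<in> sideal"
  by (simp add: zero_salg.abs_eq salg.abs_eq_iff srel_def)

lemma abs_salg_surj: obtains F where "f = abs_salg F"
  by (metis Quotient3_abs_rep[OF Quotient3_salg])

lemma abs_salg_add: "abs_salg (F + G) = abs_salg F + abs_salg G"
  by (simp add: plus_salg.abs_eq)

lemma abs_salg_mult: "abs_salg (F * G) = abs_salg F * abs_salg G"
  by (simp add: times_salg.abs_eq)

lemma abs_salg_diff: "abs_salg (F - G) = abs_salg F - abs_salg G"
  by (simp add: minus_salg.abs_eq)

lemma abs_salg_tscal: "abs_salg (tscal c) = scal c"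
  by (simp add: scal.abs_eq)

lemma scal_mult: "scal a * scal b = scal (a * b)"
  by (transfer, simp add: srel_def tscal_mult sideal.zero)

lemma scal_mult_left: "scal a * (scal b * f) = scal (a * b) * f"
  by (simp add: scal_mult flip: mult.assoc)

lemma scal_add: "scal (a + b) = scal a + scal b"
  by (transfer, simp add: srel_def tscal_add sideal.zero)

lemma scal_0 [simp]: "scal 0 = 0"
  by (transfer, simp add: srel_def sideal.zero)

lemma scal_1 [simp]: "scal 1 = 1"
  by (transfer, simp add: srel_def sideal.zero)

lemma scal_uminus: "scal (- a) = - scal a"
  using scal_add[of a "- a"] by (simp add: eq_neg_iff_add_eq_0 add.commute)

lemma scal_comm: "scal c * f = f * scal c"
  by (transfer, simp add: srel_def tscal_comm[symmetric] sideal.zero)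

lemma mult_scal_left: "f * (scal c * g) = scal c * (f * g)"
  by (metis mult.assoc scal_comm)

lemma salg_induct [case_names add scal var]:
  assumes add: "\<And>f g. P f \<Longrightarrow> P g \<Longrightarrow> P (f + g)"
    and scal: "\<And>c. P (scal c)"
    and var: "\<And>g f. P f \<Longrightarrow> P (var g * f)"
  shows "P f"
proof -
  obtain F where F: "f = abs_salg F" by (rule abs_salg_surj)
  show ?thesis unfolding F
  proof (induction F rule: tens_induct)
    case (add F G)
    then show ?case using assms(1) by (simp add: abs_salg_add)
  next
    case (word c w)
    show ?case
    proof (induction w)
      case Nil
      then show ?case using scal by (simp add: tword_Nil abs_salg_tscal)
    next
      case (Cons g w)
      have "tscal c * tword (g # w) = tword [g] * (tscal c * tword w)"
        by (simp add: tword_tscal tword_mult)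
      then show ?case using var[OF Cons, of g] by (simp add: abs_salg_mult var.abs_eq)
    qed
  qed
qed

text \<open>Goes through a chosen representative because \<open>tder\<close> is known to respect the
  ideal only under \<open>homog\<close>; a lift would demand this of every \<phi>.\<close>

definition sder :: "bool \<Rightarrow> (gen \<Rightarrow> tens) \<Rightarrow> salg \<Rightarrow> salg" where
  "sder \<epsilon> \<phi> f = abs_salg (tder \<epsilon> \<phi> (rep_salg f))"

lemma sder_abs:
  assumes "homog \<epsilon> \<phi>"
  shows "sder \<epsilon> \<phi> (abs_salg F) = abs_salg (tder \<epsilon> \<phi> F)"
proof -
  have "srel (rep_salg (abs_salg F)) F"
    by (rule Quotient3_rep_abs[OF Quotient3_salg]) (simp add: srel_def sideal.zero)
  then show ?thesis
    unfolding sder_def salg.abs_eq_iff srel_def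
    by (metis tder_diff tder_sideal[OF assms])
qed

context
  fixes \<epsilon> :: bool and \<phi> :: "gen \<Rightarrow> tens"
  assumes hom: "homog \<epsilon> \<phi>"
begin

lemma sder_add: "sder \<epsilon> \<phi> (f + g) = sder \<epsilon> \<phi> f + sder \<epsilon> \<phi> g"
proof -
  obtain F G where "f = abs_salg F" "g = abs_salg G" by (metis abs_salg_surj)
  then show ?thesis by (simp add: sder_abs[OF hom] tder_add flip: abs_salg_add)
qed

lemma sder_scal_left: "sder \<epsilon> \<phi> (scal c * f) = scal c * sder \<epsilon> \<phi> f"
proof -
  obtain F where "f = abs_salg F" by (metis abs_salg_surj)
  then show ?thesis
    by (simp add: sder_abs[OF hom] tder_scal flip: abs_salg_tscal abs_salg_mult)
qed

lemma sder_0: "sder \<epsilon> \<phi> 0 = 0"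
  using sder_scal_left[of 0 0] by simp

lemma sder_1: "sder \<epsilon> \<phi> 1 = 0"
  using sder_abs[OF hom, of 1] tder_tword[of \<epsilon> \<phi> "[]"]
  by (simp add: tword_Nil one_salg.abs_eq zero_salg.abs_eq)

lemma sder_scal: "sder \<epsilon> \<phi> (scal c) = 0"
  using sder_scal_left[of c 1] sder_1 by simp

lemma sder_sum: "sder \<epsilon> \<phi> (\<Sum>x\<in>A. f x) = (\<Sum>x\<in>A. sder \<epsilon> \<phi> (f x))"
  by (induction A rule: infinite_finite_induct) (simp_all add: sder_0 sder_add)

lemma sder_Leibniz:
  "sder \<epsilon> \<phi> (var g * f) =
    abs_salg (\<phi> g) * f + scal (ksign \<epsilon> (gpar g)) * (var g * sder \<epsilon> \<phi> f)"
proof -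
  obtain F where F: "f = abs_salg F" by (metis abs_salg_surj)
  have "sder \<epsilon> \<phi> (var g * f) = abs_salg (tder \<epsilon> \<phi> (tword [g] * F))"
    by (simp only: F var.abs_eq sder_abs[OF hom] flip: abs_salg_mult)
  then show ?thesis
    by (simp add: tder_Cons F sder_abs[OF hom] abs_salg_add abs_salg_mult abs_salg_tscal var.abs_eq
        mult.assoc)
qed

lemma sder_var: "sder \<epsilon> \<phi> (var g) = abs_salg (\<phi> g)"
  using sder_Leibniz[of g 1] by (simp add: sder_1)

end

lemma sder_mult:
  assumes "homog False \<phi>"
  shows "sder False \<phi> (f * g) = sder False \<phi> f * g + f * sder False \<phi> g"
proof (induction f rule: salg_induct)
  case (add f h)
  then show ?case by (simp add: distrib_right sder_add[OF assms])
next
  case (scal c)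
  then show ?case by (simp add: sder_scal_left[OF assms] sder_scal[OF assms])
next
  case (var h f)
  then show ?case by (simp add: sder_Leibniz[OF assms] mult.assoc distrib_left distrib_right)
qed

lemma glV_eq_sder:
  assumes "hpart \<epsilon> A = A"
  shows "glV n A f = sder \<epsilon> (glV_gen n \<epsilon> A) f"
proof -
  obtain F where F: "f = abs_salg F" by (rule abs_salg_surj)
  have "homog \<epsilon> (glV_gen n \<epsilon> A)" using homog_glV[of \<epsilon> n A] assms by simp
  then show ?thesis
    by (simp add: F sder_abs glV.abs_eq glV_tens_homogeneous[OF assms])
qed

lemma glV_hpart: "glV n A f = glV n (hpart False A) f + glV n (hpart True A) f"
proof -
  obtain F where F: "f = abs_salg F" by (rule abs_salg_surj)
  have h: "hpart e (hpart e A) = hpart e A" for e by (auto simp: hpart_def fun_eq_iff)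
  show ?thesis
    by (simp add: F glV.abs_eq glV_tens_homogeneous[OF h] glV_tens_def[of n A] flip: abs_salg_add)
qed

lemma glU_eq_sder: "glU k A f = sder False (glU_gen k A) f"
proof -
  obtain F where F: "f = abs_salg F" by (rule abs_salg_surj)
  show ?thesis by (simp add: F glU.abs_eq sder_abs homog_glU)
qed

lemma glW_eq_sder: "glW k A f = sder False (glW_gen k A) f"
proof -
  obtain F where F: "f = abs_salg F" by (rule abs_salg_surj)
  show ?thesis by (simp add: F glW.abs_eq sder_abs homog_glW)
qed

lemma sum_Idx_bar: "(\<Sum>i\<in>Idx n. f (bar i)) = (\<Sum>i\<in>Idx n. f i)"
  by (rule sum.reindex_bij_witness[of _ bar bar]) auto

lemma inner_odd_alt: "inner_odd n t s = (\<Sum>i\<in>Idx n. var (X t (bar i)) * var (Xs i s))"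
proof -
  have "(\<Sum>i\<in>Idx n. var (X t (bar i)) * var (Xs i s)) =
    (\<Sum>i\<in>Idx n. var (X t i) * var (Xs (bar i) s))"
    using sum_Idx_bar[of "\<lambda>i. var (X t i) * var (Xs (bar i) s)" n] by simp
  also have "\<dots> = (\<Sum>i\<in>Ev ` {1..n}. var (X t i) * var (Xs (bar i) s)) +
      (\<Sum>i\<in>Od ` {1..n}. var (X t i) * var (Xs (bar i) s))"
    unfolding Idx_def by (rule sum.union_disjoint) auto
  also have "\<dots> = inner_odd n t s"
    by (simp add: inner_odd_def sum.reindex inj_on_def sum.distrib)
  finally show ?thesis ..
qed

section \<open>Matrices acting on words\<close>

definition words :: "'a set \<Rightarrow> nat \<Rightarrow> 'a list set" where
  "words S m = {w. set w \<subseteq> S \<and> length w = m}"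

lemma finite_words: "finite S \<Longrightarrow> finite (words S m)"
  unfolding words_def by (rule finite_lists_length_eq)

lemma words_0 [simp]: "words S 0 = {[]}"
  by (auto simp: words_def)

lemma sum_words_Suc:
  assumes "finite S"
  shows "(\<Sum>w\<in>words S (Suc m). f w) = (\<Sum>i\<in>S. \<Sum>w\<in>words S m. f (i # w))"
proof -
  have "words S (Suc m) = (\<lambda>(i, w). i # w) ` (S \<times> words S m)"
    by (auto simp: words_def length_Suc_conv image_iff)
  moreover have "inj_on (\<lambda>(i, w). i # w) (S \<times> words S m)"
    by (auto simp: inj_on_def)
  ultimately have "(\<Sum>w\<in>words S (Suc m). f w) = (\<Sum>(i, w)\<in>S \<times> words S m. f (i # w))"
    by (simp add: sum.reindex case_prod_unfold)
  then show ?thesis by (simp add: sum.cartesian_product)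
qed

lemma Cons_words [simp]: "i # w \<in> words S (Suc m) \<longleftrightarrow> i \<in> S \<and> w \<in> words S m"
  by (auto simp: words_def)

type_synonym vec = "idx list \<Rightarrow> complex"
type_synonym mat = "idx \<Rightarrow> idx \<Rightarrow> complex"

text \<open>
  \<open>ract S \<epsilon> A w f\<close> is the coefficient at the word \<open>w\<close> of the vector obtained from \<open>f\<close> by the
  action of a matrix \<open>A\<close> of parity \<open>\<epsilon>\<close> on tensor powers, with Koszul signs.
\<close>

primrec ract :: "idx set \<Rightarrow> bool \<Rightarrow> mat \<Rightarrow> idx list \<Rightarrow> vec \<Rightarrow> complex" where
  "ract S \<epsilon> A [] f = 0"
| "ract S \<epsilon> A (i # w) f =
     (\<Sum>j\<in>S. A i j * f (j # w)) + ksign \<epsilon> (ipar i) * ract S \<epsilon> A w (\<lambda>w. f (i # w))"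

primrec wpar :: "idx list \<Rightarrow> bool" where
  "wpar [] = False"
| "wpar (i # w) = (ipar i \<noteq> wpar w)"

definition mhom :: "bool \<Rightarrow> mat \<Rightarrow> bool" where
  "mhom \<epsilon> A \<longleftrightarrow> (\<forall>i j. A i j \<noteq> 0 \<longrightarrow> (ipar i \<noteq> ipar j) = \<epsilon>)"

lemma mhomD: "mhom \<epsilon> A \<Longrightarrow> A i j \<noteq> 0 \<Longrightarrow> ipar j = (ipar i \<noteq> \<epsilon>)"
  by (auto simp: mhom_def)

lemma ract_add: "ract S \<epsilon> A w (\<lambda>w. f w + g w) = ract S \<epsilon> A w f + ract S \<epsilon> A w g"
  by (induction w arbitrary: f g) (simp_all add: distrib_left sum.distrib)

lemma ract_cmult: "ract S \<epsilon> A w (\<lambda>w. c * f w) = c * ract S \<epsilon> A w f"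
  by (induction w arbitrary: f) (simp_all add: distrib_left sum_distrib_left mult.left_commute)

lemma ract_cnj: "ract S \<epsilon> (\<lambda>i j. cnj (A i j)) w (\<lambda>w. cnj (f w)) = cnj (ract S \<epsilon> A w f)"
  by (induction w arbitrary: f) (simp_all add: ksign_def)

lemma ract_0 [simp]: "ract S \<epsilon> A w (\<lambda>w. 0) = 0"
  by (induction w) simp_all

lemma ract_sum: "ract S \<epsilon> A w (\<lambda>w. \<Sum>x\<in>Y. f x w) = (\<Sum>x\<in>Y. ract S \<epsilon> A w (f x))"
  by (induction Y rule: infinite_finite_induct) (simp_all add: ract_add)

lemma ract_mat_add:
  "ract S \<epsilon> (\<lambda>i j. A i j + B i j) w f = ract S \<epsilon> A w f + ract S \<epsilon> B w f"
  by (induction w arbitrary: f) (simp_all add: distrib_right distrib_left sum.distrib)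

lemma ract_mat_cmult:
  "ract S \<epsilon> (\<lambda>i j. c * A i j) w f = c * ract S \<epsilon> A w f"
  by (induction w arbitrary: f) (simp_all add: distrib_left sum_distrib_left mult.assoc mult.left_commute)

text \<open>All words contributing at \<open>w\<close> have the parity of \<open>w\<close> shifted
  by \<epsilon>, so a factor depending on parity alone can be pulled out with shifted argument. The
  sign changes of coefficient tensors rest on this.\<close>

lemma ract_parity:
  assumes "mhom \<epsilon> A"
  shows "ract S \<epsilon> A w (\<lambda>w'. c (wpar w') * f w') = c (wpar w \<noteq> \<epsilon>) * ract S \<epsilon> A w f"
proof (induction w arbitrary: f c)
  case (Cons i w)
  have "A i j * (c (wpar (j # w)) * f (j # w)) = c (wpar (i # w) \<noteq> \<epsilon>) * (A i j * f (j # w))" for j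
  proof (cases "A i j = 0")
    case False
    then have "wpar (j # w) = (wpar (i # w) \<noteq> \<epsilon>)" using mhomD[OF assms] by auto
    then show ?thesis by simp
  qed simp
  moreover have "ract S \<epsilon> A w (\<lambda>w'. c (wpar (i # w')) * f (i # w')) =
      c (wpar (i # w) \<noteq> \<epsilon>) * ract S \<epsilon> A w (\<lambda>w'. f (i # w'))"
    using Cons.IH[of "\<lambda>b. c (ipar i \<noteq> b)" "\<lambda>w'. f (i # w')"]
    by (cases "ipar i"; cases "wpar w"; cases \<epsilon>; simp only: wpar.simps HOL.simp_thms)
  ultimately show ?case
    by (simp only: ract.simps sum_distrib_left distrib_left mult.left_commute)
qed simp

definition mmul :: "idx set \<Rightarrow> mat \<Rightarrow> mat \<Rightarrow> mat" where
  "mmul S A B i j = (\<Sum>l\<in>S. A i l * B l j)"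

text \<open>The letterwise action represents the general linear superalgebra: contributions at two
  different positions supercommute by the Koszul signs, and those at the same position give the
  matrix products.\<close>

lemma ract_supercommutator:
  assumes "mhom a A" "mhom b B"
  shows "ract S a A w (\<lambda>w. ract S b B w f) = ksign a b * ract S b B w (\<lambda>w. ract S a A w f)
    + ract S (a \<noteq> b) (\<lambda>i j. mmul S A B i j - ksign a b * mmul S B A i j) w f"
proof (induction w arbitrary: f)
  case (Cons i w)
  let ?C = "\<lambda>i j. mmul S A B i j - ksign a b * mmul S B A i j"
  have s: "M i j * (ksign \<beta> (ipar j) * x) = ksign \<beta> (ipar i) * ksign \<alpha> \<beta> * (M i j * x)"
    if "mhom \<alpha> M" for M \<alpha> \<beta> j x
  proof (cases "M i j = 0")
    case False
    show ?thesis unfolding mhomD[OF that False] by (auto simp: ksign_def)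
  qed simp
  have 1: "(\<Sum>j\<in>S. M i j * ract S \<beta> N (j # w) f) =
      (\<Sum>l\<in>S. mmul S M N i l * f (l # w)) +
      ksign \<beta> (ipar i) * ksign \<alpha> \<beta> * (\<Sum>j\<in>S. M i j * ract S \<beta> N w (\<lambda>w. f (j # w)))"
    if "mhom \<alpha> M" for M N \<alpha> \<beta>
  proof -
    have "(\<Sum>j\<in>S. \<Sum>l\<in>S. M i j * (N j l * f (l # w))) = (\<Sum>l\<in>S. mmul S M N i l * f (l # w))"
      unfolding mmul_def sum_distrib_right by (subst sum.swap) (simp add: mult.assoc)
    then show ?thesis
      by (simp add: distrib_left sum.distrib sum_distrib_left s[OF that])
  qed
  have 2: "ract S \<alpha> M w (\<lambda>w'. ract S \<beta> N (i # w') f) =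
     (\<Sum>j\<in>S. N i j * ract S \<alpha> M w (\<lambda>w. f (j # w)))
     + ksign \<beta> (ipar i) * ract S \<alpha> M w (\<lambda>w'. ract S \<beta> N w' (\<lambda>w. f (i # w)))" for \<alpha> \<beta> M N
    by (simp add: ract_add ract_sum ract_cmult)
  have 3: "(\<Sum>l\<in>S. ?C i l * f (l # w)) = (\<Sum>l\<in>S. mmul S A B i l * f (l # w))
     - ksign a b * (\<Sum>l\<in>S. mmul S B A i l * f (l # w))"
    by (simp add: left_diff_distrib sum_subtractf sum_distrib_left mult.assoc)
  have 4: "ract S (a \<noteq> b) ?C (i # w) f = (\<Sum>l\<in>S. ?C i l * f (l # w))
     + ksign a (ipar i) * ksign b (ipar i) * ract S (a \<noteq> b) ?C w (\<lambda>w. f (i # w))"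
    by (simp add: ksign_neq)
  have 5: "ract S \<alpha> M (i # w) (\<lambda>w. ract S \<beta> N w f) =
    (\<Sum>l\<in>S. mmul S M N i l * f (l # w)) +
      ksign \<beta> (ipar i) * ksign \<alpha> \<beta> * (\<Sum>j\<in>S. M i j * ract S \<beta> N w (\<lambda>w. f (j # w)))
      + ksign \<alpha> (ipar i) * ((\<Sum>j\<in>S. N i j * ract S \<alpha> M w (\<lambda>w. f (j # w)))
     + ksign \<beta> (ipar i) * ract S \<alpha> M w (\<lambda>w'. ract S \<beta> N w' (\<lambda>w. f (i # w))))"
    if "mhom \<alpha> M" for \<alpha> \<beta> M N
    by (simp only: ract.simps(2)[of S \<alpha> M] 1[OF that] 2)
  show ?case
    unfolding 5[OF assms(1)] 5[OF assms(2)] 3 4 Cons.IH[of "\<lambda>w. f (i # w)"]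
    by (simp add: algebra_simps ksign_commute[of b a])
qed simp

text \<open>The Koszul signs are real and depend only on the letters to the left of the changed one,
  which stay the same; so the adjoint is the conjugate transpose without a sign correction.\<close>

lemma ract_adjoint:
  assumes "finite S"
  shows "(\<Sum>w\<in>words S m. cnj (f w) * ract S \<epsilon> A w g) =
    (\<Sum>w\<in>words S m. cnj (ract S \<epsilon> (\<lambda>i j. cnj (A j i)) w f) * g w)"
proof (induction m arbitrary: f g)
  case (Suc m)
  have c: "cnj (ksign a b) = ksign a b" for a b by (simp add: ksign_def)
  have "(\<Sum>i\<in>S. \<Sum>w\<in>words S m. \<Sum>j\<in>S. cnj (f (i # w)) * (A i j * g (j # w))) =
      (\<Sum>i\<in>S. \<Sum>w\<in>words S m. \<Sum>j\<in>S. A j i * cnj (f (j # w)) * g (i # w))"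
    (is "?l = ?r")
  proof -
    have "?l = (\<Sum>i\<in>S. \<Sum>j\<in>S. \<Sum>w\<in>words S m. cnj (f (i # w)) * (A i j * g (j # w)))"
      by (intro sum.cong refl sum.swap)
    also have "\<dots> = (\<Sum>j\<in>S. \<Sum>i\<in>S. \<Sum>w\<in>words S m. cnj (f (i # w)) * (A i j * g (j # w)))"
      by (rule sum.swap)
    also have "\<dots> = (\<Sum>j\<in>S. \<Sum>w\<in>words S m. \<Sum>i\<in>S. cnj (f (i # w)) * (A i j * g (j # w)))"
      by (intro sum.cong refl sum.swap)
    finally show ?thesis by (simp add: mult_ac)
  qed
  moreover have "(\<Sum>w\<in>words S m. ksign \<epsilon> (ipar i) * (cnj (f (i # w)) * ract S \<epsilon> A w (\<lambda>w. g (i # w)))) =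
    (\<Sum>w\<in>words S m. ksign \<epsilon> (ipar i) * (cnj (ract S \<epsilon> (\<lambda>i j. cnj (A j i)) w (\<lambda>w. f (i # w))) * g (i # w)))" for i
    unfolding sum_distrib_left[symmetric] Suc.IH[of "\<lambda>w. f (i # w)" "\<lambda>w. g (i # w)"] ..
  ultimately show ?case
    by (simp add: sum_words_Suc[OF assms] distrib_left distrib_right sum.distrib sum_distrib_left
        sum_distrib_right c mult_ac)
qed simp

definition vanish :: "idx set \<Rightarrow> vec \<Rightarrow> bool" where
  "vanish C f \<longleftrightarrow> (\<forall>w. set w \<inter> C \<noteq> {} \<longrightarrow> f w = 0)"

lemma vanish_Cons: "vanish C f \<Longrightarrow> vanish C (\<lambda>w. f (i # w))"
  by (auto simp: vanish_def)

lemma vanish_mono: "vanish C f \<Longrightarrow> D \<subseteq> C \<Longrightarrow> vanish D f"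
  unfolding vanish_def by blast

lemma ract_vanish_eq_0:
  assumes "vanish C f" "\<And>i j. A i j \<noteq> 0 \<Longrightarrow> j \<in> C"
  shows "ract S \<epsilon> A w f = 0"
  using assms(1)
proof (induction w arbitrary: f)
  case (Cons i w)
  have "A i j * f (j # w) = 0" for j
  proof (cases "A i j = 0")
    case False
    then have "j \<in> C" by (rule assms(2))
    then show ?thesis using Cons.prems by (auto simp: vanish_def)
  qed simp
  then have "(\<Sum>j\<in>S. A i j * f (j # w)) = 0" by (intro sum.neutral ballI)
  then show ?case using Cons.IH[OF vanish_Cons[OF Cons.prems]] by simp
qed simp

lemma vanish_ract:
  assumes "vanish C f" "\<And>i j. A i j \<noteq> 0 \<Longrightarrow> i \<notin> C"
  shows "vanish C (\<lambda>w. ract S \<epsilon> A w f)"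
proof -
  have "ract S \<epsilon> A w f = 0" if "vanish C f" "set w \<inter> C \<noteq> {}" for w f
    using that
  proof (induction w arbitrary: f)
    case (Cons i w)
    have "A i j * f (j # w) = 0" for j
    proof (cases "A i j = 0")
      case False
      then have "i \<notin> C" by (rule assms(2))
      then have "set (j # w) \<inter> C \<noteq> {}" using Cons.prems(2) by auto
      then show ?thesis using Cons.prems(1) by (simp only: vanish_def) simp
    qed simp
    then have "(\<Sum>j\<in>S. A i j * f (j # w)) = 0" by (intro sum.neutral ballI)
    moreover have "ract S \<epsilon> A w (\<lambda>w. f (i # w)) = 0"
    proof (cases "i \<in> C")
      case True
      then have "f (i # w) = 0" for w using Cons.prems(1) by (auto simp: vanish_def)
      then show ?thesis by simp
    next
      case False
      then show ?thesis using Cons.prems by (intro Cons.IH vanish_Cons) auto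
    qed
    ultimately show ?case by simp
  qed simp
  then show ?thesis using assms(1) by (simp add: vanish_def)
qed

lemma ract_words_cong:
  assumes "\<And>w. w \<in> words S m \<Longrightarrow> f w = g w" "w \<in> words S m"
  shows "ract S \<epsilon> A w f = ract S \<epsilon> A w g"
  using assms
proof (induction w arbitrary: m f g)
  case (Cons i w)
  then obtain m' where m: "m = Suc m'" by (cases m) (auto simp: words_def)
  have "ract S \<epsilon> A w (\<lambda>w. f (i # w)) = ract S \<epsilon> A w (\<lambda>w. g (i # w))"
    using Cons.prems by (intro Cons.IH[of m']) (auto simp: m)
  then show ?case using Cons.prems by (simp add: m)
qed simp

lemma ract_outside_words:
  assumes "\<And>w. w \<notin> words I m \<Longrightarrow> f w = 0" "w \<notin> words I m" "\<And>i j. A i j \<noteq> 0 \<Longrightarrow> i \<in> I"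
  shows "ract S \<epsilon> A w f = 0"
  using assms(1,2)
proof (induction w arbitrary: m f)
  case (Cons i w)
  show ?case
  proof (cases m)
    case 0
    then have "f (j # w) = 0" for j w using Cons.prems by simp
    then show ?thesis by simp
  next
    case (Suc m')
    show ?thesis
    proof (cases "i \<in> I")
      case True
      then have w: "w \<notin> words I m'" using Cons.prems(2) Suc by simp
      moreover have "ract S \<epsilon> A w (\<lambda>w. f (i # w)) = 0"
        using Cons.prems True by (intro Cons.IH[of m'] w) (simp_all add: Suc)
      ultimately show ?thesis using Cons.prems(1) by (simp add: Suc)
    next
      case False
      then have "f (i # w) = 0" for w using Cons.prems by (simp add: Suc)
      moreover have "A i j = 0" for j using assms(3) False by blast
      ultimately show ?thesis by simp
    qed
  qed
qed simp

section \<open>Products of homogeneous operators and queer matrices\<close>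

type_synonym hop = "bool \<times> mat"

definition rop :: "idx set \<Rightarrow> hop \<Rightarrow> vec \<Rightarrow> vec" where
  "rop S a f = (\<lambda>w. ract S (fst a) (snd a) w f)"

primrec rops :: "idx set \<Rightarrow> hop list \<Rightarrow> vec \<Rightarrow> vec" where
  "rops S [] f = f"
| "rops S (a # as) f = rop S a (rops S as f)"

lemma rops_append: "rops S (as @ bs) f = rops S as (rops S bs f)"
  by (induction as) simp_all

lemma rop_add: "rop S a (\<lambda>w. f w + g w) = (\<lambda>w. rop S a f w + rop S a g w)"
  by (simp add: rop_def ract_add)

lemma rop_cmult: "rop S a (\<lambda>w. c * f w) = (\<lambda>w. c * rop S a f w)"
  by (simp add: rop_def ract_cmult)

lemma rops_add: "rops S as (\<lambda>w. f w + g w) = (\<lambda>w. rops S as f w + rops S as g w)"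
  by (induction as) (simp_all add: rop_add)

lemma rops_cmult: "rops S as (\<lambda>w. c * f w) = (\<lambda>w. c * rops S as f w)"
  by (induction as) (simp_all add: rop_cmult)

lemma rops_0: "rops S as (\<lambda>w. 0) = (\<lambda>w. 0)"
  by (induction as) (simp_all add: rop_def)

lemma rops_sum: "rops S as (\<lambda>w. \<Sum>x\<in>Y. f x w) = (\<lambda>w. \<Sum>x\<in>Y. rops S as (f x) w)"
  by (induction Y rule: infinite_finite_induct) (simp_all add: rops_0 rops_add)

lemma rops_words_cong:
  assumes "\<And>w. w \<in> words S m \<Longrightarrow> f w = g w" "w \<in> words S m"
  shows "rops S as f w = rops S as g w"
  using assms(2)
  by (induction as arbitrary: w) (auto simp: rop_def assms(1) intro: ract_words_cong)

text \<open>The last condition says that the matrix supercommutes with the odd involution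
  \<open>bar\<close>, which characterises the queer superalgebra. Rows \<open>R\<close> and columns
  \<open>C\<close> select a corner of it: old to old is \<open>q n\<close>, \<open>block q\<close>
  to old lowers, old to \<open>block q\<close> raises.\<close>

definition qop :: "idx set \<Rightarrow> idx set \<Rightarrow> hop \<Rightarrow> bool" where
  "qop R C a \<longleftrightarrow> mhom (fst a) (snd a) \<and> (\<forall>i j. snd a i j \<noteq> 0 \<longrightarrow> i \<in> R \<and> j \<in> C)
     \<and> (\<forall>i j. snd a (bar i) (bar j) = ksign (fst a) True * snd a i j)"

definition hmul :: "idx set \<Rightarrow> hop \<Rightarrow> hop \<Rightarrow> hop" where
  "hmul S a b = (fst a \<noteq> fst b, mmul S (snd a) (snd b))"

definition hadj :: "hop \<Rightarrow> hop" where
  "hadj a = (fst a, \<lambda>i j. cnj (snd a j i))"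

lemma qop_hadj: "qop R C a \<Longrightarrow> qop C R (hadj a)"
  by (auto simp: qop_def hadj_def mhom_def ksign_def)

text \<open>Queer matrices are closed under the associative product, since \<open>bar\<close>
  permutes the summation index. Hence lowering times raising is itself an element of
  \<open>q n\<close>, not merely part of a supercommutator.\<close>

lemma qop_hmul:
  assumes "qop R C a" "qop C' D b"
  shows "qop R D (hmul (Idx N) a b)"
  unfolding qop_def
proof (intro conjI allI impI)
  have *: "\<exists>l. snd a i l \<noteq> 0 \<and> snd b l j \<noteq> 0" if "mmul (Idx N) (snd a) (snd b) i j \<noteq> 0" for i j
  proof (rule ccontr)
    assume "\<not> ?thesis"
    then have "mmul (Idx N) (snd a) (snd b) i j = 0"
      unfolding mmul_def by (intro sum.neutral) auto
    then show False using that by simp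
  qed
  show "mhom (fst (hmul (Idx N) a b)) (snd (hmul (Idx N) a b))"
    unfolding mhom_def
  proof (intro allI impI)
    fix i j assume "snd (hmul (Idx N) a b) i j \<noteq> 0"
    then obtain l where "snd a i l \<noteq> 0" "snd b l j \<noteq> 0" using * by (auto simp: hmul_def)
    then have "(ipar i \<noteq> ipar l) = fst a" "(ipar l \<noteq> ipar j) = fst b"
      using assms unfolding qop_def mhom_def by blast+
    then show "(ipar i \<noteq> ipar j) = fst (hmul (Idx N) a b)" by (auto simp: hmul_def)
  qed
  fix i j
  show "snd (hmul (Idx N) a b) (bar i) (bar j) =
    ksign (fst (hmul (Idx N) a b)) True * snd (hmul (Idx N) a b) i j"
  proof -
    have "mmul (Idx N) (snd a) (snd b) (bar i) (bar j) =
      (\<Sum>l\<in>Idx N. snd a (bar i) (bar l) * snd b (bar l) (bar j))"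
      unfolding mmul_def by (rule sum_Idx_bar[symmetric])
    then show ?thesis using assms
      by (simp add: qop_def hmul_def mmul_def sum_distrib_left ksign_neq mult_ac)
  qed
  assume "snd (hmul (Idx N) a b) i j \<noteq> 0"
  then obtain l where "snd a i l \<noteq> 0" "snd b l j \<noteq> 0" using * by (auto simp: hmul_def)
  then show "i \<in> R" "j \<in> D" using assms unfolding qop_def by blast+
qed

text \<open>The supercommutator is kept as two separate products because in each application one of
  them acts as zero.\<close>

lemma rop_supercommutator:
  assumes "qop R C a" "qop R' C' b"
  shows "rop S a (rop S b f) = (\<lambda>w. ksign (fst a) (fst b) * rop S b (rop S a f) w
     + (rop S (hmul S a b) f w - ksign (fst a) (fst b) * rop S (hmul S b a) f w))"
proof
  fix w
  have "mhom (fst a) (snd a)" "mhom (fst b) (snd b)" using assms by (auto simp: qop_def)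
  note ract_supercommutator[OF this, of S w f]
  also have "(\<lambda>i j. mmul S (snd a) (snd b) i j - ksign (fst a) (fst b) * mmul S (snd b) (snd a) i j) =
     (\<lambda>i j. mmul S (snd a) (snd b) i j + (- ksign (fst a) (fst b)) * mmul S (snd b) (snd a) i j)"
    by simp
  finally show "rop S a (rop S b f) w = ksign (fst a) (fst b) * rop S b (rop S a f) w
     + (rop S (hmul S a b) f w - ksign (fst a) (fst b) * rop S (hmul S b a) f w)"
    unfolding ract_mat_add ract_mat_cmult
    by (simp add: rop_def hmul_def HOL.neq_commute eq_commute[of "fst b"])
qed

lemma rop_hmul_eq_0:
  assumes "qop R C a" "qop R' D b" "C \<inter> R' = {}"
  shows "rop S (hmul S a b) f w = 0"
proof -
  have z: "mmul S (snd a) (snd b) = (\<lambda>i j. 0)"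
    unfolding mmul_def fun_eq_iff
  proof (intro allI sum.neutral ballI)
    fix i j l
    show "snd a i l * snd b l j = 0" using assms unfolding qop_def by fastforce
  qed
  have "ract S e (\<lambda>i j. 0) w f = 0" for e
    by (induction w arbitrary: f) simp_all
  then show ?thesis by (simp add: rop_def hmul_def z)
qed

lemma rop_vanish_eq_0: "qop R C a \<Longrightarrow> vanish C f \<Longrightarrow> rop S a f = (\<lambda>w. 0)"
  unfolding rop_def qop_def by (metis ract_vanish_eq_0)

lemma vanish_rop: "qop R C a \<Longrightarrow> R \<inter> D = {} \<Longrightarrow> vanish D f \<Longrightarrow> vanish D (rop S a f)"
  unfolding rop_def qop_def by (rule vanish_ract) auto

lemma rops_adjoint:
  assumes "finite S"
  shows "(\<Sum>w\<in>words S m. cnj (f w) * rops S as g w) =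
    (\<Sum>w\<in>words S m. cnj (rops S (rev (map hadj as)) f w) * g w)"
proof (induction "as" arbitrary: f)
  case (Cons a "as")
  have "(\<Sum>w\<in>words S m. cnj (f w) * rops S (a # as) g w) =
     (\<Sum>w\<in>words S m. cnj (rop S (hadj a) f w) * rops S as g w)"
    unfolding rops.simps rop_def hadj_def fst_conv snd_conv by (rule ract_adjoint[OF assms])
  then show ?case by (simp add: Cons.IH rops_append)
qed simp

definition block :: "nat \<Rightarrow> idx set" where
  "block q = {Ev q, Od q}"

lemma block_disjoint: "q \<noteq> r \<Longrightarrow> block q \<inter> block r = {}" "n < q \<Longrightarrow> Idx n \<inter> block q = {}"
  by (auto simp: block_def Idx_def)

text \<open>\<open>\<Theta>\<close> stands for the adjoint of the coefficient matrix. Operators act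
  over the enlarged range \<open>N\<close>, while commutation is assumed with \<open>q n\<close>
  alone; the point is to extend it to products that leave the old indices and return.\<close>

locale commuting =
  fixes n N :: nat and \<Theta> :: "vec \<Rightarrow> vec"
  assumes \<Theta>_add: "\<Theta> (\<lambda>w. f w + g w) = (\<lambda>w. \<Theta> f w + \<Theta> g w)"
    and \<Theta>_cmult: "\<Theta> (\<lambda>w. c * f w) = (\<lambda>w. c * \<Theta> f w)"
    and \<Theta>_vanish: "vanish (- Idx n) (\<Theta> f)"
    and \<Theta>_rop: "qop (Idx n) (Idx n) a \<Longrightarrow> \<Theta> (rop (Idx N) a f) = rop (Idx N) a (\<Theta> f)"
begin

text \<open>
  On vectors without letters from \<open>block q\<close>, lowering after raising is the action of the
  product matrix, which lies in \<open>q n\<close>; that action is then moved to the right through the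
  remaining raising operators.
\<close>

lemma commute_blocks:
  assumes "list_all2 (\<lambda>q a. qop (Idx n) (block q) a) qs Ls"
    and "list_all2 (\<lambda>q a. qop (block q) (Idx n) a) qs Rs"
    and "distinct qs" "\<forall>q\<in>set qs. n < q" "vanish (- Idx n) f"
  shows "\<Theta> (rops (Idx N) Ls (rops (Idx N) (rev Rs) f)) = rops (Idx N) Ls (rops (Idx N) (rev Rs) (\<Theta> f))"
  using assms
proof (induction qs arbitrary: Ls Rs f rule: rev_induct)
  case Nil
  then show ?case by simp
next
  case (snoc q qs)
  note IH = snoc.IH
  let ?J = "Idx N"
  obtain Ls0 L where Ls: "Ls = Ls0 @ [L]" and L0: "list_all2 (\<lambda>q a. qop (Idx n) (block q) a) qs Ls0"
    and L: "qop (Idx n) (block q) L"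
    using snoc.prems(1) by (auto simp: list_all2_append1 list_all2_Cons1)
  obtain Rs0 R where Rs: "Rs = Rs0 @ [R]" and R0: "list_all2 (\<lambda>q a. qop (block q) (Idx n) a) qs Rs0"
    and R: "qop (block q) (Idx n) R"
    using snoc.prems(2) by (auto simp: list_all2_append1 list_all2_Cons1)
  have d: "distinct qs" "\<forall>q\<in>set qs. n < q" "q \<notin> set qs" "n < q" using snoc.prems by auto
  \<comment> \<open>Before \<open>R\<close> acts, the vector has no letter from
    \<open>block q\<close>, since the other raising operators create letters from other blocks only.
    So \<open>L\<close> kills it, and so does \<open>hmul R L\<close>, whose columns lie in
    \<open>block q\<close>; only \<open>hmul L R\<close> survives.\<close>
  have contract: "rops ?J Ls (rops ?J (rev Rs) g) =
      rops ?J Ls0 (rop ?J (hmul ?J L R) (rops ?J (rev Rs0) g))" if "vanish (- Idx n) g" for g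
  proof -
    have "vanish (block q) g" using vanish_mono[OF that, of "block q"] block_disjoint(2)[OF d(4)] by blast
    moreover have "vanish (block q) (rops ?J as h)"
      if "vanish (block q) h" "\<forall>a\<in>set as. \<exists>q'\<in>set qs. qop (block q') (Idx n) a" for h "as"
      using that(2)
    proof (induction "as")
      case (Cons a "as")
      then obtain q' where q': "q' \<in> set qs" "qop (block q') (Idx n) a" by auto
      then have "q \<noteq> q'" using d(3) by auto
      then show ?case using Cons q' block_disjoint(1)[of q' q] by (auto intro: vanish_rop)
    qed (simp add: that(1))
    moreover have "\<forall>a\<in>set (rev Rs0). \<exists>q'\<in>set qs. qop (block q') (Idx n) a"
    proof
      fix a assume "a \<in> set (rev Rs0)"
      then obtain i where i: "i < length Rs0" "a = Rs0 ! i" by (auto simp: in_set_conv_nth)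
      then have "qs ! i \<in> set qs" "qop (block (qs ! i)) (Idx n) a"
        using R0 by (auto simp: list_all2_conv_all_nth)
      then show "\<exists>q'\<in>set qs. qop (block q') (Idx n) a" by blast
    qed
    ultimately have v: "vanish (block q) (rops ?J (rev Rs0) g)" by blast
    have "rop ?J (hmul ?J R L) (rops ?J (rev Rs0) g) = (\<lambda>w. 0)"
      by (rule rop_vanish_eq_0[OF qop_hmul[OF R L] v])
    moreover have "rop ?J R (\<lambda>w. 0) = (\<lambda>w. 0)" by (simp add: rop_def)
    ultimately have "rop ?J L (rop ?J R (rops ?J (rev Rs0) g)) =
        rop ?J (hmul ?J L R) (rops ?J (rev Rs0) g)"
      unfolding rop_supercommutator[OF L R] rop_vanish_eq_0[OF L v] by simp
    then show ?thesis by (simp add: Ls Rs rops_append)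
  qed
  \<comment> \<open>\<open>R2\<close> holds the operators that \<open>B\<close> still has to pass.
    Passing \<open>R'\<close> leaves the correction \<open>hmul R' B\<close>, again a raising
    operator for the same block, so the outer induction hypothesis with one block fewer applies;
    \<open>hmul B R'\<close> acts as zero since old indices and blocks are disjoint.\<close>
  have move: "\<Theta> (rops ?J Ls0 (rops ?J (rev R1) (rop ?J B (rops ?J (rev R2) g)))) =
      rops ?J Ls0 (rops ?J (rev R1) (rop ?J B (rops ?J (rev R2) (\<Theta> g))))"
    if "list_all2 (\<lambda>q a. qop (block q) (Idx n) a) qs (R2 @ R1)" "qop (Idx n) (Idx n) B"
      "vanish (- Idx n) g" for R1 R2 B g
    using that
  proof (induction R2 arbitrary: R1 B rule: rev_induct)
    case Nil
    have "vanish (- Idx n) (rop ?J B g)" by (rule vanish_rop[OF Nil(2) _ Nil(3)]) auto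
    then show ?case using snoc.IH[OF L0 _ d(1,2), of R1 "rop ?J B g"] Nil
      by (simp add: \<Theta>_rop)
  next
    case (snoc R' R2)
    obtain qs1 q' qs2 where q': "qs = qs1 @ q' # qs2" "qop (block q') (Idx n) R'"
      "list_all2 (\<lambda>q a. qop (block q) (Idx n) a) qs1 R2"
      "list_all2 (\<lambda>q a. qop (block q) (Idx n) a) qs2 R1"
      using snoc.prems(1) by (auto simp: list_all2_append2 list_all2_Cons2)
    have RB: "qop (block q') (Idx n) (hmul ?J R' B)" by (rule qop_hmul[OF q'(2) snoc.prems(2)])
    let ?k = "ksign (fst B) (fst R')"
    have "Idx n \<inter> block q' = {}" using d(2) q'(1) by (intro block_disjoint) auto
    then have z: "rop ?J (hmul ?J B R') h w = 0" for h w
      by (rule rop_hmul_eq_0[OF snoc.prems(2) q'(2)])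
    have e: "rops ?J Ls0 (rops ?J (rev R1) (rop ?J B (rops ?J (rev (R2 @ [R'])) h))) =
       (\<lambda>w. ?k * rops ?J Ls0 (rops ?J (rev (R' # R1)) (rop ?J B (rops ?J (rev R2) h))) w
          + (- ?k) * rops ?J Ls0 (rops ?J (rev (R2 @ hmul ?J R' B # R1)) h) w)" for h
      by (simp only: rev_append rev.simps append.simps rops_append rops.simps
          rop_supercommutator[OF snoc.prems(2) q'(2)] z diff_0 minus_mult_left rops_add rops_cmult)
    have 1: "\<Theta> (rops ?J Ls0 (rops ?J (rev (R' # R1)) (rop ?J B (rops ?J (rev R2) g)))) =
        rops ?J Ls0 (rops ?J (rev (R' # R1)) (rop ?J B (rops ?J (rev R2) (\<Theta> g))))"
      by (rule snoc.IH) (use snoc.prems in simp_all)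
    have 2: "\<Theta> (rops ?J Ls0 (rops ?J (rev (R2 @ hmul ?J R' B # R1)) g)) =
       rops ?J Ls0 (rops ?J (rev (R2 @ hmul ?J R' B # R1)) (\<Theta> g))"
      by (rule IH[OF L0 _ d(1,2) snoc.prems(3)])
         (use q' RB in \<open>auto intro: list_all2_appendI\<close>)
    show ?case unfolding e \<Theta>_add \<Theta>_cmult 1 2 ..
  qed
  have "qop (Idx n) (Idx n) (hmul ?J L R)" by (rule qop_hmul[OF L R])
  from move[of Rs0 "[]", OF _ this snoc.prems(5)] show ?case
    using R0 by (simp add: contract[OF snoc.prems(5)] contract[OF \<Theta>_vanish])
qed

end

section \<open>The commutant of the queer superalgebra on words\<close>

lemma sum_cnj_self_eq_0:
  assumes "finite A" "(\<Sum>x\<in>A. cnj (z x) * z x) = 0" "x \<in> A"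
  shows "z x = 0"
proof -
  have "(\<Sum>x\<in>A. cnj (z x) * z x) = complex_of_real (\<Sum>x\<in>A. (cmod (z x))\<^sup>2)"
    unfolding of_real_sum by (intro sum.cong refl) (simp only: complex_norm_square mult.commute)
  then have "(\<Sum>x\<in>A. (cmod (z x))\<^sup>2) = 0" unfolding assms(2) by (metis of_real_eq_0_iff)
  then show ?thesis using assms(1,3) by (simp add: sum_nonneg_eq_0_iff)
qed

text \<open>Gram-Schmidt, one vector at a time: \<open>K y\<close> is made orthogonal to the earlier
  family, and its remainder \<open>g\<close> is then split off from \<open>T\<close>. The induction
  hypothesis is applied to both \<open>T\<close> and \<open>K y\<close>, so \<open>T\<close> is
  generalised.\<close>

lemma orthogonal_decomposition:
  fixes K :: "'y \<Rightarrow> 'a \<Rightarrow> complex" and T :: "'a \<Rightarrow> complex"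
  assumes "finite Y" "finite \<Omega>"
  shows "\<exists>\<beta> z. (\<forall>x\<in>\<Omega>. T x = (\<Sum>y\<in>Y. \<beta> y * K y x) + z x) \<and>
    (\<forall>y\<in>Y. (\<Sum>x\<in>\<Omega>. cnj (z x) * K y x) = 0)"
  using assms(1)
proof (induction Y arbitrary: T)
  case empty
  then show ?case by (intro exI[of _ "\<lambda>_. 0"] exI[of _ T]) simp
next
  case (insert y Y)
  obtain \<beta> z where T: "\<And>x. x \<in> \<Omega> \<Longrightarrow> T x = (\<Sum>y\<in>Y. \<beta> y * K y x) + z x"
    and z: "\<And>y. y \<in> Y \<Longrightarrow> (\<Sum>x\<in>\<Omega>. cnj (z x) * K y x) = 0" using insert.IH[of T] by blast
  obtain \<gamma> g where K: "\<And>x. x \<in> \<Omega> \<Longrightarrow> K y x = (\<Sum>y\<in>Y. \<gamma> y * K y x) + g x"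
    and g: "\<And>y. y \<in> Y \<Longrightarrow> (\<Sum>x\<in>\<Omega>. cnj (g x) * K y x) = 0" using insert.IH[of "K y"] by blast
  define N where "N = (\<Sum>x\<in>\<Omega>. cnj (g x) * g x)"
  \<comment> \<open>If \<open>N = 0\<close>, then \<open>g\<close> vanishes on
    \<open>\<Omega>\<close> and division by zero gives \<open>\<alpha> = 0\<close>, so a dependent
    \<open>K y\<close> needs no separate construction.\<close>
  define \<alpha> where "\<alpha> = (\<Sum>x\<in>\<Omega>. cnj (g x) * z x) / N"
  define z' where "z' x = z x - \<alpha> * g x" for x
  define \<beta>' where "\<beta>' y' = (if y' = y then \<alpha> else \<beta> y' - \<alpha> * \<gamma> y')" for y'
  have g0: "g x = 0" if "N = 0" "x \<in> \<Omega>" for x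
    using sum_cnj_self_eq_0[OF assms(2), of g] that by (simp add: N_def)
  have gz: "(\<Sum>x\<in>\<Omega>. cnj (g x) * z' x) = 0"
  proof (cases "N = 0")
    case True
    then show ?thesis using g0 by simp
  next
    case False
    have "(\<Sum>x\<in>\<Omega>. cnj (g x) * z' x) = (\<Sum>x\<in>\<Omega>. cnj (g x) * z x) - \<alpha> * N"
      by (simp add: z'_def N_def sum_distrib_left sum_subtractf algebra_simps)
    then show ?thesis using False by (simp add: \<alpha>_def)
  qed
  have zg: "(\<Sum>x\<in>\<Omega>. cnj (z' x) * g x) = 0"
    using arg_cong[OF gz, of cnj] by (simp add: mult.commute)
  have Y: "(\<Sum>x\<in>\<Omega>. cnj (z' x) * K y' x) = 0" if "y' \<in> Y" for y'
  proof -
    have "(\<Sum>x\<in>\<Omega>. cnj (z' x) * K y' x) =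
      (\<Sum>x\<in>\<Omega>. cnj (z x) * K y' x) - cnj \<alpha> * (\<Sum>x\<in>\<Omega>. cnj (g x) * K y' x)"
      by (simp add: z'_def sum_distrib_left sum_subtractf algebra_simps)
    then show ?thesis using z g that by simp
  qed
  have "(\<Sum>x\<in>\<Omega>. cnj (z' x) * K y x) =
    (\<Sum>x\<in>\<Omega>. cnj (z' x) * (\<Sum>y\<in>Y. \<gamma> y * K y x)) + (\<Sum>x\<in>\<Omega>. cnj (z' x) * g x)"
    unfolding sum.distrib[symmetric] distrib_left[symmetric] using K by (intro sum.cong) auto
  also have "(\<Sum>x\<in>\<Omega>. cnj (z' x) * (\<Sum>y\<in>Y. \<gamma> y * K y x)) =
     (\<Sum>y\<in>Y. \<gamma> y * (\<Sum>x\<in>\<Omega>. cnj (z' x) * K y x))"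
    unfolding sum_distrib_left by (subst sum.swap) (simp add: mult_ac)
  finally have y: "(\<Sum>x\<in>\<Omega>. cnj (z' x) * K y x) = 0" using Y zg by simp
  have "T x = (\<Sum>y\<in>insert y Y. \<beta>' y * K y x) + z' x" if "x \<in> \<Omega>" for x
  proof -
    have "(\<Sum>y'\<in>Y. \<beta>' y' * K y' x) = (\<Sum>y\<in>Y. \<beta> y * K y x) - \<alpha> * (\<Sum>y\<in>Y. \<gamma> y * K y x)"
      unfolding sum_distrib_left sum_subtractf[symmetric]
      using insert.hyps by (intro sum.cong) (auto simp: \<beta>'_def algebra_simps)
    then have "(\<Sum>y\<in>insert y Y. \<beta>' y * K y x) =
        \<alpha> * K y x + (\<Sum>y\<in>Y. \<beta> y * K y x) - \<alpha> * (\<Sum>y\<in>Y. \<gamma> y * K y x)"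
      using insert.hyps by (simp add: \<beta>'_def)
    then show ?thesis by (simp add: T[OF that] K[OF that] z'_def algebra_simps)
  qed
  then show ?case using y Y by (intro exI[of _ \<beta>'] exI[of _ z']) simp
qed

text \<open>The remainder of the projection is orthogonal to each \<open>K y\<close>, hence by
  assumption to \<open>T\<close>, hence to itself.\<close>

lemma in_span_if_orthogonal:
  fixes K :: "'y \<Rightarrow> 'a \<Rightarrow> complex" and T :: "'a \<Rightarrow> complex"
  assumes "finite Y" "finite \<Omega>"
    and orth: "\<And>z. (\<And>y. y \<in> Y \<Longrightarrow> (\<Sum>x\<in>\<Omega>. cnj (z x) * K y x) = 0) \<Longrightarrow> (\<Sum>x\<in>\<Omega>. cnj (z x) * T x) = 0"
  shows "\<exists>\<beta>. \<forall>x\<in>\<Omega>. T x = (\<Sum>y\<in>Y. \<beta> y * K y x)"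
proof -
  obtain \<beta> z where T: "\<And>x. x \<in> \<Omega> \<Longrightarrow> T x = (\<Sum>y\<in>Y. \<beta> y * K y x) + z x"
    and z: "\<And>y. y \<in> Y \<Longrightarrow> (\<Sum>x\<in>\<Omega>. cnj (z x) * K y x) = 0"
    using orthogonal_decomposition[OF assms(1,2), of T K] by blast
  have "0 = (\<Sum>x\<in>\<Omega>. cnj (z x) * T x)" using orth[OF z] by simp
  also have "\<dots> = (\<Sum>x\<in>\<Omega>. cnj (z x) * (\<Sum>y\<in>Y. \<beta> y * K y x)) + (\<Sum>x\<in>\<Omega>. cnj (z x) * z x)"
    unfolding sum.distrib[symmetric] distrib_left[symmetric] using T by (intro sum.cong) auto
  also have "(\<Sum>x\<in>\<Omega>. cnj (z x) * (\<Sum>y\<in>Y. \<beta> y * K y x)) =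
     (\<Sum>y\<in>Y. \<beta> y * (\<Sum>x\<in>\<Omega>. cnj (z x) * K y x))"
    unfolding sum_distrib_left by (subst sum.swap) (simp add: mult_ac)
  finally have "(\<Sum>x\<in>\<Omega>. cnj (z x) * z x) = 0" using z by simp
  then have "\<forall>x\<in>\<Omega>. z x = 0" using sum_cnj_self_eq_0[OF assms(2)] by blast
  then show ?thesis using T by auto
qed

text \<open>
  The lowering matrix sends \<open>e\<^sub>q\<close> to \<open>e\<^sub>i\<close>; its second entry is forced by membership in the queer
  superalgebra.
\<close>

definition low :: "idx \<Rightarrow> nat \<Rightarrow> hop" where
  "low i q = (ipar i, \<lambda>a b. if a = i \<and> b = Ev q then 1
     else if a = bar i \<and> b = Od q then ksign (ipar i) True else 0)"

lemma bar_eq_iff: "bar a = b \<longleftrightarrow> a = bar b"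
  by auto

lemma qop_low:
  assumes "i \<in> Idx n"
  shows "qop (Idx n) (block q) (low i q)"
proof -
  have "bar i \<noteq> i" by (metis ipar_bar)
  moreover have "bar b = Ev q \<longleftrightarrow> b = Od q" "bar b = Od q \<longleftrightarrow> b = Ev q" for b by (cases b; simp)+
  ultimately show ?thesis
    using assms by (auto simp: qop_def low_def mhom_def block_def bar_eq_iff)
qed

definition lows :: "idx list \<Rightarrow> nat list \<Rightarrow> hop list" where
  "lows u qs = map (\<lambda>(i, q). low i q) (zip u qs)"

lemma lows_Cons [simp]: "lows (i # u) (q # qs) = low i q # lows u qs"
  by (simp add: lows_def)

lemma list_all2_lows:
  assumes "set u \<subseteq> Idx n" "length u = length qs"
  shows "list_all2 (\<lambda>q a. qop (Idx n) (block q) a) qs (lows u qs)"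
  unfolding list_all2_conv_all_nth lows_def using assms by (auto intro!: qop_low)

lemma list_all2_lows_adj:
  assumes "set u \<subseteq> Idx n" "length u = length qs"
  shows "list_all2 (\<lambda>q a. qop (block q) (Idx n) a) qs (map hadj (lows u qs))"
  unfolding list_all2_conv_all_nth lows_def using assms by (auto intro!: qop_hadj qop_low)

section \<open>Supports of lowered words and evaluation of raised vectors\<close>

definition delta :: "idx list \<Rightarrow> vec" where
  "delta y w = (if w = y then 1 else 0)"

definition outer_count :: "nat \<Rightarrow> idx list \<Rightarrow> nat" where
  "outer_count n w = length (filter (\<lambda>i. i \<notin> Idx n) w)"

text \<open>Every nonzero entry trades a new letter for an old one, so the maximal number of new
  letters in the support drops by one. After m such operators on a word of length m, only words over
  the old indices are left.\<close>

lemma ract_lowering: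
  assumes "\<And>w. outer_count n w > l \<Longrightarrow> f w = 0" "outer_count n w \<ge> l"
    and A: "\<And>i j. A i j \<noteq> 0 \<Longrightarrow> i \<in> Idx n \<and> j \<notin> Idx n"
  shows "ract S \<epsilon> A w f = 0"
  using assms(1,2)
proof (induction w arbitrary: f l)
  case (Cons i w)
  have "A i j * f (j # w) = 0" for j
  proof (cases "A i j = 0")
    case False
    then have "outer_count n (j # w) > l" using A[of i j] Cons.prems(2) by (simp add: outer_count_def)
    then show ?thesis using Cons.prems(1) by simp
  qed simp
  then have "(\<Sum>j\<in>S. A i j * f (j # w)) = 0" by (intro sum.neutral ballI)
  moreover have "ract S \<epsilon> A w (\<lambda>w. f (i # w)) = 0"
  proof (cases "i \<in> Idx n")
    case True
    then show ?thesis using Cons.prems by (intro Cons.IH[of l]) (simp_all add: outer_count_def)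
  next
    case False
    show ?thesis
    proof (cases l)
      case 0
      then have "f (i # w) = 0" for w using Cons.prems(1) False by (simp add: outer_count_def)
      then show ?thesis by simp
    next
      case (Suc l')
      then show ?thesis using Cons.prems False by (intro Cons.IH[of l']) (simp_all add: outer_count_def)
    qed
  qed
  ultimately show ?case by simp
qed simp

lemma rops_lowering:
  assumes "\<And>w. outer_count n w > l + length as \<Longrightarrow> f w = 0"
    and "\<forall>a\<in>set as. \<exists>q>n. qop (Idx n) (block q) a" "outer_count n w > l"
  shows "rops S as f w = 0"
  using assms
proof (induction "as" arbitrary: l w)
  case (Cons a "as")
  obtain q where q: "q > n" "qop (Idx n) (block q) a" using Cons.prems(2) by auto
  have "snd a i j \<noteq> 0 \<Longrightarrow> i \<in> Idx n \<and> j \<notin> Idx n" for i j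
    using q block_disjoint(2)[OF q(1)] unfolding qop_def by blast
  moreover have "rops S as f w' = 0" if "outer_count n w' > Suc l" for w'
    using Cons.prems that by (intro Cons.IH[of "Suc l"]) auto
  ultimately show ?case
    using Cons.prems(3) unfolding rops.simps rop_def by (intro ract_lowering[of "Suc l" n]) auto
qed simp

lemma lows_delta_outside:
  assumes "u \<in> words (Idx n) (length qs)" "length y = length qs" "\<forall>q\<in>set qs. n < q" "\<not> set w \<subseteq> Idx n"
  shows "rops S (lows u qs) (delta y) w = 0"
proof (rule rops_lowering[of 0 _ n])
  have [simp]: "length (lows u qs) = length qs" using assms by (simp add: lows_def words_def)
  show "delta y w' = 0" if "0 + length (lows u qs) < outer_count n w'" for w'
    using that assms(2) length_filter_le[of "\<lambda>i. i \<notin> Idx n" w']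
    by (cases "w' = y") (simp_all add: delta_def outer_count_def)
  show "\<forall>a\<in>set (lows u qs). \<exists>q>n. qop (Idx n) (block q) a"
  proof
    fix a assume "a \<in> set (lows u qs)"
    then obtain i q where "a = low i q" "i \<in> set u" "q \<in> set qs"
      by (auto simp: lows_def dest: set_zip_leftD set_zip_rightD)
    then show "\<exists>q>n. qop (Idx n) (block q) a" using assms by (auto simp: words_def intro!: qop_low)
  qed
  show "0 < outer_count n w" using assms(4) by (auto simp: outer_count_def filter_empty_conv)
qed

lemma ract_rows_eq_0: "(\<And>i j. i \<in> set w \<Longrightarrow> A i j = 0) \<Longrightarrow> ract S \<epsilon> A w f = 0"
  by (induction w arbitrary: f) auto

text \<open>Row \<open>Ev q\<close> of the adjoint is the unit row at \<open>u\<close>, and no other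
  letter of the word lies in \<open>block q\<close>, so only this position contributes; the even
  prefix makes its Koszul sign trivial.\<close>

lemma rop_raise_at:
  assumes "finite S" "u \<in> S" "\<forall>i\<in>set ps. \<not> ipar i" "set ps \<inter> block q = {}" "set ws \<inter> block q = {}"
  shows "rop S (hadj (low u q)) f (ps @ Ev q # ws) = f (ps @ u # ws)"
proof -
  let ?A = "snd (hadj (low u q))"
  have 0: "?A i j = 0" if "i \<notin> block q" for i j
    using that by (auto simp: hadj_def low_def block_def)
  have 1: "?A (Ev q) j = (if j = u then 1 else 0)" for j
    by (auto simp: hadj_def low_def)
  have "ract S e ?A (ps @ Ev q # ws) f = f (ps @ u # ws)" for e
    using assms(3,4)
  proof (induction ps arbitrary: f)
    case Nil
    have "ract S e ?A ws g = 0" for g using assms(5) by (intro ract_rows_eq_0 0) auto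
    moreover have "(\<Sum>j\<in>S. ?A (Ev q) j * f (j # ws)) = f (u # ws)"
      unfolding 1 using assms(1,2) by (simp add: if_distrib[of "\<lambda>x. x * _"] sum.delta cong: if_cong)
    ultimately show ?case by simp
  next
    case (Cons p ps)
    have "?A p j = 0" for j using Cons.prems by (intro 0) auto
    then show ?case using Cons by simp
  qed
  then show ?thesis by (simp add: rop_def)
qed

text \<open>As the new letters are distinct, each raising operator acts only at its own position. In
  the induction the prefix \<open>ps\<close> collects letters whose operators stand nearer to
  \<open>f\<close> and are evaluated afterwards.\<close>

lemma rops_raise_at:
  assumes "finite S" "set u \<subseteq> S" "set u \<subseteq> Idx n" "length u = length qs" "distinct qs" "\<forall>q\<in>set qs. n < q"
    "\<forall>i\<in>set ps. \<not> ipar i" "\<forall>q\<in>set qs. set ps \<inter> block q = {}"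
  shows "rops S (rev (map hadj (lows u qs))) f (ps @ map Ev qs) = f (ps @ u)"
  using assms(2-)
proof (induction qs arbitrary: u ps f)
  case (Cons q qs)
  then obtain i u' where u: "u = i # u'" by (cases u) auto
  have "rops S (rev (map hadj (lows u (q # qs)))) f (ps @ map Ev (q # qs)) =
     rops S (rev (map hadj (lows u' qs))) (rop S (hadj (low i q)) f) ((ps @ [Ev q]) @ map Ev qs)"
    by (simp add: u rops_append)
  also have "\<dots> = rop S (hadj (low i q)) f ((ps @ [Ev q]) @ u')"
    using Cons.prems by (intro Cons.IH) (auto simp: u block_def)
  also have "\<dots> = f (ps @ u)"
    using rop_raise_at[of S i ps q u' f] Cons.prems block_disjoint(2)[of n q] assms(1) by (auto simp: u)
  finally show ?case .
qed (simp add: lows_def)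

lemma Idx_mono: "n \<le> N \<Longrightarrow> Idx n \<subseteq> Idx N"
  by (auto simp: Idx_def)

lemma words_mono: "S \<subseteq> S' \<Longrightarrow> words S m \<subseteq> words S' m"
  by (auto simp: words_def)

text \<open>
  A vector orthogonal to all lowered words \<open>rops (lows u qs) (delta y)\<close> is annihilated by raising,
  summed over \<open>u\<close>. The adjoint of \<open>T\<close> preserves this property, and evaluating the
  raised sum at the word \<open>map Ev qs\<close> gives the pairing with \<open>T\<close>.
\<close>

lemma sergeev_duality:
  fixes T :: "idx list \<Rightarrow> idx list \<Rightarrow> complex"
  assumes N: "n \<le> N" and qs: "distinct qs" "\<forall>q\<in>set qs. n < q \<and> q \<le> N" "length qs = m"
    and T_supp: "\<And>w u. T w u \<noteq> 0 \<Longrightarrow> w \<in> words (Idx n) m \<and> u \<in> words (Idx n) m"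
    and T_comm: "\<And>a w u. qop (Idx n) (Idx n) a \<Longrightarrow> ract (Idx N) (fst a) (snd a) w (\<lambda>w. T w u) =
        ract (Idx N) (fst a) (\<lambda>i j. snd a j i) u (\<lambda>u. T w u)"
  shows "\<exists>\<beta>. \<forall>w\<in>words (Idx N) m. \<forall>u\<in>words (Idx n) m.
    T w u = (\<Sum>y\<in>words (Idx N) m. \<beta> y * rops (Idx N) (lows u qs) (delta y) w)"
proof -
  let ?I = "Idx n" and ?J = "Idx N"
  let ?WI = "words ?I m" and ?WJ = "words ?J m"
  let ?low = "\<lambda>u. rops ?J (lows u qs)"
  let ?raise = "\<lambda>u. rops ?J (rev (map hadj (lows u qs)))"
  have IJ: "?I \<subseteq> ?J" using N by (rule Idx_mono)
  have WIJ: "?WI \<subseteq> ?WJ" using IJ by (rule words_mono)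
  have fin [simp]: "finite ?I" "finite ?J" "finite ?WI" "finite ?WJ"
    by (simp_all add: finite_Idx finite_words)
  have qs': "\<forall>q\<in>set qs. n < q" using qs by auto
  have u: "set u \<subseteq> ?I" "length u = length qs" if "u \<in> ?WI" for u
    using that qs by (auto simp: words_def)
  define \<Theta> where "\<Theta> z u = (\<Sum>w\<in>?WJ. cnj (T w u) * z w)" for z u
  interpret commuting n N \<Theta>
  proof
    fix f g :: vec and c and a
    show "\<Theta> (\<lambda>w. f w + g w) = (\<lambda>w. \<Theta> f w + \<Theta> g w)"
      by (simp add: fun_eq_iff \<Theta>_def distrib_left sum.distrib)
    show "\<Theta> (\<lambda>w. c * f w) = (\<lambda>w. c * \<Theta> f w)"
      by (simp add: fun_eq_iff \<Theta>_def sum_distrib_left mult_ac)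
    show "vanish (- ?I) (\<Theta> f)"
      unfolding vanish_def
    proof (intro allI impI)
      fix u assume "set u \<inter> - ?I \<noteq> {}"
      then have "T w u = 0" for w using T_supp[of w u] by (auto simp: words_def)
      then show "\<Theta> f u = 0" by (simp add: \<Theta>_def)
    qed
    assume a: "qop ?I ?I a"
    show "\<Theta> (rop ?J a f) = rop ?J a (\<Theta> f)"
    proof
      fix u
      have "\<Theta> (rop ?J a f) u = (\<Sum>w\<in>?WJ. cnj (ract ?J (fst a) (\<lambda>i j. cnj (snd a j i)) w (\<lambda>w. T w u)) * f w)"
        unfolding \<Theta>_def rop_def by (rule ract_adjoint) simp
      also have "\<dots> = (\<Sum>w\<in>?WJ. ract ?J (fst a) (snd a) u (\<lambda>u. cnj (T w u)) * f w)"
        using T_comm[OF qop_hadj[OF a], of _ u] by (simp add: hadj_def flip: ract_cnj)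
      also have "\<dots> = rop ?J a (\<Theta> f) u"
        unfolding rop_def \<Theta>_def ract_sum by (simp add: ract_cmult mult.commute)
      finally show "\<Theta> (rop ?J a f) u = rop ?J a (\<Theta> f) u" .
    qed
  qed
  have \<Theta>_sum: "\<Theta> (\<lambda>w. \<Sum>x\<in>Y. f x w) = (\<lambda>w. \<Sum>x\<in>Y. \<Theta> (f x) w)" for f :: "idx list \<Rightarrow> vec" and Y
  proof (induction Y rule: infinite_finite_induct)
    case (insert x Y)
    then show ?case by (simp add: \<Theta>_add)
  qed (use \<Theta>_cmult[of 0 "\<lambda>_. 0"] in simp_all)
  \<comment> \<open>A matrix is read as one vector indexed by pairs of words, so that a single
    family \<beta> serves all columns \<open>u\<close> at once.\<close>
  have "\<exists>\<beta>. \<forall>x\<in>?WJ \<times> ?WI. (case x of (w, u) \<Rightarrow> T w u) =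
      (\<Sum>y\<in>?WJ. \<beta> y * (case x of (w, u) \<Rightarrow> ?low u (delta y) w))"
  proof (rule in_span_if_orthogonal)
    fix z :: "idx list \<times> idx list \<Rightarrow> complex"
    assume "\<And>y. y \<in> ?WJ \<Longrightarrow>
      (\<Sum>x\<in>?WJ \<times> ?WI. cnj (z x) * (case x of (w, u) \<Rightarrow> ?low u (delta y) w)) = 0"
    then have orth: "(\<Sum>u\<in>?WI. \<Sum>w\<in>?WJ. cnj (z (w, u)) * ?low u (delta y) w) = 0" if "y \<in> ?WJ" for y
      using that by (simp add: sum.cartesian_product' sum.swap[of _ ?WI ?WJ])
    \<comment> \<open>Cutting off at the old words costs nothing, as lowered words are supported
      there, and it supplies the support condition of \<open>commute_blocks\<close>.\<close>
    define Z where "Z u w = (if w \<in> ?WI then z (w, u) else 0)" for u w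
    have Zv: "vanish (- ?I) (Z u)" for u
      unfolding vanish_def Z_def words_def by auto
    have raise0: "(\<Sum>u\<in>?WI. ?raise u (Z u) y) = 0" if y: "y \<in> ?WJ" for y
    proof -
      have "(\<Sum>w\<in>?WJ. cnj (z (w, u)) * ?low u (delta y) w) = cnj (?raise u (Z u) y)"
        if "u \<in> ?WI" for u
      proof -
        have "(\<Sum>w\<in>?WJ. cnj (z (w, u)) * ?low u (delta y) w) =
           (\<Sum>w\<in>?WJ. cnj (Z u w) * ?low u (delta y) w)"
        proof (rule sum.cong[OF refl])
          fix w assume w: "w \<in> ?WJ"
          show "cnj (z (w, u)) * ?low u (delta y) w = cnj (Z u w) * ?low u (delta y) w"
          proof (cases "w \<in> ?WI")
            case False
            then have "\<not> set w \<subseteq> ?I" using w by (auto simp: words_def)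
            then have "?low u (delta y) w = 0"
              using that y qs qs' by (intro lows_delta_outside) (auto simp: words_def)
            then show ?thesis by simp
          qed (simp add: Z_def)
        qed
        also have "\<dots> = (\<Sum>w\<in>?WJ. cnj (?raise u (Z u) w) * delta y w)"
          by (rule rops_adjoint) simp
        also have "\<dots> = (\<Sum>w\<in>?WJ. if w = y then cnj (?raise u (Z u) w) else 0)"
          by (intro sum.cong refl) (simp add: delta_def)
        also have "\<dots> = cnj (?raise u (Z u) y)" using y by simp
        finally show ?thesis .
      qed
      then have "(\<Sum>u\<in>?WI. cnj (?raise u (Z u) y)) = 0" using orth[OF y] by simp
      then have "cnj (\<Sum>u\<in>?WI. ?raise u (Z u) y) = 0" by simp
      then show ?thesis by (simp only: complex_cnj_zero_iff)
    qed
    \<comment> \<open>\<open>x\<close> is shown to be zero on \<open>?WJ\<close> by pairing it with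
      itself: moving the raising operators across turns them into lowerings of \<open>x\<close>, and
      these equal \<open>\<Theta>\<close> of lowerings of the raised sum of the \<open>Z u\<close>,
      which vanishes by \<open>raise0\<close>.\<close>
    define x where "x w = (\<Sum>u\<in>?WI. ?raise u (\<Theta> (Z u)) w)" for w
    have low0: "?low u' x w = 0" if "u' \<in> ?WI" "w \<in> ?WJ" for u' w
    proof -
      have "?low u' (?raise u (\<Theta> (Z u))) = \<Theta> (?low u' (?raise u (Z u)))" if "u \<in> ?WI" for u
        using commute_blocks[OF list_all2_lows[OF u[OF \<open>u' \<in> ?WI\<close>]] list_all2_lows_adj[OF u[OF that]]
          qs(1) qs' Zv] by (rule sym)
      then have "?low u' x w = (\<Sum>u\<in>?WI. \<Theta> (?low u' (?raise u (Z u))) w)"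
        unfolding x_def rops_sum by simp
      also have "\<dots> = \<Theta> (\<lambda>w. \<Sum>u\<in>?WI. ?low u' (?raise u (Z u)) w) w" by (simp add: \<Theta>_sum)
      also have "(\<lambda>w. \<Sum>u\<in>?WI. ?low u' (?raise u (Z u)) w) = ?low u' (\<lambda>w. \<Sum>u\<in>?WI. ?raise u (Z u) w)"
        by (simp add: rops_sum)
      also have "\<Theta> \<dots> w = 0"
        unfolding \<Theta>_def
      proof (intro sum.neutral ballI)
        fix w' assume w': "w' \<in> ?WJ"
        have "?low u' (\<lambda>w. \<Sum>u\<in>?WI. ?raise u (Z u) w) w' = ?low u' (\<lambda>w. 0) w'"
          using raise0 w' by (intro rops_words_cong[of ?J m])
        then show "cnj (T w' w) * ?low u' (\<lambda>w. \<Sum>u\<in>?WI. ?raise u (Z u) w) w' = 0"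
          by (simp add: rops_0)
      qed
      finally show ?thesis .
    qed
    have "(\<Sum>w\<in>?WJ. cnj (x w) * x w) = (\<Sum>u\<in>?WI. \<Sum>w\<in>?WJ. cnj (?raise u (\<Theta> (Z u)) w) * x w)"
      by (subst sum.swap) (simp add: x_def sum_distrib_right)
    also have "\<dots> = (\<Sum>u\<in>?WI. \<Sum>w\<in>?WJ. cnj (\<Theta> (Z u) w) * ?low u x w)"
      by (intro sum.cong refl rops_adjoint[symmetric]) simp
    also have "\<dots> = 0" using low0 by (simp add: sum.neutral)
    finally have x0: "x w = 0" if "w \<in> ?WJ" for w
      using sum_cnj_self_eq_0[of ?WJ x] that by simp
    have "map Ev qs \<in> ?WJ" using qs by (auto simp: words_def Idx_def)
    then have "0 = (\<Sum>u\<in>?WI. ?raise u (\<Theta> (Z u)) (map Ev qs))" using x0 by (simp add: x_def)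
    also have "\<dots> = (\<Sum>u\<in>?WI. \<Theta> (Z u) u)"
    proof (intro sum.cong refl)
      fix v assume v: "v \<in> ?WI"
      have "set v \<subseteq> ?J" using u(1)[OF v] IJ by blast
      then show "?raise v (\<Theta> (Z v)) (map Ev qs) = \<Theta> (Z v) v"
        using rops_raise_at[OF fin(2) _ u[OF v] qs(1) qs', of "[]"] by simp
    qed
    also have "\<dots> = cnj (\<Sum>u\<in>?WI. \<Sum>w\<in>?WJ. cnj (z (w, u)) * T w u)"
      unfolding \<Theta>_def cnj_sum complex_cnj_mult complex_cnj_cnj
    proof (intro sum.cong refl)
      fix w u
      show "cnj (T w u) * Z u w = z (w, u) * cnj (T w u)"
        using T_supp[of w u] by (cases "w \<in> ?WI") (auto simp: Z_def)
    qed
    finally have "cnj (\<Sum>u\<in>?WI. \<Sum>w\<in>?WJ. cnj (z (w, u)) * T w u) = 0" by (rule sym)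
    then have "(\<Sum>u\<in>?WI. \<Sum>w\<in>?WJ. cnj (z (w, u)) * T w u) = 0"
      by (simp only: complex_cnj_zero_iff)
    then show "(\<Sum>x\<in>?WJ \<times> ?WI. cnj (z x) * (case x of (w, u) \<Rightarrow> T w u)) = 0"
      by (simp add: sum.cartesian_product' sum.swap[of _ ?WI ?WJ])
  qed simp_all
  then show ?thesis by fastforce
qed

section \<open>The algebra of inner products\<close>

lemma var_supercomm_left:
  "var g * (var h * f) = scal (ksign (gpar g) (gpar h)) * (var h * (var g * f))"
  by (simp add: var_supercomm[of g h] flip: mult.assoc)

lemma var_scal_left: "var g * (scal c * f) = scal c * (var g * f)"
  by (rule mult_scal_left)

lemma homogI:
  assumes "\<And>g h. abs_salg (\<phi> g) * var h = scal (ksign (gpar g \<noteq> \<epsilon>) (gpar h)) * (var h * abs_salg (\<phi> g))"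
  shows "homog \<epsilon> \<phi>"
  unfolding homog_def abs_salg_eq_0_iff[symmetric]
  using assms by (simp add: abs_salg_diff abs_salg_mult abs_salg_tscal var.abs_eq)

lemma abs_glV_gen_X: "abs_salg (glV_gen n \<epsilon> A (X t j)) = (\<Sum>i\<in>Idx n. scal (A i j) * var (X t i))"
  by (simp only: glV_gen.simps abs_salg_sum finite_Idx abs_salg_term)

lemma abs_glV_gen_Xs:
  "abs_salg (glV_gen n \<epsilon> A (Xs i s)) = (\<Sum>j\<in>Idx n. scal (- ksign \<epsilon> (ipar i) * A i j) * var (Xs j s))"
  by (simp only: glV_gen.simps abs_salg_sum finite_Idx abs_salg_term)

lemma qop_hpart: "qop R C (\<epsilon>, A) \<Longrightarrow> hpart \<epsilon> A = A"
  by (auto simp: qop_def mhom_def hpart_def fun_eq_iff)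

lemma qop_homog: "qop R C (\<epsilon>, A) \<Longrightarrow> homog \<epsilon> (glV_gen n \<epsilon> A)"
  using homog_glV[of \<epsilon> n A] by (simp add: qop_hpart)

lemma qq_qop:
  assumes "A \<in> \<qq> n"
  shows "qop (Idx n) (Idx n) (\<epsilon>, hpart \<epsilon> A)"
proof -
  have A: "A i j \<noteq> 0 \<Longrightarrow> i \<in> Idx n \<and> j \<in> Idx n" for i j
    using assms by (auto simp: qq_iff gl_def)
  have "A (bar i) (bar j) = (if ipar i = ipar j then 1 else - 1) * A i j" for i j
  proof (cases "i \<in> Idx n \<and> j \<in> Idx n")
    case True
    then show ?thesis using assms unfolding qq_iff
      by (cases i; cases j) (auto simp: Idx_def)
  next
    case False
    then have "A i j = 0" "A (bar i) (bar j) = 0" using A[of i j] A[of "bar i" "bar j"] by auto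
    then show ?thesis by simp
  qed
  then show ?thesis using A by (auto simp: qop_def mhom_def hpart_def ksign_def)
qed

lemma qop_qq:
  assumes "qop (Idx n) (Idx n) (\<epsilon>, A)"
  shows "A \<in> \<qq> n"
  unfolding qq_iff
proof (intro conjI ballI)
  show "A \<in> gl (Idx n)" using assms by (auto simp: qop_def gl_def)
  fix i j
  have b: "A (bar a) (bar b) = ksign \<epsilon> True * A a b" for a b using assms by (auto simp: qop_def)
  have h: "A a b \<noteq> 0 \<Longrightarrow> (ipar a \<noteq> ipar b) = \<epsilon>" for a b using assms by (auto simp: qop_def mhom_def)
  show "A (Od i) (Od j) = A (Ev i) (Ev j)"
    using b[of "Ev i" "Ev j"] h[of "Ev i" "Ev j"] by (cases "A (Ev i) (Ev j) = 0") auto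
  show "A (Od i) (Ev j) = - A (Ev i) (Od j)"
    using b[of "Ev i" "Od j"] h[of "Ev i" "Od j"] by (cases "A (Ev i) (Od j) = 0") auto
qed

text \<open>The subalgebra generated by the inner products, built by left multiplication with one
  factor; each stability proof thus becomes a Leibniz computation for a single inner
  product.\<close>

inductive_set inner_alg :: "nat \<Rightarrow> nat \<Rightarrow> nat \<Rightarrow> salg set" for n k p where
  scal: "scal c \<in> inner_alg n k p"
| add: "f \<in> inner_alg n k p \<Longrightarrow> g \<in> inner_alg n k p \<Longrightarrow> f + g \<in> inner_alg n k p"
| even: "t \<in> {1..k} \<Longrightarrow> s \<in> {1..p} \<Longrightarrow> f \<in> inner_alg n k p \<Longrightarrow> inner_even n t s * f \<in> inner_alg n k p"
| odd: "t \<in> {1..k} \<Longrightarrow> s \<in> {1..p} \<Longrightarrow> f \<in> inner_alg n k p \<Longrightarrow> inner_odd n t s * f \<in> inner_alg n k p"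

lemma inner_alg_scal_left: "f \<in> inner_alg n k p \<Longrightarrow> scal c * f \<in> inner_alg n k p"
  by (induction rule: inner_alg.induct)
     (auto intro: inner_alg.intros simp: scal_mult distrib_left mult_scal_left[symmetric])

lemma inner_alg_0: "0 \<in> inner_alg n k p"
  using inner_alg.scal[of 0] by simp

lemma inner_alg_1: "1 \<in> inner_alg n k p"
  using inner_alg.scal[of 1] by simp

lemma inner_alg_sum: "(\<And>x. x \<in> A \<Longrightarrow> f x \<in> inner_alg n k p) \<Longrightarrow> sum f A \<in> inner_alg n k p"
  by (induction A rule: infinite_finite_induct) (auto intro: inner_alg_0 inner_alg.add)

lemma inner_alg_mult: "f \<in> inner_alg n k p \<Longrightarrow> g \<in> inner_alg n k p \<Longrightarrow> f * g \<in> inner_alg n k p"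
  by (induction rule: inner_alg.induct)
     (auto intro: inner_alg.intros inner_alg_scal_left simp: distrib_right mult.assoc)

lemma subalgebra_inner_alg: "subalgebra (inner_alg n k p)"
  by (auto simp: subalgebra_def intro: inner_alg.intros inner_alg_mult)

lemma inner_alg_subset:
  assumes "subalgebra B"
    and "\<And>t s. t \<in> {1..k} \<Longrightarrow> s \<in> {1..p} \<Longrightarrow> inner_even n t s \<in> B \<and> inner_odd n t s \<in> B"
  shows "inner_alg n k p \<subseteq> B"
proof
  fix f assume "f \<in> inner_alg n k p"
  then show "f \<in> B" by induction (use assms in \<open>auto simp: subalgebra_def\<close>)
qed

text \<open>The derivation produces one double sum from \<open>X\<close> and its negative from
  \<open>Xs\<close>, with the roles of the indices exchanged; the Koszul signs cancel because the
  paired letters have equal parity.\<close>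

lemma sder_inner_even_mult:
  assumes "qop (Idx n) (Idx n) (\<epsilon>, A)"
  shows "sder \<epsilon> (glV_gen n \<epsilon> A) (inner_even n t s * f) = inner_even n t s * sder \<epsilon> (glV_gen n \<epsilon> A) f"
proof -
  note h = qop_homog[OF assms, of n]
  let ?D = "sder \<epsilon> (glV_gen n \<epsilon> A)"
  let ?x = "\<lambda>i. var (X t i)" and ?y = "\<lambda>i. var (Xs i s)"
  have "?D (?x i * (?y i * f)) = (\<Sum>a\<in>Idx n. scal (A a i) * (?x a * (?y i * f)))
     - (\<Sum>j\<in>Idx n. scal (A i j) * (?x i * (?y j * f))) + ?x i * (?y i * ?D f)" for i
    by (simp add: sder_Leibniz[OF h] abs_salg_sum finite_Idx abs_salg_term sum_distrib_left sum_distrib_right right_diff_distrib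
        distrib_left mult.assoc var_scal_left scal_mult_left scal_uminus sum_negf)
  then have "(\<Sum>i\<in>Idx n. ?D (?x i * (?y i * f))) =
      (\<Sum>i\<in>Idx n. \<Sum>a\<in>Idx n. scal (A a i) * (?x a * (?y i * f)))
     - (\<Sum>i\<in>Idx n. \<Sum>j\<in>Idx n. scal (A i j) * (?x i * (?y j * f))) + (\<Sum>i\<in>Idx n. ?x i * (?y i * ?D f))"
    by (simp add: sum.distrib sum_subtractf)
  also have "(\<Sum>i\<in>Idx n. \<Sum>a\<in>Idx n. scal (A a i) * (?x a * (?y i * f))) =
     (\<Sum>i\<in>Idx n. \<Sum>j\<in>Idx n. scal (A i j) * (?x i * (?y j * f)))"
    by (rule sum.swap)
  finally show ?thesis
    by (simp add: inner_even_def sum_distrib_right sder_sum[OF h] mult.assoc)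
qed

text \<open>Here the two double sums agree only after reindexing by \<open>bar\<close> and using the
  \<open>bar\<close> symmetry of the matrix, which is how \<open>q n\<close> enters. The remaining
  sign is that of passing an odd factor.\<close>

lemma sder_inner_odd_mult:
  assumes "qop (Idx n) (Idx n) (\<epsilon>, A)"
  shows "sder \<epsilon> (glV_gen n \<epsilon> A) (inner_odd n t s * f) =
    scal (ksign \<epsilon> True) * (inner_odd n t s * sder \<epsilon> (glV_gen n \<epsilon> A) f)"
proof -
  note h = qop_homog[OF assms, of n]
  let ?D = "sder \<epsilon> (glV_gen n \<epsilon> A)"
  let ?x = "\<lambda>i. var (X t i)" and ?y = "\<lambda>i. var (Xs i s)"
  let ?k = "ksign \<epsilon> True"
  have k: "ksign \<epsilon> (\<not> b) = ?k * ksign \<epsilon> b" for b by (auto simp: ksign_def)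
  have "?D (?x (bar i) * (?y i * f)) = (\<Sum>a\<in>Idx n. scal (A a (bar i)) * (?x a * (?y i * f)))
     - (\<Sum>j\<in>Idx n. scal (?k * A i j) * (?x (bar i) * (?y j * f)))
     + scal ?k * (?x (bar i) * (?y i * ?D f))" for i
    by (simp add: sder_Leibniz[OF h] abs_salg_sum finite_Idx abs_salg_term sum_distrib_left sum_distrib_right right_diff_distrib
        distrib_left mult.assoc var_scal_left scal_mult_left scal_uminus sum_negf k)
  then have "(\<Sum>i\<in>Idx n. ?D (?x (bar i) * (?y i * f))) =
      (\<Sum>i\<in>Idx n. \<Sum>a\<in>Idx n. scal (A a (bar i)) * (?x a * (?y i * f)))
     - (\<Sum>i\<in>Idx n. \<Sum>j\<in>Idx n. scal (?k * A i j) * (?x (bar i) * (?y j * f)))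
     + (\<Sum>i\<in>Idx n. scal ?k * (?x (bar i) * (?y i * ?D f)))"
    by (simp add: sum.distrib sum_subtractf)
  also have "(\<Sum>i\<in>Idx n. \<Sum>j\<in>Idx n. scal (?k * A i j) * (?x (bar i) * (?y j * f))) =
      (\<Sum>i\<in>Idx n. \<Sum>j\<in>Idx n. scal (?k * A (bar i) j) * (?x i * (?y j * f)))"
    using sum_Idx_bar[of "\<lambda>i. \<Sum>j\<in>Idx n. scal (?k * A (bar i) j) * (?x i * (?y j * f))" n] by simp
  also have "\<dots> = (\<Sum>i\<in>Idx n. \<Sum>j\<in>Idx n. scal (A i (bar j)) * (?x i * (?y j * f)))"
  proof (intro sum.cong refl)
    fix i j
    have "A (bar i) (bar (bar j)) = ?k * A i (bar j)" using assms by (simp only: qop_def fst_conv snd_conv)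
    then show "scal (?k * A (bar i) j) * (?x i * (?y j * f)) = scal (A i (bar j)) * (?x i * (?y j * f))"
      by simp
  qed
  also have "\<dots> = (\<Sum>i\<in>Idx n. \<Sum>a\<in>Idx n. scal (A a (bar i)) * (?x a * (?y i * f)))"
    by (rule sum.swap)
  finally show ?thesis
    by (simp add: inner_odd_alt sum_distrib_right sum_distrib_left sder_sum[OF h] mult.assoc)
qed

lemma glV_inner_alg:
  assumes "A \<in> \<qq> n" "f \<in> inner_alg n k p"
  shows "glV n A f = 0"
proof -
  have "sder \<epsilon> (glV_gen n \<epsilon> (hpart \<epsilon> A)) f = 0" for \<epsilon>
  proof -
    note q = qq_qop[OF assms(1), of \<epsilon>]
    note h = qop_homog[OF q, of n]
    show ?thesis using assms(2)
      by induction
         (simp_all add: sder_scal[OF h] sder_add[OF h] sder_inner_even_mult[OF q] sder_inner_odd_mult[OF q])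
  qed
  moreover have h: "hpart e (hpart e A) = hpart e A" for e by (auto simp: hpart_def fun_eq_iff)
  ultimately show ?thesis
    by (subst glV_hpart) (simp add: glV_eq_sder[OF h])
qed

lemma glU_inner_even: "glU k A (inner_even n t s) = (\<Sum>r=1..k. scal (A r t) * inner_even n r s)"
proof -
  have "glU k A (inner_even n t s) = (\<Sum>i\<in>Idx n. \<Sum>r=1..k. scal (A r t) * (var (X r i) * var (Xs i s)))"
    by (simp add: glU_eq_sder inner_even_def sder_sum[OF homog_glU] sder_mult[OF homog_glU]
        sder_var[OF homog_glU] abs_salg_sum abs_salg_term sum_distrib_right mult.assoc
        zero_salg.abs_eq[symmetric])
  also have "\<dots> = (\<Sum>r=1..k. \<Sum>i\<in>Idx n. scal (A r t) * (var (X r i) * var (Xs i s)))"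
    by (rule sum.swap)
  finally show ?thesis by (simp add: inner_even_def sum_distrib_left)
qed

lemma glU_inner_odd: "glU k A (inner_odd n t s) = (\<Sum>r=1..k. scal (A r t) * inner_odd n r s)"
proof -
  have "glU k A (inner_odd n t s) = (\<Sum>i\<in>Idx n. \<Sum>r=1..k. scal (A r t) * (var (X r (bar i)) * var (Xs i s)))"
    by (simp add: glU_eq_sder inner_odd_alt sder_sum[OF homog_glU] sder_mult[OF homog_glU]
        sder_var[OF homog_glU] abs_salg_sum abs_salg_term sum_distrib_right mult.assoc
        zero_salg.abs_eq[symmetric])
  also have "\<dots> = (\<Sum>r=1..k. \<Sum>i\<in>Idx n. scal (A r t) * (var (X r (bar i)) * var (Xs i s)))"
    by (rule sum.swap)
  finally show ?thesis by (simp add: inner_odd_alt sum_distrib_left)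
qed

lemma glW_inner_even: "glW p A (inner_even n t s) = (\<Sum>r=1..p. scal (A r s) * inner_even n t r)"
proof -
  have "glW p A (inner_even n t s) = (\<Sum>i\<in>Idx n. \<Sum>r=1..p. scal (A r s) * (var (X t i) * var (Xs i r)))"
    by (simp add: glW_eq_sder inner_even_def sder_sum[OF homog_glW] sder_mult[OF homog_glW]
        sder_var[OF homog_glW] abs_salg_sum abs_salg_term sum_distrib_left var_scal_left
        zero_salg.abs_eq[symmetric])
  also have "\<dots> = (\<Sum>r=1..p. \<Sum>i\<in>Idx n. scal (A r s) * (var (X t i) * var (Xs i r)))"
    by (rule sum.swap)
  finally show ?thesis by (simp add: inner_even_def sum_distrib_left)
qed

lemma glW_inner_odd: "glW p A (inner_odd n t s) = (\<Sum>r=1..p. scal (A r s) * inner_odd n t r)"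
proof -
  have "glW p A (inner_odd n t s) = (\<Sum>i\<in>Idx n. \<Sum>r=1..p. scal (A r s) * (var (X t (bar i)) * var (Xs i r)))"
    by (simp add: glW_eq_sder inner_odd_alt sder_sum[OF homog_glW] sder_mult[OF homog_glW]
        sder_var[OF homog_glW] abs_salg_sum abs_salg_term sum_distrib_left var_scal_left
        zero_salg.abs_eq[symmetric])
  also have "\<dots> = (\<Sum>r=1..p. \<Sum>i\<in>Idx n. scal (A r s) * (var (X t (bar i)) * var (Xs i r)))"
    by (rule sum.swap)
  finally show ?thesis by (simp add: inner_odd_alt sum_distrib_left)
qed

lemma glU_inner_alg: "f \<in> inner_alg n k p \<Longrightarrow> glU k A f \<in> inner_alg n k p"
proof (induction rule: inner_alg.induct)
  case (scal c)
  then show ?case by (simp add: glU_eq_sder sder_scal[OF homog_glU] inner_alg_0)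
next
  case (add f g)
  then show ?case by (simp add: glU_eq_sder sder_add[OF homog_glU] inner_alg.add)
next
  case (even t s f)
  have "glU k A (inner_even n t s * f) = glU k A (inner_even n t s) * f + inner_even n t s * glU k A f"
    by (simp add: glU_eq_sder sder_mult[OF homog_glU])
  then show ?case using even
    by (auto simp: glU_inner_even sum_distrib_right mult.assoc
        intro!: inner_alg.add inner_alg_sum inner_alg_scal_left inner_alg.even)
next
  case (odd t s f)
  have "glU k A (inner_odd n t s * f) = glU k A (inner_odd n t s) * f + inner_odd n t s * glU k A f"
    by (simp add: glU_eq_sder sder_mult[OF homog_glU])
  then show ?case using odd
    by (auto simp: glU_inner_odd sum_distrib_right mult.assoc
        intro!: inner_alg.add inner_alg_sum inner_alg_scal_left inner_alg.odd)
qed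

lemma glW_inner_alg: "f \<in> inner_alg n k p \<Longrightarrow> glW p A f \<in> inner_alg n k p"
proof (induction rule: inner_alg.induct)
  case (scal c)
  then show ?case by (simp add: glW_eq_sder sder_scal[OF homog_glW] inner_alg_0)
next
  case (add f g)
  then show ?case by (simp add: glW_eq_sder sder_add[OF homog_glW] inner_alg.add)
next
  case (even t s f)
  have "glW p A (inner_even n t s * f) = glW p A (inner_even n t s) * f + inner_even n t s * glW p A f"
    by (simp add: glW_eq_sder sder_mult[OF homog_glW])
  then show ?case using even
    by (auto simp: glW_inner_even sum_distrib_right mult.assoc
        intro!: inner_alg.add inner_alg_sum inner_alg_scal_left inner_alg.even)
next
  case (odd t s f)
  have "glW p A (inner_odd n t s * f) = glW p A (inner_odd n t s) * f + inner_odd n t s * glW p A f"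
    by (simp add: glW_eq_sder sder_mult[OF homog_glW])
  then show ?case using odd
    by (auto simp: glW_inner_odd sum_distrib_right mult.assoc
        intro!: inner_alg.add inner_alg_sum inner_alg_scal_left inner_alg.odd)
qed

lemma polarization_inner_alg:
  assumes "D \<in> polarizations k p" "f \<in> inner_alg n k p"
  shows "D f \<in> inner_alg n k p"
  using assms
  by (induction arbitrary: f rule: polarizations.induct)
     (auto intro: glU_inner_alg glW_inner_alg inner_alg_scal_left inner_alg.add)

lemma subalgebra_\<AA>: "subalgebra (\<AA> n k p)"
  unfolding \<AA>_def subalgebra_def by blast

lemma var_in_\<AA>: "g \<in> gens n k p \<Longrightarrow> var g \<in> \<AA> n k p"
  unfolding \<AA>_def by blast

lemma subalgebra_sum: "subalgebra B \<Longrightarrow> (\<And>x. x \<in> S \<Longrightarrow> f x \<in> B) \<Longrightarrow> sum f S \<in> B"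
proof (induction S rule: infinite_finite_induct)
  case (infinite S)
  then show ?case using scal_0 by (metis subalgebra_def sum.infinite)
next
  case empty
  then show ?case using scal_0 by (metis subalgebra_def sum.empty)
next
  case (insert x S)
  then show ?case by (simp add: subalgebra_def)
qed

lemma inner_alg_subset_\<AA>: "inner_alg n k p \<subseteq> \<AA> n k p"
proof (rule inner_alg_subset[OF subalgebra_\<AA>], intro conjI)
  fix t s assume ts: "t \<in> {1..k}" "s \<in> {1..p}"
  have "var (X t i) * var (Xs j s) \<in> \<AA> n k p" if "i \<in> Idx n" "j \<in> Idx n" for i j
    using subalgebra_\<AA>[of n k p] var_in_\<AA>[of "X t i" n k p] var_in_\<AA>[of "Xs j s" n k p] ts that
    by (auto simp: subalgebra_def gens_def)
  then show "inner_even n t s \<in> \<AA> n k p" "inner_odd n t s \<in> \<AA> n k p"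
    by (auto simp: inner_even_def inner_odd_alt intro!: subalgebra_sum[OF subalgebra_\<AA>])
qed

lemma inner_alg_subset_invariants: "inner_alg n k p \<subseteq> invariants n k p (\<qq> n)"
  using inner_alg_subset_\<AA> glV_inner_alg by (auto simp: invariants_def)

text \<open>Each operator of \<open>gl(U)\<close> or \<open>gl(W)\<close> sends an inner product to
  a linear combination of inner products of the same kind, so by Leibniz the generated subalgebra is
  already stable.\<close>

lemma polarization_closure_inner:
  "polarization_closure k p
    ({inner_even n t s | t s. t \<in> {1..k} \<and> s \<in> {1..p}} \<union>
     {inner_odd n t s | t s. t \<in> {1..k} \<and> s \<in> {1..p}}) = inner_alg n k p"
    (is "polarization_closure k p ?M = _")
proof
  have "?M \<subseteq> inner_alg n k p"
    using inner_alg.even[OF _ _ inner_alg_1] inner_alg.odd[OF _ _ inner_alg_1] by fastforce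
  then show "polarization_closure k p ?M \<subseteq> inner_alg n k p"
    unfolding polarization_closure_def
    using subalgebra_inner_alg polarization_inner_alg by (intro Inter_lower) auto
  show "inner_alg n k p \<subseteq> polarization_closure k p ?M"
    unfolding polarization_closure_def by (intro Inter_greatest inner_alg_subset) auto
qed

section \<open>Taylor expansion\<close>

lift_definition ev0 :: "salg \<Rightarrow> complex" is "\<lambda>F. Poly_Mapping.lookup F []"
proof -
  fix F G assume "srel F G"
  then have "Poly_Mapping.lookup (F - G) [] = 0" unfolding srel_def by (rule sideal_lookup_Nil)
  then show "Poly_Mapping.lookup F [] = Poly_Mapping.lookup G []" by (simp add: lookup_minus)
qed

lemma ev0_add [simp]: "ev0 (f + g) = ev0 f + ev0 g"
  by (transfer, simp add: lookup_add)

lemma ev0_mult [simp]: "ev0 (f * g) = ev0 f * ev0 g"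
  by (transfer, simp add: lookup_Nil_mult)

lemma ev0_scal [simp]: "ev0 (scal c) = c"
  by (transfer, simp add: tscal_def)

lemma ev0_var [simp]: "ev0 (var g) = 0"
  by (transfer, simp add: tword_def lookup_single)

lemma ev0_0 [simp]: "ev0 0 = 0"
  using ev0_scal[of 0] by simp

lemma ev0_sum: "ev0 (\<Sum>x\<in>S. f x) = (\<Sum>x\<in>S. ev0 (f x))"
  by (induction S rule: infinite_finite_induct) simp_all

section \<open>Partial derivatives, bidegrees and Euler identities\<close>

definition pd_gen :: "gen \<Rightarrow> gen \<Rightarrow> tens" where
  "pd_gen g h = (if h = g then 1 else 0)"

definition pd :: "gen \<Rightarrow> salg \<Rightarrow> salg" where
  "pd g = sder (gpar g) (pd_gen g)"

lemma abs_salg_1: "abs_salg 1 = 1"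
  by (simp add: one_salg.abs_eq)

lemma abs_salg_0: "abs_salg 0 = 0"
  by (simp add: zero_salg.abs_eq)

lemma homog_pd: "homog (gpar g) (pd_gen g)"
  by (rule homogI) (simp add: pd_gen_def abs_salg_1 abs_salg_0)

lemma pd_add: "pd g (f + h) = pd g f + pd g h"
  unfolding pd_def by (rule sder_add[OF homog_pd])

lemma pd_scal_left: "pd g (scal c * f) = scal c * pd g f"
  unfolding pd_def by (rule sder_scal_left[OF homog_pd])

lemma pd_scal [simp]: "pd g (scal c) = 0"
  unfolding pd_def by (rule sder_scal[OF homog_pd])

lemma pd_0 [simp]: "pd g 0 = 0"
  unfolding pd_def by (rule sder_0[OF homog_pd])

lemma pd_sum: "pd g (\<Sum>x\<in>S. f x) = (\<Sum>x\<in>S. pd g (f x))"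
  unfolding pd_def by (rule sder_sum[OF homog_pd])

lemma pd_var_mult: "pd g (var h * f) =
    (if h = g then f else 0) + scal (ksign (gpar g) (gpar h)) * (var h * pd g f)"
  unfolding pd_def by (simp add: sder_Leibniz[OF homog_pd] pd_gen_def abs_salg_1 abs_salg_0)

text \<open>Bidegree in the letters of V and of its dual, given by construction rules. No uniqueness
  of degrees is claimed, so nothing about bases of the quotient has to be known.\<close>

inductive bihom :: "nat \<Rightarrow> nat \<Rightarrow> nat \<Rightarrow> nat \<Rightarrow> nat \<Rightarrow> salg \<Rightarrow> bool" for n k p where
  scal: "bihom n k p 0 0 (scal c)"
| zero: "bihom n k p a b 0"
| add: "bihom n k p a b f \<Longrightarrow> bihom n k p a b g \<Longrightarrow> bihom n k p a b (f + g)"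
| varX: "bihom n k p a b f \<Longrightarrow> t \<in> {1..k} \<Longrightarrow> i \<in> Idx n \<Longrightarrow> bihom n k p (Suc a) b (var (X t i) * f)"
| varXs: "bihom n k p a b f \<Longrightarrow> i \<in> Idx n \<Longrightarrow> s \<in> {1..p} \<Longrightarrow> bihom n k p a (Suc b) (var (Xs i s) * f)"

lemma bihom_scal_left: "bihom n k p a b f \<Longrightarrow> bihom n k p a b (scal c * f)"
  by (induction rule: bihom.induct)
     (auto simp: scal_mult distrib_left simp flip: var_scal_left intro: bihom.intros)

lemma bihom_mult:
  "bihom n k p a b f \<Longrightarrow> bihom n k p a' b' g \<Longrightarrow> bihom n k p (a + a') (b + b') (f * g)"
  by (induction rule: bihom.induct)
     (auto simp: distrib_right mult.assoc intro: bihom.intros bihom_scal_left)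

lemma bihom_pd_X:
  assumes "bihom n k p a b f"
  shows "(case a of 0 \<Rightarrow> pd (X t i) f = 0 | Suc a' \<Rightarrow> bihom n k p a' b (pd (X t i) f))"
  using assms
proof (induction rule: bihom.induct)
  case (varX a b f t i)
  then show ?case
    by (cases a) (auto simp: pd_var_mult intro!: bihom.intros(2-) bihom_scal_left)
next
  case (varXs a b f i s)
  then show ?case
    by (cases a) (auto simp: pd_var_mult intro!: bihom.intros(2-) bihom_scal_left)
qed (auto simp: pd_add split: nat.splits intro: bihom.intros)

lemma bihom_pd_Xs:
  assumes "bihom n k p a b f"
  shows "(case b of 0 \<Rightarrow> pd (Xs i s) f = 0 | Suc b' \<Rightarrow> bihom n k p a b' (pd (Xs i s) f))"
  using assms
proof (induction rule: bihom.induct)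
  case (varX a b f t i)
  then show ?case
    by (cases b) (auto simp: pd_var_mult intro!: bihom.intros(2-) bihom_scal_left)
next
  case (varXs a b f i s)
  then show ?case
    by (cases b) (auto simp: pd_var_mult intro!: bihom.intros(2-) bihom_scal_left)
qed (auto simp: pd_add split: nat.splits intro: bihom.intros)

lemma sum_sum_delta:
  assumes "finite S" "finite S'" "x0 \<in> S" "y0 \<in> S'"
  shows "(\<Sum>x\<in>S. \<Sum>y\<in>S'. if x0 = x \<and> y0 = y then f x y else 0) = f x0 y0"
proof -
  have "(\<Sum>x\<in>S. \<Sum>y\<in>S'. if x0 = x \<and> y0 = y then f x y else 0) =
    (\<Sum>x\<in>S. if x0 = x then f x y0 else 0)"
    by (intro sum.cong refl) (use assms in \<open>auto simp: sum.delta'\<close>)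
  then show ?thesis using assms by (simp add: sum.delta')
qed

text \<open>The two Koszul signs from passing \<open>h\<close> cancel, so
  \<open>var g * pd g\<close> is an even derivation that counts the letter \<open>g\<close>.\<close>

lemma Euler_term:
  "var g * pd g (var h * f) = (if h = g then var h * f else 0) + var h * (var g * pd g f)"
  by (auto simp: pd_var_mult distrib_left var_scal_left var_supercomm_left[of g h] scal_mult_left)

lemma Euler_X:
  "bihom n k p a b f \<Longrightarrow>
    (\<Sum>t\<in>{1..k}. \<Sum>i\<in>Idx n. var (X t i) * pd (X t i) f) = scal (of_nat a) * f"
proof (induction rule: bihom.induct)
  case (add a b f g)
  then show ?case by (simp add: pd_add distrib_left sum.distrib)
next
  case (varX a b f t i)
  have "(\<Sum>t'\<in>{1..k}. \<Sum>i'\<in>Idx n. if t = t' \<and> i = i' then var (X t i) * f else 0) = var (X t i) * f"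
    using varX.hyps finite_Idx by (intro sum_sum_delta) auto
  moreover have "(\<Sum>t'\<in>{1..k}. \<Sum>i'\<in>Idx n. var (X t i) * (var (X t' i') * pd (X t' i') f)) =
     var (X t i) * (scal (of_nat a) * f)"
    by (simp only: varX.IH[symmetric] sum_distrib_left)
  ultimately show ?case
    by (simp add: Euler_term sum.distrib var_scal_left scal_add distrib_right)
next
  case (varXs a b f i s)
  have "(\<Sum>t'\<in>{1..k}. \<Sum>i'\<in>Idx n. var (Xs i s) * (var (X t' i') * pd (X t' i') f)) =
     var (Xs i s) * (scal (of_nat a) * f)"
    by (simp only: varXs.IH[symmetric] sum_distrib_left)
  then show ?case by (simp add: Euler_term var_scal_left)
qed simp_all

lemma Euler_Xs:
  "bihom n k p a b f \<Longrightarrow>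
    (\<Sum>s\<in>{1..p}. \<Sum>i\<in>Idx n. var (Xs i s) * pd (Xs i s) f) = scal (of_nat b) * f"
proof (induction rule: bihom.induct)
  case (add a b f g)
  then show ?case by (simp add: pd_add distrib_left sum.distrib)
next
  case (varXs a b f i s)
  have "(\<Sum>s'\<in>{1..p}. \<Sum>i'\<in>Idx n. if s = s' \<and> i = i' then var (Xs i s) * f else 0) = var (Xs i s) * f"
    using varXs.hyps finite_Idx by (intro sum_sum_delta) auto
  moreover have "(\<Sum>s'\<in>{1..p}. \<Sum>i'\<in>Idx n. var (Xs i s) * (var (Xs i' s') * pd (Xs i' s') f)) =
     var (Xs i s) * (scal (of_nat b) * f)"
    by (simp only: varXs.IH[symmetric] sum_distrib_left)
  ultimately show ?case
    by (simp add: Euler_term sum.distrib var_scal_left scal_add distrib_right conj_commute)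
next
  case (varX a b f t i)
  have "(\<Sum>s'\<in>{1..p}. \<Sum>i'\<in>Idx n. var (X t i) * (var (Xs i' s') * pd (Xs i' s') f)) =
     var (X t i) * (scal (of_nat b) * f)"
    by (simp only: varX.IH[symmetric] sum_distrib_left)
  then show ?case by (simp add: Euler_term var_scal_left)
qed simp_all

text \<open>Iterated Euler operators with all variables moved to the left of all derivatives; what
  remains at the right is a number, the constant term of an iterated derivative.\<close>

primrec taylorS :: "nat \<Rightarrow> nat \<Rightarrow> nat \<Rightarrow> salg \<Rightarrow> salg" where
  "taylorS n p 0 f = scal (ev0 f)"
| "taylorS n p (Suc b) f = (\<Sum>s\<in>{1..p}. \<Sum>i\<in>Idx n. var (Xs i s) * taylorS n p b (pd (Xs i s) f))"

primrec taylor :: "nat \<Rightarrow> nat \<Rightarrow> nat \<Rightarrow> nat \<Rightarrow> nat \<Rightarrow> salg \<Rightarrow> salg" where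
  "taylor n k p 0 b f = taylorS n p b f"
| "taylor n k p (Suc a) b f = (\<Sum>t\<in>{1..k}. \<Sum>i\<in>Idx n. var (X t i) * taylor n k p a b (pd (X t i) f))"

lemma taylorS_add: "taylorS n p b (f + g) = taylorS n p b f + taylorS n p b g"
  by (induction b arbitrary: f g) (simp_all add: scal_add pd_add distrib_left sum.distrib)

lemma taylor_add: "taylor n k p a b (f + g) = taylor n k p a b f + taylor n k p a b g"
  by (induction a arbitrary: f g) (simp_all add: taylorS_add pd_add distrib_left sum.distrib)

lemma taylorS_0 [simp]: "taylorS n p b 0 = 0"
  by (induction b) simp_all

lemma taylor_0 [simp]: "taylor n k p a b 0 = 0"
  by (induction a) simp_all

lemma ev0_bihom:
  "bihom n k p a b f \<Longrightarrow> scal (ev0 f) = (if a = 0 \<and> b = 0 then f else 0)"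
  by (induction rule: bihom.induct) (simp_all add: scal_add)

lemma taylorS_bihom:
  assumes "bihom n k p a' b' f"
  shows "taylorS n p b f = (if a' = 0 \<and> b = b' then scal (fact b) * f else 0)"
  using assms
proof (induction b arbitrary: b' f)
  case 0
  then show ?case using ev0_bihom by auto
next
  case (Suc b)
  show ?case
  proof (cases b')
    case 0
    then show ?thesis using bihom_pd_Xs[OF Suc.prems] by simp
  next
    case [simp]: (Suc b'')
    have "bihom n k p a' b'' (pd (Xs i s) f)" for i s using bihom_pd_Xs[OF Suc.prems, of i s] by simp
    note Suc.IH[OF this]
    then have "taylorS n p (Suc b) f = (if a' = 0 \<and> b = b'' then
        scal (fact b) * (\<Sum>s\<in>{1..p}. \<Sum>i\<in>Idx n. var (Xs i s) * pd (Xs i s) f) else 0)"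
      by (simp add: var_scal_left sum_distrib_left)
    also have "\<dots> = (if a' = 0 \<and> Suc b = b' then scal (fact (Suc b)) * f else 0)"
      unfolding Euler_Xs[OF Suc.prems] by (simp add: scal_mult_left algebra_simps)
    finally show ?thesis .
  qed
qed

text \<open>Successive Euler identities contribute the degrees a, a - 1, ..., 1, hence the
  factorials; in a wrong bidegree a derivative or the constant term is zero.\<close>

lemma taylor_bihom:
  assumes "bihom n k p a' b' f"
  shows "taylor n k p a b f = (if a = a' \<and> b = b' then scal (fact a * fact b) * f else 0)"
  using assms
proof (induction a arbitrary: a' f)
  case 0
  then show ?case by (auto simp: taylorS_bihom)
next
  case (Suc a)
  show ?case
  proof (cases a')
    case 0
    then show ?thesis using bihom_pd_X[OF Suc.prems] by simp
  next
    case [simp]: (Suc a'')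
    have "bihom n k p a'' b' (pd (X t i) f)" for i t using bihom_pd_X[OF Suc.prems, of t i] by simp
    note IH = Suc.IH[OF this]
    have "taylor n k p (Suc a) b f = (if a = a'' \<and> b = b' then
        scal (fact a * fact b) * (\<Sum>t\<in>{1..k}. \<Sum>i\<in>Idx n. var (X t i) * pd (X t i) f) else 0)"
    proof (cases "a = a'' \<and> b = b'")
      case True
      show ?thesis unfolding taylor.simps IH if_P[OF True] by (simp add: var_scal_left sum_distrib_left)
    next
      case False
      show ?thesis unfolding taylor.simps IH if_not_P[OF False] by simp
    qed
    also have "\<dots> = (if Suc a = a' \<and> b = b' then scal (fact (Suc a) * fact b) * f else 0)"
      unfolding Euler_X[OF Suc.prems] by (simp add: scal_mult_left algebra_simps)
    finally show ?thesis .
  qed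
qed

inductive_set bihom_sums :: "nat \<Rightarrow> nat \<Rightarrow> nat \<Rightarrow> salg set" for n k p where
  base: "bihom n k p a b f \<Longrightarrow> f \<in> bihom_sums n k p"
| add: "f \<in> bihom_sums n k p \<Longrightarrow> g \<in> bihom_sums n k p \<Longrightarrow> f + g \<in> bihom_sums n k p"

lemma subalgebra_bihom_sums: "subalgebra (bihom_sums n k p)"
  unfolding subalgebra_def
proof (intro conjI allI ballI)
  fix f g assume f: "f \<in> bihom_sums n k p" and g: "g \<in> bihom_sums n k p"
  have base: "h * g \<in> bihom_sums n k p" if "bihom n k p a b h" for h a b
    using g
    by induction (auto intro: bihom_sums.intros bihom_mult[OF that] simp: distrib_left)
  show "f * g \<in> bihom_sums n k p"
    using f by induction (auto intro: base bihom_sums.add simp: distrib_right)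
qed (auto intro: bihom_sums.intros bihom.scal)

lemma \<AA>_subset_bihom_sums: "\<AA> n k p \<subseteq> bihom_sums n k p"
proof -
  have "var g \<in> bihom_sums n k p" if "g \<in> gens n k p" for g
  proof -
    have "bihom n k p 0 0 1" using bihom.scal[of n k p 1] by simp
    from bihom.varX[OF this] bihom.varXs[OF this] that
    have "\<exists>a b. bihom n k p a b (var g)" unfolding mult_1_right by (fastforce simp: gens_def)
    then show ?thesis by (blast intro: bihom_sums.base)
  qed
  then show ?thesis unfolding \<AA>_def using subalgebra_bihom_sums by (intro Inter_lower) auto
qed

lemma taylor_expansion:
  assumes "f \<in> \<AA> n k p"
  shows "\<exists>d. f = (\<Sum>a<d. \<Sum>b<d. scal (1 / (fact a * fact b)) * taylor n k p a b f)"
proof -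
  let ?S = "\<lambda>d f. \<Sum>a<d. \<Sum>b<d. scal (1 / (fact a * fact b)) * taylor n k p a b f"
  have "f \<in> bihom_sums n k p" using assms \<AA>_subset_bihom_sums by blast
  \<comment> \<open>All large bounds are claimed, so that two summands can use a common one.\<close>
  then have "\<exists>d0. \<forall>d\<ge>d0. f = ?S d f"
  proof induction
    case (base a b f)
    have "f = ?S d f" if "d \<ge> Suc (max a b)" for d
    proof -
      have "?S d f = (\<Sum>a'<d. \<Sum>b'<d. if a = a' \<and> b = b' then f else 0)"
        by (intro sum.cong refl) (auto simp: taylor_bihom[OF base] scal_mult_left)
      also have "\<dots> = f" using that by (intro sum_sum_delta) auto
      finally show ?thesis by simp
    qed
    then show ?case by blast
  next
    case (add f g)
    then obtain d1 d2 where d: "\<forall>d\<ge>d1. f = ?S d f" "\<forall>d\<ge>d2. g = ?S d g" by blast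
    have "f + g = ?S d (f + g)" if "d \<ge> max d1 d2" for d
    proof -
      have "?S d (f + g) = ?S d f + ?S d g" by (simp add: taylor_add distrib_left sum.distrib)
      then show ?thesis using d that by simp
    qed
    then show ?case by blast
  qed
  then show ?thesis by blast
qed

section \<open>Coefficient tensors and the action on them\<close>

primrec coef :: "gen list \<Rightarrow> salg \<Rightarrow> complex" where
  "coef [] f = ev0 f"
| "coef (g # v) f = coef v (pd g f)"

lemma coef_add: "coef v (f + g) = coef v f + coef v g"
  by (induction v arbitrary: f g) (simp_all add: pd_add)

lemma coef_scal_left: "coef v (scal c * f) = c * coef v f"
  by (induction v arbitrary: f) (simp_all add: pd_scal_left)

lemma coef_0 [simp]: "coef v 0 = 0"
  by (induction v) simp_all

lemma coef_sum: "coef v (\<Sum>x\<in>S. f x) = (\<Sum>x\<in>S. coef v (f x))"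
  by (induction S rule: infinite_finite_induct) (simp_all add: coef_add)

definition xword :: "nat list \<Rightarrow> idx list \<Rightarrow> gen list" where
  "xword ts w = map (\<lambda>(t, i). X t i) (zip ts w)"

definition xsword :: "idx list \<Rightarrow> nat list \<Rightarrow> gen list" where
  "xsword u ss = map (\<lambda>(i, s). Xs i s) (zip u ss)"

lemma xword_simps [simp]: "xword [] w = []" "xword (t # ts) (i # w) = X t i # xword ts w"
  by (simp_all add: xword_def)

lemma xsword_simps [simp]: "xsword u [] = []" "xsword (i # u) (s # ss) = Xs i s # xsword u ss"
  by (simp_all add: xsword_def)

primrec con2 :: "idx set \<Rightarrow> nat list \<Rightarrow> (idx list \<Rightarrow> complex) \<Rightarrow> salg" where
  "con2 I [] F = scal (F [])"
| "con2 I (s # ss) F = (\<Sum>i\<in>I. var (Xs i s) * con2 I ss (\<lambda>u. F (i # u)))"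

primrec con1 :: "idx set \<Rightarrow> nat list \<Rightarrow> nat list \<Rightarrow> (idx list \<Rightarrow> idx list \<Rightarrow> complex) \<Rightarrow> salg" where
  "con1 I [] ss F = con2 I ss (F [])"
| "con1 I (t # ts) ss F = (\<Sum>i\<in>I. var (X t i) * con1 I ts ss (\<lambda>w. F (i # w)))"

lemma taylorS_con2:
  "taylorS n p b f = (\<Sum>ss\<in>words {1..p} b. con2 (Idx n) ss (\<lambda>u. coef (xsword u ss) f))"
proof (induction b arbitrary: f)
  case (Suc b)
  have "taylorS n p (Suc b) f = (\<Sum>s\<in>{1..p}. \<Sum>i\<in>Idx n. \<Sum>ss\<in>words {1..p} b.
      var (Xs i s) * con2 (Idx n) ss (\<lambda>u. coef (xsword u ss) (pd (Xs i s) f)))"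
    by (simp add: Suc.IH sum_distrib_left)
  also have "\<dots> = (\<Sum>s\<in>{1..p}. \<Sum>ss\<in>words {1..p} b. \<Sum>i\<in>Idx n.
      var (Xs i s) * con2 (Idx n) ss (\<lambda>u. coef (xsword u ss) (pd (Xs i s) f)))"
    by (intro sum.cong refl sum.swap)
  finally show ?case by (simp add: sum_words_Suc)
qed simp

lemma taylor_con1:
  "taylor n k p a b f = (\<Sum>ts\<in>words {1..k} a. \<Sum>ss\<in>words {1..p} b.
    con1 (Idx n) ts ss (\<lambda>w u. coef (xword ts w @ xsword u ss) f))"
proof (induction a arbitrary: f)
  case 0
  then show ?case by (simp add: taylorS_con2)
next
  case (Suc a)
  let ?c = "\<lambda>t ts i ss. var (X t i) * con1 (Idx n) ts ss (\<lambda>w u. coef (xword ts w @ xsword u ss) (pd (X t i) f))"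
  have "taylor n k p (Suc a) b f =
      (\<Sum>t\<in>{1..k}. \<Sum>i\<in>Idx n. \<Sum>ts\<in>words {1..k} a. \<Sum>ss\<in>words {1..p} b. ?c t ts i ss)"
    by (simp add: Suc.IH sum_distrib_left)
  also have "\<dots> = (\<Sum>t\<in>{1..k}. \<Sum>ts\<in>words {1..k} a. \<Sum>i\<in>Idx n. \<Sum>ss\<in>words {1..p} b. ?c t ts i ss)"
    by (intro sum.cong refl sum.swap)
  also have "\<dots> = (\<Sum>t\<in>{1..k}. \<Sum>ts\<in>words {1..k} a. \<Sum>ss\<in>words {1..p} b. \<Sum>i\<in>Idx n. ?c t ts i ss)"
    by (intro sum.cong refl sum.swap)
  finally show ?case by (simp add: sum_words_Suc)
qed

lemma pd_linear_mult:
  assumes "\<And>z. z \<in> Z \<Longrightarrow> c z \<noteq> 0 \<Longrightarrow> gpar (y z) = e"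
  shows "pd g ((\<Sum>z\<in>Z. scal (c z) * var (y z)) * f) = pd g (\<Sum>z\<in>Z. scal (c z) * var (y z)) * f
    + scal (ksign (gpar g) e) * ((\<Sum>z\<in>Z. scal (c z) * var (y z)) * pd g f)"
proof -
  have 1: "pd g (var h) = (if h = g then 1 else 0)" for h
    using pd_var_mult[of g h 1] pd_scal[of g 1] by simp
  have "pd g (scal (c z) * (var (y z) * f)) = pd g (scal (c z) * var (y z)) * f
     + scal (ksign (gpar g) e) * (scal (c z) * (var (y z) * pd g f))" if "z \<in> Z" for z
    using assms[OF that]
    by (cases "c z = 0") (auto simp: pd_scal_left pd_var_mult distrib_left scal_mult_left mult.commute 1)
  then show ?thesis
    by (simp add: sum_distrib_left sum_distrib_right mult.assoc pd_sum sum.distrib)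
qed

text \<open>The action is a vector field with linear coefficients, so its supercommutator with
  \<open>pd g\<close> has constant ones. On \<open>H\<close>, \<open>c h\<close> is the coefficient
  of \<open>g\<close> in the image of \<open>h\<close>; outside \<open>H\<close> that coefficient is
  zero.\<close>

lemma pd_glV:
  assumes A: "qop (Idx n) (Idx n) (\<epsilon>, A)"
    and c: "\<And>h. pd g (abs_salg (glV_gen n \<epsilon> A h)) = scal (if h \<in> H then c h else 0)"
    and par: "\<And>h. c h \<noteq> 0 \<Longrightarrow> gpar h = (gpar g \<noteq> \<epsilon>)" and "finite H"
  shows "pd g (sder \<epsilon> (glV_gen n \<epsilon> A) f) =
    scal (ksign \<epsilon> (gpar g)) * sder \<epsilon> (glV_gen n \<epsilon> A) (pd g f) + (\<Sum>h\<in>H. scal (c h) * pd h f)"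
proof -
  note hom = qop_homog[OF A, of n]
  let ?D = "sder \<epsilon> (glV_gen n \<epsilon> A)"
  have lin: "pd g (abs_salg (glV_gen n \<epsilon> A h) * f) = pd g (abs_salg (glV_gen n \<epsilon> A h)) * f
     + scal (ksign (gpar g) (gpar h \<noteq> \<epsilon>)) * (abs_salg (glV_gen n \<epsilon> A h) * pd g f)" for h f
  proof (cases h)
    case (X t i)
    show ?thesis unfolding X abs_glV_gen_X
      by (rule pd_linear_mult) (use A in \<open>auto simp: qop_def mhom_def\<close>)
  next
    case (Xs i s)
    show ?thesis unfolding Xs abs_glV_gen_Xs
      by (rule pd_linear_mult) (use A in \<open>auto simp: qop_def mhom_def\<close>)
  qed
  show ?thesis
  proof (induction f rule: salg_induct)
    case (add f h)
    then show ?case by (simp add: sder_add[OF hom] pd_add distrib_left sum.distrib)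
  next
    case (scal d)
    then show ?case by (simp add: sder_scal[OF hom] sder_0[OF hom])
  next
    case (var h f)
    have "(\<Sum>h'\<in>H. scal (c h') * pd h' (var h * f)) =
      (\<Sum>h'\<in>H. if h' = h then scal (c h) * f else 0) +
      (\<Sum>h'\<in>H. scal (ksign (gpar g \<noteq> \<epsilon>) (gpar h)) * (var h * (scal (c h') * pd h' f)))"
      unfolding sum.distrib[symmetric]
    proof (intro sum.cong refl)
      fix h'
      show "scal (c h') * pd h' (var h * f) = (if h' = h then scal (c h) * f else 0) +
         scal (ksign (gpar g \<noteq> \<epsilon>) (gpar h)) * (var h * (scal (c h') * pd h' f))"
        using par[of h'] by (cases "c h' = 0")
          (auto simp: pd_var_mult distrib_left scal_mult_left var_scal_left mult.commute)
    qed
    also have "(\<Sum>h'\<in>H. if h' = h then scal (c h) * f else 0) = scal (if h \<in> H then c h else 0) * f"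
      using \<open>finite H\<close> by simp
    finally have S: "(\<Sum>h'\<in>H. scal (c h') * pd h' (var h * f)) = scal (if h \<in> H then c h else 0) * f +
        scal (ksign (gpar g \<noteq> \<epsilon>) (gpar h)) * (var h * (\<Sum>h'\<in>H. scal (c h') * pd h' f))"
      by (simp only: sum_distrib_left)
    have "pd g (?D (var h * f)) = scal (if h \<in> H then c h else 0) * f
       + scal (ksign (gpar g) (gpar h \<noteq> \<epsilon>)) * (abs_salg (glV_gen n \<epsilon> A h) * pd g f)
       + scal (ksign \<epsilon> (gpar h)) * ((if h = g then ?D f else 0)
           + scal (ksign (gpar g) (gpar h)) * (var h * pd g (?D f)))"
      unfolding sder_Leibniz[OF hom] pd_add pd_scal_left pd_var_mult lin c ..
    also have "\<dots> = scal (ksign \<epsilon> (gpar g)) * ?D (pd g (var h * f))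
        + (\<Sum>h'\<in>H. scal (c h') * pd h' (var h * f))"
      unfolding S unfolding pd_var_mult var.IH sder_add[OF hom] sder_scal_left[OF hom] sder_Leibniz[OF hom]
      by (cases "h = g")
         (simp_all add: distrib_left var_scal_left scal_mult_left sder_0[OF hom] ksign_neq
           ksign_commute[of "gpar g" \<epsilon>] mult_ac(1-3)[where ?'a = complex] add_ac)
    finally show ?case .
  qed
qed

section \<open>Contraction with inner products\<close>

lemma pd_var: "pd g (var h) = (if h = g then 1 else 0)"
  using pd_var_mult[of g h 1] pd_scal[of g 1] by simp

lemma pd_X_glV:
  assumes A: "qop (Idx n) (Idx n) (\<epsilon>, A)"
  shows "pd (X t i) (sder \<epsilon> (glV_gen n \<epsilon> A) f) =
    scal (ksign \<epsilon> (ipar i)) * sder \<epsilon> (glV_gen n \<epsilon> A) (pd (X t i) f)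
    + (\<Sum>j\<in>Idx n. scal (A i j) * pd (X t j) f)"
proof -
  let ?c = "\<lambda>h. case h of X t' j \<Rightarrow> A i j | Xs j s \<Rightarrow> 0"
  have A': "A i j \<noteq> 0 \<Longrightarrow> i \<in> Idx n \<and> j \<in> Idx n" for i j using A by (auto simp: qop_def)
  have "pd (X t i) (abs_salg (glV_gen n \<epsilon> A h)) = scal (if h \<in> X t ` Idx n then ?c h else 0)" for h
  proof (cases h)
    case (X t' j)
    have "pd (X t i) (abs_salg (glV_gen n \<epsilon> A h)) =
      (\<Sum>l\<in>Idx n. if i = l then (if t' = t then scal (A i j) else 0) else 0)"
      unfolding X abs_glV_gen_X pd_sum pd_scal_left by (intro sum.cong refl) (auto simp: pd_var)
    also have "\<dots> = scal (if t' = t then A i j else 0)"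
      using A'[of i j] by (cases "A i j = 0") (auto simp: finite_Idx)
    also have "(if t' = t then A i j else 0) = (if h \<in> X t ` Idx n then ?c h else 0)"
      using A'[of i j] by (auto simp: X)
    finally show ?thesis .
  next
    case (Xs j s)
    show ?thesis unfolding Xs abs_glV_gen_Xs pd_sum pd_scal_left pd_var by auto
  qed
  moreover have "gpar h = (gpar (X t i) \<noteq> \<epsilon>)" if "?c h \<noteq> 0" for h
    using that A by (auto simp: qop_def mhom_def split: gen.splits)
  ultimately have "pd (X t i) (sder \<epsilon> (glV_gen n \<epsilon> A) f) =
    scal (ksign \<epsilon> (gpar (X t i))) * sder \<epsilon> (glV_gen n \<epsilon> A) (pd (X t i) f)
    + (\<Sum>h\<in>X t ` Idx n. scal (?c h) * pd h f)"
    using finite_Idx by (intro pd_glV[OF A]) auto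
  then show ?thesis by (simp add: sum.reindex inj_on_def)
qed

lemma pd_Xs_glV:
  assumes A: "qop (Idx n) (Idx n) (\<epsilon>, A)"
  shows "pd (Xs j s) (sder \<epsilon> (glV_gen n \<epsilon> A) f) =
    scal (ksign \<epsilon> (ipar j)) * sder \<epsilon> (glV_gen n \<epsilon> A) (pd (Xs j s) f)
    + (\<Sum>i\<in>Idx n. scal (- ksign \<epsilon> (ipar i) * A i j) * pd (Xs i s) f)"
proof -
  let ?c = "\<lambda>h. case h of X t i \<Rightarrow> 0 | Xs i s' \<Rightarrow> - ksign \<epsilon> (ipar i) * A i j"
  have A': "A i j \<noteq> 0 \<Longrightarrow> i \<in> Idx n \<and> j \<in> Idx n" for i j using A by (auto simp: qop_def)
  have "pd (Xs j s) (abs_salg (glV_gen n \<epsilon> A h)) = scal (if h \<in> (\<lambda>i. Xs i s) ` Idx n then ?c h else 0)" for h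
  proof (cases h)
    case (Xs i s')
    have "pd (Xs j s) (abs_salg (glV_gen n \<epsilon> A h)) =
      (\<Sum>l\<in>Idx n. if j = l then (if s' = s then scal (- ksign \<epsilon> (ipar i) * A i j) else 0) else 0)"
      unfolding Xs abs_glV_gen_Xs pd_sum pd_scal_left by (intro sum.cong refl) (auto simp: pd_var)
    also have "\<dots> = scal (if s' = s then - ksign \<epsilon> (ipar i) * A i j else 0)"
      using A'[of i j] by (cases "A i j = 0") (auto simp: finite_Idx)
    also have "(if s' = s then - ksign \<epsilon> (ipar i) * A i j else 0) =
        (if h \<in> (\<lambda>i. Xs i s) ` Idx n then ?c h else 0)"
      using A'[of i j] by (auto simp: Xs)
    finally show ?thesis .
  next
    case (X t i)
    show ?thesis unfolding X abs_glV_gen_X pd_sum pd_scal_left pd_var by auto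
  qed
  moreover have "gpar h = (gpar (Xs j s) \<noteq> \<epsilon>)" if "?c h \<noteq> 0" for h
    using that A by (auto simp: qop_def mhom_def split: gen.splits)
  ultimately have "pd (Xs j s) (sder \<epsilon> (glV_gen n \<epsilon> A) f) =
    scal (ksign \<epsilon> (gpar (Xs j s))) * sder \<epsilon> (glV_gen n \<epsilon> A) (pd (Xs j s) f)
    + (\<Sum>h\<in>(\<lambda>i. Xs i s) ` Idx n. scal (?c h) * pd h f)"
    using finite_Idx by (intro pd_glV[OF A]) auto
  then show ?thesis by (simp add: sum.reindex inj_on_def)
qed

lemma ev0_glV:
  assumes A: "qop (Idx n) (Idx n) (\<epsilon>, A)"
  shows "ev0 (sder \<epsilon> (glV_gen n \<epsilon> A) f) = 0"
proof -
  have z: "ev0 (abs_salg (glV_gen n \<epsilon> A h)) = 0" for h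
  proof (cases h)
    case (X t i)
    show ?thesis unfolding X abs_glV_gen_X by (simp add: ev0_sum)
  next
    case (Xs i s)
    show ?thesis unfolding Xs abs_glV_gen_Xs by (simp add: ev0_sum)
  qed
  note hom = qop_homog[OF A, of n]
  show ?thesis
    by (induction f rule: salg_induct)
       (simp_all add: sder_add[OF hom] sder_scal[OF hom] sder_Leibniz[OF hom] z)
qed

text \<open>The analogue of \<open>ract\<close> for words in the dual: the matrix is transposed and
  carries the sign of \<open>glV_gen\<close> on \<open>Xs\<close>.\<close>

primrec dact :: "idx set \<Rightarrow> bool \<Rightarrow> mat \<Rightarrow> idx list \<Rightarrow> vec \<Rightarrow> complex" where
  "dact S \<epsilon> A [] F = 0"
| "dact S \<epsilon> A (j # u) F = (\<Sum>i\<in>S. - ksign \<epsilon> (ipar i) * A i j * F (i # u))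
     + ksign \<epsilon> (ipar j) * dact S \<epsilon> A u (\<lambda>u. F (j # u))"

lemma coef_Xs_glV:
  assumes A: "qop (Idx n) (Idx n) (\<epsilon>, A)" and "length u = length ss"
  shows "coef (xsword u ss) (sder \<epsilon> (glV_gen n \<epsilon> A) f) =
    dact (Idx n) \<epsilon> A u (\<lambda>u. coef (xsword u ss) f)"
  using assms(2)
proof (induction u ss arbitrary: f rule: list_induct2)
  case (Cons j u s ss)
  then show ?case
    by (simp only: xsword_simps coef.simps pd_Xs_glV[OF A] coef_add coef_sum coef_scal_left
        dact.simps add.commute)
qed (simp add: ev0_glV[OF A])

text \<open>Each derivative commuted past the action contributes one letter of the tensor action;
  the sign \<open>ksign \<epsilon> (wpar w)\<close> comes from passing the derivatives of
  \<open>w\<close>, and the last term drops out because the action produces no constant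
  term.\<close>

lemma coef_glV:
  assumes A: "qop (Idx n) (Idx n) (\<epsilon>, A)" and "length w = length ts" "length u = length ss"
  shows "coef (xword ts w @ xsword u ss) (sder \<epsilon> (glV_gen n \<epsilon> A) f) =
    ract (Idx n) \<epsilon> A w (\<lambda>w. coef (xword ts w @ xsword u ss) f) +
    ksign \<epsilon> (wpar w) * dact (Idx n) \<epsilon> A u (\<lambda>u. coef (xword ts w @ xsword u ss) f)"
  using assms(2)
proof (induction w ts arbitrary: f rule: list_induct2)
  case (Cons i w t ts)
  then show ?case
    by (simp add: pd_X_glV[OF A] coef_add coef_sum coef_scal_left ksign_neq distrib_left mult.assoc)
qed (simp add: coef_Xs_glV[OF A assms(3)])

lemma coef_invariant:
  assumes "f \<in> invariants n k p (\<qq> n)" and A: "qop (Idx n) (Idx n) (\<epsilon>, A)"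
    and "length w = length ts" "length u = length ss"
  shows "ract (Idx n) \<epsilon> A w (\<lambda>w. coef (xword ts w @ xsword u ss) f) =
    - ksign \<epsilon> (wpar w) * dact (Idx n) \<epsilon> A u (\<lambda>u. coef (xword ts w @ xsword u ss) f)"
proof -
  have "sder \<epsilon> (glV_gen n \<epsilon> A) f = glV n A f" using glV_eq_sder[OF qop_hpart[OF A]] by simp
  also have "\<dots> = 0" using assms(1) qop_qq[OF A] by (auto simp: invariants_def)
  finally show ?thesis using coef_glV[OF A assms(3,4), of f] by (simp add: eq_neg_iff_add_eq_0)
qed

lemma ract_identity:
  assumes "set w \<subseteq> S" "finite S"
  shows "ract S False (\<lambda>i j. if i = j \<and> i \<in> S then 1 else 0) w F = of_nat (length w) * F w"
  using assms(1)
proof (induction w arbitrary: F)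
  case (Cons i w)
  have "(\<Sum>j\<in>S. (if i = j \<and> i \<in> S then 1 else 0) * F (j # w)) = (\<Sum>j\<in>S. if i = j then F (j # w) else 0)"
    using Cons.prems by (intro sum.cong) auto
  also have "\<dots> = F (i # w)" using Cons.prems assms(2) by simp
  finally show ?case using Cons by (simp add: algebra_simps)
qed simp

lemma dact_identity:
  assumes "set u \<subseteq> S" "finite S"
  shows "dact S False (\<lambda>i j. if i = j \<and> i \<in> S then 1 else 0) u F = - of_nat (length u) * F u"
  using assms(1)
proof (induction u arbitrary: F)
  case (Cons j u)
  have "(\<Sum>i\<in>S. - ksign False (ipar i) * (if i = j \<and> i \<in> S then 1 else 0) * F (i # u)) =
    (\<Sum>i\<in>S. if i = j then - F (i # u) else 0)"
    by (intro sum.cong) auto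
  also have "\<dots> = - F (j # u)" using Cons.prems assms(2) by simp
  finally show ?case using Cons by (simp add: algebra_simps)
qed simp

lemma coef_invariant_eq_0:
  assumes "f \<in> invariants n k p (\<qq> n)" "length ts \<noteq> length ss"
    and "w \<in> words (Idx n) (length ts)" "u \<in> words (Idx n) (length ss)"
  shows "coef (xword ts w @ xsword u ss) f = 0"
proof -
  let ?A = "\<lambda>i j. if i = j \<and> i \<in> Idx n then 1 else 0"
  have q: "qop (Idx n) (Idx n) (False, ?A)" by (auto simp: qop_def mhom_def bar_eq_iff)
  have "of_nat (length ts) * coef (xword ts w @ xsword u ss) f =
      of_nat (length ss) * coef (xword ts w @ xsword u ss) f"
    using coef_invariant[OF assms(1) q, of w ts u ss] assms(3,4)
    by (simp add: ract_identity dact_identity finite_Idx words_def)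
  then show ?thesis using assms(2) by simp
qed

text \<open>In closed form: the Koszul sign of reversing the word, times -1 for each odd
  letter.\<close>

primrec chi :: "idx list \<Rightarrow> complex" where
  "chi [] = 1"
| "chi (i # u) = chi u * ksign (ipar i) (\<not> wpar u)"

text \<open>The Koszul sign of reversing the word. It accumulates when dual letters are moved to the
  right one after another, the last letter of the word first.\<close>

primrec rev_sign :: "idx list \<Rightarrow> complex" where
  "rev_sign [] = 1"
| "rev_sign (i # u) = rev_sign u * ksign (ipar i) (wpar u)"

lemma rev_sign_eq: "rev_sign u = chi u * ksign (wpar u) (wpar u)"
proof (induction u)
  case (Cons i u)
  then show ?case by (cases "ipar i"; cases "wpar u") simp_all
qed simp

lemma chi_sq: "chi u * chi u = 1"
proof (induction u)
  case (Cons i u)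
  have "chi (i # u) * chi (i # u) = (chi u * chi u) * (ksign (ipar i) (\<not> wpar u) * ksign (ipar i) (\<not> wpar u))"
    by (simp only: chi.simps mult_ac)
  then show ?case using Cons by (simp only: ksign_sq mult_1_right)
qed simp

text \<open>The sign \<open>chi\<close> turns the dual action on words into right multiplication of matrices.\<close>

lemma ract_transpose_chi:
  assumes A: "mhom \<epsilon> A"
  shows "ract S \<epsilon> (\<lambda>i j. A j i) u (\<lambda>u. chi u * F u) = - chi u * ksign \<epsilon> (wpar u) * dact S \<epsilon> A u F"
proof (induction u arbitrary: F)
  case (Cons j u)
  have A': "mhom \<epsilon> (\<lambda>i j. A j i)" using A by (auto simp: mhom_def)
  have "ract S \<epsilon> (\<lambda>i j. A j i) u (\<lambda>u. chi (j # u) * F (j # u)) =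
     ract S \<epsilon> (\<lambda>i j. A j i) u (\<lambda>u. ksign (ipar j) (\<not> wpar u) * (chi u * F (j # u)))"
    by (simp add: mult_ac)
  also have "\<dots> = ksign (ipar j) (\<not> (wpar u \<noteq> \<epsilon>)) * (- chi u * ksign \<epsilon> (wpar u) * dact S \<epsilon> A u (\<lambda>u. F (j # u)))"
    unfolding ract_parity[OF A', of S u "\<lambda>b. ksign (ipar j) (\<not> b)"] Cons.IH ..
  finally have 1: "ksign \<epsilon> (ipar j) * ract S \<epsilon> (\<lambda>i j. A j i) u (\<lambda>u. chi (j # u) * F (j # u)) =
     - chi (j # u) * ksign \<epsilon> (wpar (j # u)) * (ksign \<epsilon> (ipar j) * dact S \<epsilon> A u (\<lambda>u. F (j # u)))"
    by (cases \<epsilon>; cases "ipar j"; cases "wpar u") simp_all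
  have 2: "A i j * (chi (i # u) * F (i # u)) =
     - chi (j # u) * ksign \<epsilon> (wpar (j # u)) * (- ksign \<epsilon> (ipar i) * A i j * F (i # u))" for i
  proof (cases "A i j = 0")
    case False
    then have "ipar j = (ipar i \<noteq> \<epsilon>)" by (rule mhomD[OF A])
    then show ?thesis by (cases \<epsilon>; cases "ipar i"; cases "wpar u") simp_all
  qed simp
  show ?case
    unfolding ract.simps(2) dact.simps(2) distrib_left sum_distrib_left
    by (simp only: 1 2)
qed simp

lemma ract_mono_set:
  assumes "S \<subseteq> S'" "finite S'" "\<And>i j. A i j \<noteq> 0 \<Longrightarrow> j \<in> S"
  shows "ract S' \<epsilon> A w f = ract S \<epsilon> A w f"
proof (induction w arbitrary: f)
  case (Cons i w)
  have "(\<Sum>j\<in>S'. A i j * f (j # w)) = (\<Sum>j\<in>S. A i j * f (j # w))"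
    using assms by (intro sum.mono_neutral_right) auto
  then show ?case using Cons by simp
qed simp

text \<open>The part of a contraction in the letters of V. The index set may contain new indices:
  \<open>gen\<close> has letters for all of them, so V is enlarged without leaving
  \<open>salg\<close>.\<close>

primrec ten :: "idx set \<Rightarrow> nat list \<Rightarrow> vec \<Rightarrow> salg" where
  "ten J [] f = scal (f [])"
| "ten J (t # ts) f = (\<Sum>j\<in>J. var (X t j) * ten J ts (\<lambda>w. f (j # w)))"

definition xsprod :: "idx list \<Rightarrow> nat list \<Rightarrow> salg" where
  "xsprod u ss = foldr (\<lambda>g f. var g * f) (xsword u ss) 1"

lemma xsprod_simps [simp]:
  "xsprod u [] = 1" "xsprod (i # u) (s # ss) = var (Xs i s) * xsprod u ss"
  by (simp_all add: xsprod_def)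

lemma ten_add: "ten J ts (\<lambda>w. f w + g w) = ten J ts f + ten J ts g"
  by (induction ts arbitrary: f g) (simp_all add: scal_add distrib_left sum.distrib)

lemma ten_cmult: "ten J ts (\<lambda>w. c * f w) = scal c * ten J ts f"
  by (induction ts arbitrary: f) (simp_all add: scal_mult var_scal_left sum_distrib_left)

lemma ten_0 [simp]: "ten J ts (\<lambda>w. 0) = 0"
  by (induction ts) simp_all

lemma ten_sum: "ten J ts (\<lambda>w. \<Sum>x\<in>Y. f x w) = (\<Sum>x\<in>Y. ten J ts (f x))"
  by (induction Y rule: infinite_finite_induct) (simp_all add: ten_add)

lemma ten_cong: "(\<And>w. w \<in> words J (length ts) \<Longrightarrow> f w = g w) \<Longrightarrow> ten J ts f = ten J ts g"
proof (induction ts arbitrary: f g)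
  case (Cons t ts)
  have "ten J ts (\<lambda>w. f (j # w)) = ten J ts (\<lambda>w. g (j # w))" if "j \<in> J" for j
    using that Cons.prems by (intro Cons.IH) simp
  then show ?case by simp
qed simp

lemma ten_mono_set:
  assumes "I \<subseteq> J" "finite J" "\<And>w. w \<in> words J (length ts) \<Longrightarrow> \<not> set w \<subseteq> I \<Longrightarrow> f w = 0"
  shows "ten I ts f = ten J ts f"
  using assms(3)
proof (induction ts arbitrary: f)
  case (Cons t ts)
  have "ten I ts (\<lambda>w. f (j # w)) = ten J ts (\<lambda>w. f (j # w))" if "j \<in> I" for j
    using that assms(1) by (intro Cons.IH Cons.prems) auto
  then have "ten I (t # ts) f = (\<Sum>j\<in>I. var (X t j) * ten J ts (\<lambda>w. f (j # w)))" by simp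
  also have "\<dots> = (\<Sum>j\<in>J. var (X t j) * ten J ts (\<lambda>w. f (j # w)))"
  proof (rule sum.mono_neutral_left)
    show "\<forall>j\<in>J - I. var (X t j) * ten J ts (\<lambda>w. f (j # w)) = 0"
    proof
      fix j assume j: "j \<in> J - I"
      have "ten J ts (\<lambda>w. f (j # w)) = ten J ts (\<lambda>w. 0)"
        using j by (intro ten_cong Cons.prems) auto
      then show "var (X t j) * ten J ts (\<lambda>w. f (j # w)) = 0" by simp
    qed
  qed (use assms in auto)
  finally show ?case by simp
qed simp

lemma con2_eq:
  assumes "finite I"
  shows "con2 I ss F = (\<Sum>u\<in>words I (length ss). scal (F u) * xsprod u ss)"
  by (induction ss arbitrary: F) (simp_all add: sum_words_Suc[OF assms] var_scal_left sum_distrib_left)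

lemma con1_eq:
  assumes "finite I"
  shows "con1 I ts ss F = (\<Sum>u\<in>words I (length ss). ten I ts (\<lambda>w. F w u) * xsprod u ss)"
proof (induction ts arbitrary: F)
  case (Cons t ts)
  have "con1 I (t # ts) ss F =
    (\<Sum>i\<in>I. \<Sum>u\<in>words I (length ss). var (X t i) * (ten I ts (\<lambda>w. F (i # w) u) * xsprod u ss))"
    by (simp add: Cons.IH sum_distrib_left)
  also have "\<dots> =
    (\<Sum>u\<in>words I (length ss). \<Sum>i\<in>I. var (X t i) * (ten I ts (\<lambda>w. F (i # w) u) * xsprod u ss))"
    by (rule sum.swap)
  finally show ?case by (simp add: sum_distrib_right mult.assoc)
qed (simp add: con2_eq[OF assms])

section \<open>Parities of coefficient vectors and the signs they cause\<close>

definition parity_hom :: "bool \<Rightarrow> vec \<Rightarrow> bool" where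
  "parity_hom P f \<longleftrightarrow> (\<forall>w. f w \<noteq> 0 \<longrightarrow> wpar w = P)"

lemma parity_hom_Cons: "parity_hom P f \<Longrightarrow> parity_hom (ipar i \<noteq> P) (\<lambda>w. f (i # w))"
  by (auto simp: parity_hom_def)

lemma parity_hom_ract:
  assumes "mhom \<epsilon> A" "parity_hom P f"
  shows "parity_hom (P \<noteq> \<epsilon>) (\<lambda>w. ract S \<epsilon> A w f)"
  unfolding parity_hom_def
proof (intro allI impI)
  fix w assume nz: "ract S \<epsilon> A w f \<noteq> 0"
  have "f = (\<lambda>w. (if wpar w = P then 1 else 0) * f w)" using assms(2) by (auto simp: parity_hom_def fun_eq_iff)
  then have "ract S \<epsilon> A w f = (if (wpar w \<noteq> \<epsilon>) = P then 1 else 0) * ract S \<epsilon> A w f"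
    using ract_parity[OF assms(1), of S w "\<lambda>b. if b = P then 1 else 0" f] by metis
  then show "wpar w = (P \<noteq> \<epsilon>)" using nz by (auto split: if_splits)
qed

lemma parity_hom_lows:
  assumes "length u = length qs" "parity_hom P f"
  shows "parity_hom (wpar u \<noteq> P) (rops S (lows u qs) f)"
  using assms(1)
proof (induction u qs rule: list_induct2)
  case Nil
  then show ?case using assms(2) by (simp add: lows_def)
next
  case (Cons i u q qs)
  have "mhom (ipar i) (snd (low i q))"
    by (auto simp: low_def mhom_def)
  from parity_hom_ract[OF this Cons.IH, of S]
  have "parity_hom ((wpar u \<noteq> P) \<noteq> ipar i) (rops S (lows (i # u) (q # qs)) f)"
    by (simp add: rop_def low_def)
  moreover have "((wpar u \<noteq> P) \<noteq> ipar i) = (wpar (i # u) \<noteq> P)" by auto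
  ultimately show ?case by simp
qed

lemma ten_var_commute:
  assumes "parity_hom P f"
  shows "var g * ten J ts f = scal (ksign (gpar g) P) * (ten J ts f * var g)"
  using assms
proof (induction ts arbitrary: f P)
  case Nil
  then show ?case
    by (cases "f [] = 0") (auto simp: parity_hom_def scal_comm)
next
  case (Cons t ts)
  have "var g * (var (X t j) * ten J ts (\<lambda>w. f (j # w))) =
      scal (ksign (gpar g) P) * (var (X t j) * (ten J ts (\<lambda>w. f (j # w)) * var g))" for j
    unfolding var_supercomm_left[of g "X t j"] Cons.IH[OF parity_hom_Cons[OF Cons.prems]]
    by (cases "gpar g"; cases "ipar j"; cases P) (simp_all add: var_scal_left scal_mult_left scal_uminus)
  then show ?case by (simp add: sum_distrib_left sum_distrib_right mult.assoc)
qed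

text \<open>Even in both cases: \<open>inner_even\<close> is even and replaces an even letter,
  \<open>inner_odd\<close> is odd and replaces an odd one. The values are spelled out as words
  because \<open>sder\<close> expects maps into the tensor algebra.\<close>

definition cder_gen :: "nat \<Rightarrow> nat \<Rightarrow> nat \<Rightarrow> gen \<Rightarrow> tens" where
  "cder_gen n q s g = (case g of
     X t i \<Rightarrow> if i = Ev q then \<Sum>i\<in>Idx n. tword [X t i, Xs i s]
       else if i = Od q then \<Sum>i\<in>Idx n. tword [X t (bar i), Xs i s] else 0
   | Xs i s' \<Rightarrow> 0)"

definition cder :: "nat \<Rightarrow> nat \<Rightarrow> nat \<Rightarrow> salg \<Rightarrow> salg" where
  "cder n q s = sder False (cder_gen n q s)"

lemma abs_cder_gen_Xs: "abs_salg (cder_gen n q s (Xs i s')) = 0"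
  by (simp add: cder_gen_def abs_salg_0)

lemma abs_tword2: "abs_salg (tword [g, h]) = var g * var h"
  by (simp add: var.abs_eq tword_mult flip: abs_salg_mult)

lemma abs_cder_gen_X: "abs_salg (cder_gen n q s (X t i)) =
    (if i = Ev q then inner_even n t s else if i = Od q then inner_odd n t s else 0)"
  by (simp add: cder_gen_def abs_salg_0 abs_salg_sum finite_Idx inner_even_def inner_odd_alt abs_tword2)

lemma inner_even_var: "inner_even n t s * var h = var h * inner_even n t s"
proof -
  have "var (X t i) * (var (Xs i s) * var h) = var h * (var (X t i) * var (Xs i s))" for i
    by (simp add: var_supercomm[of "Xs i s" h] var_supercomm_left[of "X t i" h] var_scal_left
        scal_mult_left mult.assoc)
  then show ?thesis by (simp add: inner_even_def sum_distrib_left sum_distrib_right mult.assoc)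
qed

lemma inner_odd_var:
  "inner_odd n t s * var h = scal (ksign True (gpar h)) * (var h * inner_odd n t s)"
proof -
  have "var (X t (bar i)) * (var (Xs i s) * var h) =
      scal (ksign True (gpar h)) * (var h * (var (X t (bar i)) * var (Xs i s)))" for i
    unfolding var_supercomm[of "Xs i s" h] var_supercomm_left[of "X t (bar i)" h] mult.assoc var_scal_left
    by (cases "ipar i"; cases "gpar h") (simp_all add: scal_mult_left scal_uminus)
  then show ?thesis by (simp add: inner_odd_alt sum_distrib_left sum_distrib_right mult.assoc)
qed

lemma homog_cder: "homog False (cder_gen n q s)"
proof (rule homogI)
  fix g h
  show "abs_salg (cder_gen n q s g) * var h =
    scal (ksign (gpar g \<noteq> False) (gpar h)) * (var h * abs_salg (cder_gen n q s g))"
    by (cases g) (simp_all add: abs_cder_gen_X abs_cder_gen_Xs inner_even_var inner_odd_var)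
qed

lemma cder_X: "cder n q s (var (X t i)) =
    (if i = Ev q then inner_even n t s else if i = Od q then inner_odd n t s else 0)"
  by (simp only: cder_def sder_var[OF homog_cder] abs_cder_gen_X)

lemma cder_Xs: "cder n q s (var (Xs i s')) = 0"
  by (simp only: cder_def sder_var[OF homog_cder] abs_cder_gen_Xs)

lemma cder_mult: "cder n q s (f * g) = cder n q s f * g + f * cder n q s g"
  unfolding cder_def by (rule sder_mult[OF homog_cder])

lemma cder_sum: "cder n q s (\<Sum>x\<in>S. f x) = (\<Sum>x\<in>S. cder n q s (f x))"
  unfolding cder_def by (rule sder_sum[OF homog_cder])

lemma cder_add: "cder n q s (f + g) = cder n q s f + cder n q s g"
  unfolding cder_def by (rule sder_add[OF homog_cder])

lemma cder_scal: "cder n q s (scal c) = 0"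
  unfolding cder_def by (rule sder_scal[OF homog_cder])

lemma cder_scal_left: "cder n q s (scal c * f) = scal c * cder n q s f"
  unfolding cder_def by (rule sder_scal_left[OF homog_cder])

text \<open>Inner products involve old indices only, so a later derivation does not touch those
  already produced.\<close>

lemma cder_inner:
  assumes "n < q"
  shows "cder n q s (inner_even n t s') = 0" "cder n q s (inner_odd n t s') = 0"
proof -
  have "i \<noteq> Ev q \<and> i \<noteq> Od q" if "i \<in> Idx n" for i using that assms by (auto simp: Idx_def)
  then show "cder n q s (inner_even n t s') = 0" "cder n q s (inner_odd n t s') = 0"
    by (auto simp: inner_even_def inner_odd_alt cder_sum cder_mult cder_X cder_Xs intro!: sum.neutral)
qed

lemma cder_xsprod: "length u = length ss \<Longrightarrow> cder n q s (xsprod u ss) = 0"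
proof (induction u ss rule: list_induct2)
  case Nil
  then show ?case using cder_scal[of n q s 1] by simp
qed (simp add: cder_mult cder_Xs)

text \<open>Both sides change one letter at a time. Moving the new dual letter to the far right
  costs the parity of the letters after it, which is \<open>P\<close> corrected by the prefix and by
  the removed letter. The prefix accounts for the Koszul sign in \<open>rop\<close>, a removed
  \<open>Od q\<close> for the sign in the second entry of \<open>low\<close>.\<close>

lemma cder_ten:
  assumes "parity_hom P f" "n < q" "q \<le> N"
  shows "cder n q s (ten (Idx N) ts f) =
    (\<Sum>i\<in>Idx n. scal (ksign (ipar i) P) * (ten (Idx N) ts (rop (Idx N) (low i q) f) * var (Xs i s)))"
  using assms(1)
proof (induction ts arbitrary: f P)
  case Nil
  then show ?case by (simp add: cder_scal rop_def)
next
  case (Cons t ts)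
  let ?J = "Idx N"
  let ?F = "\<lambda>j. ten ?J ts (\<lambda>w. f (j # w))"
  let ?R = "\<lambda>i j. ten ?J ts (rop ?J (low i q) (\<lambda>w. f (j # w)))"
  have mem: "Ev q \<in> ?J" "Od q \<in> ?J" using assms by (auto simp: Idx_def)
  \<comment> \<open>The first letter is split off: it is lowered from \<open>Ev q\<close>, lowered
    from \<open>Od q\<close>, or left in place.\<close>
  have step: "ten ?J (t # ts) (rop ?J (low i q) f) =
     var (X t i) * ?F (Ev q) + scal (ksign (ipar i) True) * (var (X t (bar i)) * ?F (Od q))
     + (\<Sum>j\<in>?J. scal (ksign (ipar i) (ipar j)) * (var (X t j) * ?R i j))"
    if i: "i \<in> Idx n" for i
  proof -
    have iJ: "i \<in> ?J" "bar i \<in> ?J" "bar i \<noteq> i" using i assms ipar_bar[of i] by (auto simp: Idx_def)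
    have "ten ?J (t # ts) (rop ?J (low i q) f) =
      (\<Sum>j\<in>?J. var (X t j) * (\<Sum>l\<in>?J. scal (snd (low i q) j l) * ?F l))
      + (\<Sum>j\<in>?J. var (X t j) * (scal (ksign (ipar i) (ipar j)) * ?R i j))"
      by (simp add: rop_def ten_add ten_sum ten_cmult distrib_left sum.distrib low_def)
    also have "(\<Sum>j\<in>?J. var (X t j) * (\<Sum>l\<in>?J. scal (snd (low i q) j l) * ?F l)) =
       (\<Sum>j\<in>?J. (if j = i then var (X t i) * ?F (Ev q) else 0) +
         (if j = bar i then scal (ksign (ipar i) True) * (var (X t (bar i)) * ?F (Od q)) else 0))"
    proof (intro sum.cong refl)
      fix j
      have "(\<Sum>l\<in>?J. scal (snd (low i q) j l) * ?F l) =
        (\<Sum>l\<in>?J. (if l = Ev q then (if j = i then ?F l else 0) else 0) +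
          (if l = Od q then (if j = bar i then scal (ksign (ipar i) True) * ?F l else 0) else 0))"
        by (intro sum.cong refl) (auto simp: low_def)
      also have "\<dots> = (if j = i then ?F (Ev q) else 0) +
          (if j = bar i then scal (ksign (ipar i) True) * ?F (Od q) else 0)"
        using mem by (simp add: sum.distrib finite_Idx)
      finally show "var (X t j) * (\<Sum>l\<in>?J. scal (snd (low i q) j l) * ?F l) =
        (if j = i then var (X t i) * ?F (Ev q) else 0) +
         (if j = bar i then scal (ksign (ipar i) True) * (var (X t (bar i)) * ?F (Od q)) else 0)"
        by (auto simp: distrib_left var_scal_left)
    qed
    also have "\<dots> = var (X t i) * ?F (Ev q) + scal (ksign (ipar i) True) * (var (X t (bar i)) * ?F (Od q))"
      using iJ by (simp add: sum.distrib finite_Idx)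
    finally show ?thesis by (simp add: var_scal_left)
  qed
  have "cder n q s (ten ?J (t # ts) f) =
      (\<Sum>j\<in>?J. cder n q s (var (X t j)) * ?F j) + (\<Sum>j\<in>?J. var (X t j) * cder n q s (?F j))"
    by (simp add: cder_sum cder_mult sum.distrib)
  also have "(\<Sum>j\<in>?J. cder n q s (var (X t j)) * ?F j) =
      (\<Sum>j\<in>?J. (if j = Ev q then inner_even n t s * ?F j else 0) + (if j = Od q then inner_odd n t s * ?F j else 0))"
    by (intro sum.cong refl) (auto simp: cder_X)
  also have "\<dots> = inner_even n t s * ?F (Ev q) + inner_odd n t s * ?F (Od q)"
    using mem by (simp add: sum.distrib finite_Idx)
  also have "\<dots> = (\<Sum>i\<in>Idx n. scal (ksign (ipar i) P) * (var (X t i) * (?F (Ev q) * var (Xs i s))))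
     + (\<Sum>i\<in>Idx n. scal (ksign (ipar i) P * ksign (ipar i) True) * (var (X t (bar i)) * (?F (Od q) * var (Xs i s))))"
    unfolding inner_even_def inner_odd_alt sum_distrib_right mult.assoc
      ten_var_commute[OF parity_hom_Cons[OF Cons.prems]] var_scal_left
    by (intro arg_cong2[of _ _ _ _ "(+)"] sum.cong refl) (simp_all add: ksign_def)
  also have "(\<Sum>j\<in>?J. var (X t j) * cder n q s (?F j)) =
    (\<Sum>j\<in>?J. \<Sum>i\<in>Idx n. scal (ksign (ipar i) P * ksign (ipar i) (ipar j)) * (var (X t j) * (?R i j * var (Xs i s))))"
    unfolding Cons.IH[OF parity_hom_Cons[OF Cons.prems]] sum_distrib_left var_scal_left
    by (intro sum.cong refl) (simp add: ksign_neq mult.commute)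
  also have "\<dots> = (\<Sum>i\<in>Idx n. \<Sum>j\<in>?J. scal (ksign (ipar i) P * ksign (ipar i) (ipar j)) * (var (X t j) * (?R i j * var (Xs i s))))"
    by (rule sum.swap)
  finally have L: "cder n q s (ten ?J (t # ts) f) =
     (\<Sum>i\<in>Idx n. scal (ksign (ipar i) P) * (var (X t i) * (?F (Ev q) * var (Xs i s))))
     + (\<Sum>i\<in>Idx n. scal (ksign (ipar i) P * ksign (ipar i) True) * (var (X t (bar i)) * (?F (Od q) * var (Xs i s))))
     + (\<Sum>i\<in>Idx n. \<Sum>j\<in>?J. scal (ksign (ipar i) P * ksign (ipar i) (ipar j)) * (var (X t j) * (?R i j * var (Xs i s))))" .
  show ?case
    unfolding L sum.distrib[symmetric]
  proof (rule sum.cong[OF refl])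
    fix i assume i: "i \<in> Idx n"
    show "scal (ksign (ipar i) P) * (var (X t i) * (?F (Ev q) * var (Xs i s)))
     + scal (ksign (ipar i) P * ksign (ipar i) True) * (var (X t (bar i)) * (?F (Od q) * var (Xs i s)))
     + (\<Sum>j\<in>?J. scal (ksign (ipar i) P * ksign (ipar i) (ipar j)) * (var (X t j) * (?R i j * var (Xs i s)))) =
     scal (ksign (ipar i) P) * (ten ?J (t # ts) (rop ?J (low i q) f) * var (Xs i s))"
      unfolding step[OF i]
      by (simp add: distrib_left distrib_right sum_distrib_left sum_distrib_right mult.assoc scal_mult_left)
  qed
qed

text \<open>\<open>l\<close> counts the letters of V not yet absorbed into an inner product. Their
  index is unrestricted, so that new indices are allowed, and \<open>cder\<close> lowers a positive
  \<open>l\<close> by one.\<close>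

inductive xfilt :: "nat \<Rightarrow> nat \<Rightarrow> nat \<Rightarrow> nat \<Rightarrow> salg \<Rightarrow> bool" for n k p where
  scal: "xfilt n k p 0 (scal c)"
| zero: "xfilt n k p l 0"
| add: "xfilt n k p l f \<Longrightarrow> xfilt n k p l g \<Longrightarrow> xfilt n k p l (f + g)"
| even: "xfilt n k p l f \<Longrightarrow> t \<in> {1..k} \<Longrightarrow> s \<in> {1..p} \<Longrightarrow> xfilt n k p l (inner_even n t s * f)"
| odd: "xfilt n k p l f \<Longrightarrow> t \<in> {1..k} \<Longrightarrow> s \<in> {1..p} \<Longrightarrow> xfilt n k p l (inner_odd n t s * f)"
| var: "xfilt n k p l f \<Longrightarrow> t \<in> {1..k} \<Longrightarrow> xfilt n k p (Suc l) (var (X t i) * f)"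

lemma xfilt_0: "xfilt n k p l f \<Longrightarrow> l = 0 \<Longrightarrow> f \<in> inner_alg n k p"
  by (induction rule: xfilt.induct) (auto intro: inner_alg.intros inner_alg_0)

lemma xfilt_cder:
  assumes "xfilt n k p l f" "n < q" "s \<in> {1..p}"
  shows "case l of 0 \<Rightarrow> cder n q s f = 0 | Suc l' \<Rightarrow> xfilt n k p l' (cder n q s f)"
  using assms(1)
proof (induction rule: xfilt.induct)
  case (zero l)
  then show ?case using cder_scal[of n q s 0] by (auto split: nat.splits intro: xfilt.zero)
next
  case (var l f t i)
  then show ?case using assms(3)
    by (cases l) (auto simp: cder_mult cder_X intro!: xfilt.intros(2-))
qed (auto simp: cder_scal cder_add cder_mult cder_inner[OF assms(2)] split: nat.splits intro: xfilt.intros)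

lemma xfilt_sum: "(\<And>x. x \<in> S \<Longrightarrow> xfilt n k p l (f x)) \<Longrightarrow> xfilt n k p l (sum f S)"
  by (induction S rule: infinite_finite_induct) (auto intro: xfilt.intros)

lemma xfilt_ten: "set ts \<subseteq> {1..k} \<Longrightarrow> xfilt n k p (length ts) (ten J ts f)"
  by (induction ts arbitrary: f) (auto intro!: xfilt_sum xfilt.scal xfilt.var)

text \<open>The sign is what repeated use of \<open>cder_ten\<close> accumulates: each dual letter
  passes the V part, whose parity is \<open>P\<close> shifted by the letters lowered before.\<close>

definition contraction ::
  "nat \<Rightarrow> nat \<Rightarrow> nat list \<Rightarrow> bool \<Rightarrow> vec \<Rightarrow> nat list \<Rightarrow> nat list \<Rightarrow> salg" where
  "contraction n N ts P g qs ss = (\<Sum>u\<in>words (Idx n) (length ss).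
     scal (rev_sign u * ksign P (wpar u)) * (ten (Idx N) ts (rops (Idx N) (lows u qs) g) * xsprod u ss))"

text \<open>
  Summing the lowering of \<open>q\<close> against a new dual letter is the derivation \<open>cder\<close>, which trades
  a letter with index \<open>q\<close> for an inner product.
\<close>

lemma contraction_Cons:
  assumes "parity_hom P g" "n < q" "q \<le> N" "length qs = length ss"
  shows "contraction n N ts P g (q # qs) (s # ss) = cder n q s (contraction n N ts P g qs ss)"
proof -
  let ?T = "\<lambda>i u. ten (Idx N) ts (rop (Idx N) (low i q) (rops (Idx N) (lows u qs) g))"
  have "cder n q s (contraction n N ts P g qs ss) =
    (\<Sum>u\<in>words (Idx n) (length ss). \<Sum>i\<in>Idx n.
      scal (rev_sign (i # u) * ksign P (wpar (i # u))) * (?T i u * xsprod (i # u) (s # ss)))"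
    unfolding contraction_def cder_sum
  proof (rule sum.cong[OF refl])
    fix u assume u: "u \<in> words (Idx n) (length ss)"
    then have "length u = length qs" "length u = length ss" using assms by (auto simp: words_def)
    note h = parity_hom_lows[OF this(1) assms(1), of "Idx N"] and x = cder_xsprod[OF this(2)]
    have k: "rev_sign u * ksign P (wpar u) * ksign (ipar i) (wpar u \<noteq> P) =
        rev_sign (i # u) * ksign P (wpar (i # u))" for i
      by (cases "ipar i"; cases P; cases "wpar u") simp_all
    show "cder n q s (scal (rev_sign u * ksign P (wpar u)) *
        (ten (Idx N) ts (rops (Idx N) (lows u qs) g) * xsprod u ss)) =
      (\<Sum>i\<in>Idx n. scal (rev_sign (i # u) * ksign P (wpar (i # u))) * (?T i u * xsprod (i # u) (s # ss)))"
      unfolding cder_scal_left cder_mult x cder_ten[OF h assms(2,3)] k[symmetric] xsprod_simps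
      by (simp only: cder_scal mult_zero_left add_0_left mult_zero_right add_0_right sum_distrib_left
          sum_distrib_right mult.assoc scal_mult_left)
  qed
  also have "\<dots> = (\<Sum>i\<in>Idx n. \<Sum>u\<in>words (Idx n) (length ss).
      scal (rev_sign (i # u) * ksign P (wpar (i # u))) * (?T i u * xsprod (i # u) (s # ss)))"
    by (rule sum.swap)
  finally show ?thesis
    by (simp only: contraction_def length_Cons sum_words_Suc[OF finite_Idx] lows_Cons rops.simps)
qed

lemma contraction_in_inner_alg:
  assumes "parity_hom P g" "set ts \<subseteq> {1..k}" "set ss \<subseteq> {1..p}"
    and "\<forall>q\<in>set qs. n < q \<and> q \<le> N" "length ts = length ss" "length qs = length ss"
  shows "contraction n N ts P g qs ss \<in> inner_alg n k p"
proof -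
  \<comment> \<open>\<open>r\<close> is the number of letters of V left over while \<open>ss\<close>
    is still incomplete; the case needed is \<open>r = 0\<close>.\<close>
  have "xfilt n k p r (contraction n N ts P g qs ss)"
    if "length qs = length ss" "length ts = length ss + r" "set ss \<subseteq> {1..p}" "\<forall>q\<in>set qs. n < q \<and> q \<le> N" for r
    using that
  proof (induction qs ss arbitrary: r rule: list_induct2)
    case Nil
    then show ?case using xfilt_ten[OF assms(2)] by (simp add: contraction_def lows_def)
  next
    case (Cons q qs s ss)
    then have "xfilt n k p (Suc r) (contraction n N ts P g qs ss)" by auto
    from xfilt_cder[OF this, of q s] show ?case
      using Cons.prems contraction_Cons[OF assms(1) _ _ Cons.hyps] by simp
  qed
  then show ?thesis using assms(3-) by (intro xfilt_0[OF _ refl]) auto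
qed

lemma con1_invariant:
  assumes f: "f \<in> invariants n k p (\<qq> n)" and ts: "set ts \<subseteq> {1..k}" and ss: "set ss \<subseteq> {1..p}"
    and len: "length ts = length ss"
  shows "con1 (Idx n) ts ss (\<lambda>w u. coef (xword ts w @ xsword u ss) f) \<in> inner_alg n k p"
proof -
  define m where "m = length ss"
  define N where "N = n + m"
  define qs where "qs = map (\<lambda>r. n + Suc r) [0..<m]"
  let ?I = "Idx n" and ?J = "Idx N"
  let ?WI = "words ?I m" and ?WJ = "words ?J m"
  define F where "F w u = coef (xword ts w @ xsword u ss) f" for w u
  \<comment> \<open>\<open>chi u\<close> turns the dual action into the transposed one, and
    \<open>ksign (wpar w) (wpar u)\<close> absorbs the sign from passing \<open>w\<close> in
    \<open>coef_glV\<close>. Zero elsewhere gives the support condition of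
    \<open>sergeev_duality\<close>.\<close>
  define T where "T w u = (if w \<in> ?WI \<and> u \<in> ?WI then chi u * ksign (wpar w) (wpar u) * F w u else 0)" for w u
  have IJ: "?I \<subseteq> ?J" by (rule Idx_mono) (simp add: N_def)
  have lens: "length w = length ts" "length w = length ss" if "w \<in> ?WI" for w
    using that len by (auto simp: words_def m_def)
  have "\<exists>\<beta>. \<forall>w\<in>?WJ. \<forall>u\<in>?WI. T w u = (\<Sum>y\<in>?WJ. \<beta> y * rops ?J (lows u qs) (delta y) w)"
  proof (rule sergeev_duality)
    fix a :: hop and w u
    assume a: "qop ?I ?I a"
    obtain \<epsilon> A where a_eq: "a = (\<epsilon>, A)" by (cases a)
    have A: "qop ?I ?I (\<epsilon>, A)" using a a_eq by simp
    have supp: "A i j \<noteq> 0 \<Longrightarrow> i \<in> ?I \<and> j \<in> ?I" for i j using A by (auto simp: qop_def)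
    have hom: "mhom \<epsilon> A" "mhom \<epsilon> (\<lambda>i j. A j i)" using A by (auto simp: qop_def mhom_def)
    have "ract ?I \<epsilon> A w (\<lambda>w. T w u) = ract ?I \<epsilon> (\<lambda>i j. A j i) u (\<lambda>u. T w u)"
    proof (cases "w \<in> ?WI \<and> u \<in> ?WI")
      case True
      have "ract ?I \<epsilon> A w (\<lambda>w. T w u) = ract ?I \<epsilon> A w (\<lambda>w. (chi u * ksign (wpar w) (wpar u)) * F w u)"
        using True by (intro ract_words_cong[of ?I m]) (auto simp: T_def)
      also have "\<dots> = chi u * ksign (wpar w \<noteq> \<epsilon>) (wpar u) * ract ?I \<epsilon> A w (\<lambda>w. F w u)"
        by (rule ract_parity[OF hom(1), of _ _ "\<lambda>b. chi u * ksign b (wpar u)"])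
      also have "ract ?I \<epsilon> A w (\<lambda>w. F w u) = - ksign \<epsilon> (wpar w) * dact ?I \<epsilon> A u (\<lambda>u. F w u)"
        unfolding F_def using True lens by (intro coef_invariant[OF f A]) auto
      finally have L: "ract ?I \<epsilon> A w (\<lambda>w. T w u) =
        chi u * ksign (wpar w \<noteq> \<epsilon>) (wpar u) * (- ksign \<epsilon> (wpar w) * dact ?I \<epsilon> A u (\<lambda>u. F w u))" .
      have "ract ?I \<epsilon> (\<lambda>i j. A j i) u (\<lambda>u. T w u) =
          ract ?I \<epsilon> (\<lambda>i j. A j i) u (\<lambda>u. ksign (wpar w) (wpar u) * (chi u * F w u))"
        using True by (intro ract_words_cong[of ?I m]) (auto simp: T_def)
      also have "\<dots> = ksign (wpar w) (wpar u \<noteq> \<epsilon>) * (- chi u * ksign \<epsilon> (wpar u) * dact ?I \<epsilon> A u (\<lambda>u. F w u))"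
        unfolding ract_parity[OF hom(2), of _ _ "\<lambda>b. ksign (wpar w) b"] ract_transpose_chi[OF hom(1)] ..
      finally show ?thesis
        unfolding L by (cases "wpar w"; cases "wpar u"; cases \<epsilon>) simp_all
    next
      case False
      show ?thesis
      proof (cases "w \<in> ?WI")
        case True
        then have "u \<notin> ?WI" using False by simp
        then have "(\<lambda>w. T w u) = (\<lambda>w. 0)" by (auto simp: T_def)
        moreover have "ract ?I \<epsilon> (\<lambda>i j. A j i) u (\<lambda>u. T w u) = 0"
          using \<open>u \<notin> ?WI\<close> supp by (intro ract_outside_words[of ?I m]) (auto simp: T_def)
        ultimately show ?thesis by simp
      next
        case False
        then have "(\<lambda>u. T w u) = (\<lambda>u. 0)" by (auto simp: T_def)
        moreover have "ract ?I \<epsilon> A w (\<lambda>w. T w u) = 0"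
          using False supp by (intro ract_outside_words[of ?I m]) (auto simp: T_def)
        ultimately show ?thesis by simp
      qed
    qed
    then show "ract ?J (fst a) (snd a) w (\<lambda>w. T w u) = ract ?J (fst a) (\<lambda>i j. snd a j i) u (\<lambda>u. T w u)"
      using supp IJ by (simp add: a_eq ract_mono_set[of ?I ?J] finite_Idx)
  qed (auto simp: N_def qs_def T_def distinct_map inj_on_def split: if_splits)
  then obtain \<beta> where \<beta>: "\<And>w u. w \<in> ?WJ \<Longrightarrow> u \<in> ?WI \<Longrightarrow>
      T w u = (\<Sum>y\<in>?WJ. \<beta> y * rops ?J (lows u qs) (delta y) w)" by blast
  have par: "parity_hom (wpar y) (delta y)" for y by (auto simp: parity_hom_def delta_def)
  have lqs: "length qs = m" by (simp add: qs_def)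
  \<comment> \<open>A nonzero entry forces \<open>wpar w = (wpar u \<noteq> wpar y)\<close>. Then
    \<open>ksign (wpar w) (wpar u)\<close> splits into \<open>ksign (wpar u) (wpar u)\<close>, which
    turns \<open>chi u\<close> into \<open>rev_sign u\<close>, and the sign required by
    \<open>contraction\<close>.\<close>
  have T': "chi u * ksign (wpar w) (wpar u) * T w u =
      (\<Sum>y\<in>?WJ. \<beta> y * ((rev_sign u * ksign (wpar y) (wpar u)) * rops ?J (lows u qs) (delta y) w))"
    if "w \<in> ?WJ" "u \<in> ?WI" for w u
    unfolding \<beta>[OF that] sum_distrib_left
  proof (intro sum.cong refl)
    fix y
    let ?K = "rops ?J (lows u qs) (delta y) w"
    have "length u = length qs" using that lqs by (auto simp: words_def)
    from parity_hom_lows[OF this par[of y], of ?J] have "?K \<noteq> 0 \<Longrightarrow> wpar w = (wpar u \<noteq> wpar y)"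
      by (auto simp: parity_hom_def)
    then show "chi u * ksign (wpar w) (wpar u) * (\<beta> y * ?K) =
        \<beta> y * (rev_sign u * ksign (wpar y) (wpar u) * ?K)"
      unfolding rev_sign_eq by (cases "?K = 0"; cases "wpar u"; cases "wpar y") simp_all
  qed
  have "con1 ?I ts ss F = (\<Sum>u\<in>?WI. ten ?I ts (\<lambda>w. F w u) * xsprod u ss)"
    unfolding con1_eq[OF finite_Idx] m_def ..
  also have "\<dots> = (\<Sum>u\<in>?WI. (\<Sum>y\<in>?WJ. scal (\<beta> y) * (scal (rev_sign u * ksign (wpar y) (wpar u)) *
      (ten ?J ts (rops ?J (lows u qs) (delta y)) * xsprod u ss))))"
  proof (rule sum.cong[OF refl])
    fix u assume u: "u \<in> ?WI"
    have "ten ?I ts (\<lambda>w. F w u) = ten ?I ts (\<lambda>w. chi u * ksign (wpar w) (wpar u) * T w u)"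
    proof (rule ten_cong)
      fix w assume "w \<in> words ?I (length ts)"
      then have "w \<in> ?WI" using len by (simp add: m_def)
      then have "chi u * ksign (wpar w) (wpar u) * T w u =
          (chi u * chi u) * (ksign (wpar w) (wpar u) * ksign (wpar w) (wpar u)) * F w u"
        using u by (simp only: T_def mult_ac) simp
      then show "F w u = chi u * ksign (wpar w) (wpar u) * T w u" by (simp only: chi_sq ksign_sq mult_1_left)
    qed
    \<comment> \<open>\<open>T\<close> vanishes off the old words, so the index set may be enlarged
      to the one in which the lowering operators act.\<close>
    also have "\<dots> = ten ?J ts (\<lambda>w. chi u * ksign (wpar w) (wpar u) * T w u)"
      by (rule ten_mono_set[OF IJ finite_Idx]) (auto simp: T_def words_def)
    also have "\<dots> = ten ?J ts (\<lambda>w. \<Sum>y\<in>?WJ. \<beta> y * ((rev_sign u * ksign (wpar y) (wpar u)) *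
        rops ?J (lows u qs) (delta y) w))"
      by (rule ten_cong) (use T' u len m_def in auto)
    also have "\<dots> = (\<Sum>y\<in>?WJ. scal (\<beta> y) * (scal (rev_sign u * ksign (wpar y) (wpar u)) *
        ten ?J ts (rops ?J (lows u qs) (delta y))))"
      by (simp only: ten_sum ten_cmult)
    finally show "ten ?I ts (\<lambda>w. F w u) * xsprod u ss =
      (\<Sum>y\<in>?WJ. scal (\<beta> y) * (scal (rev_sign u * ksign (wpar y) (wpar u)) *
      (ten ?J ts (rops ?J (lows u qs) (delta y)) * xsprod u ss)))"
      by (simp only: sum_distrib_right mult.assoc)
  qed
  also have "\<dots> = (\<Sum>y\<in>?WJ. scal (\<beta> y) * contraction n N ts (wpar y) (delta y) qs ss)"
    by (subst sum.swap) (simp only: contraction_def sum_distrib_left m_def)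
  also have "\<dots> \<in> inner_alg n k p"
    using ts ss len lqs
    by (intro inner_alg_sum inner_alg_scal_left contraction_in_inner_alg[OF par])
       (auto simp: m_def N_def qs_def)
  finally show ?thesis unfolding F_def .
qed

lemma invariants_subset_inner_alg: "invariants n k p (\<qq> n) \<subseteq> inner_alg n k p"
proof
  fix f assume f: "f \<in> invariants n k p (\<qq> n)"
  have "con1 (Idx n) ts ss (\<lambda>w u. coef (xword ts w @ xsword u ss) f) \<in> inner_alg n k p"
    if "set ts \<subseteq> {1..k}" "set ss \<subseteq> {1..p}" for ts ss
  proof (cases "length ts = length ss")
    case True
    then show ?thesis using con1_invariant[OF f that] by simp
  next
    case False
    have "ten (Idx n) ts (\<lambda>w. coef (xword ts w @ xsword u ss) f) = ten (Idx n) ts (\<lambda>w. 0)"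
      if "u \<in> words (Idx n) (length ss)" for u
      by (rule ten_cong) (rule coef_invariant_eq_0[OF f False _ that])
    then show ?thesis by (simp add: con1_eq[OF finite_Idx] inner_alg_0)
  qed
  then have "taylor n k p a b f \<in> inner_alg n k p" for a b
    unfolding taylor_con1 by (intro inner_alg_sum) (auto simp: words_def)
  then have *: "(\<Sum>a<d. \<Sum>b<d. scal (1 / (fact a * fact b)) * taylor n k p a b f) \<in> inner_alg n k p" for d
    by (intro inner_alg_sum inner_alg_scal_left)
  have "f \<in> \<AA> n k p" using f by (simp add: invariants_def)
  then obtain d where "f = (\<Sum>a<d. \<Sum>b<d. scal (1 / (fact a * fact b)) * taylor n k p a b f)"
    using taylor_expansion by blast
  \<comment> \<open>\<open>f\<close> occurs on both sides of the equation, so it is replaced once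
    and explicitly; rewriting would loop.\<close>
  from ssubst[OF this, of "\<lambda>h. h \<in> inner_alg n k p"] show "f \<in> inner_alg n k p" using * by this
qed

theorem theorem1p5p1:
  fixes n k p :: nat
  shows "basic_set n k p (\<qq> n)
    ({inner_even n t s | t s. t \<in> {1..k} \<and> s \<in> {1..p}} \<union>
     {inner_odd n t s | t s. t \<in> {1..k} \<and> s \<in> {1..p}})"
proof -
  have "invariants n k p (\<qq> n) = inner_alg n k p"
    using invariants_subset_inner_alg inner_alg_subset_invariants by blast
  moreover have "inner_even n t s \<in> inner_alg n k p" "inner_odd n t s \<in> inner_alg n k p"
    if "t \<in> {1..k}" "s \<in> {1..p}" for t s
    using inner_alg.even[OF that inner_alg_1] inner_alg.odd[OF that inner_alg_1] by simp_all
  ultimately show ?thesis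
    unfolding basic_set_def polarization_closure_inner by auto
qed

end
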